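(* If $E$ is a complete exceptional sequence in $\operatorname{mod}\Lambda_n$, then $\operatorname{soc}E$ belongs to $\mathbf P(n)$, and the map $$\operatorname{soc}\colon \mathbf E(\operatorname{mod}\Lambda_n)\to \mathbf P(n)$$ is a bijection. Moreover, the diagram formed by the maps $$\mathbf M(\mathbf{Nc}(n+1))\xrightarrow{\ \mathbf M(A)\ }\mathbf M(\mathbf A(\operatorname{mod}\Lambda_n))\xrightarrow{\ M\ }\mathbf E(\operatorname{mod}\Lambda_n)\xrightarrow{\ \operatorname{soc}\ }\mathbf P(n)$$ and $$\lambda\colon\mathbf M(\mathbf{Nc}(n+1))\to\mathbf P(n)$$ is commutative, that is, $\lambda=\operatorname{soc}\circ M\circ\mathbf M(A)$.
   Context: $\Lambda_n$ is the path algebra over a field of the quiver $1\leftarrow 2\leftarrow\cdots\leftarrow n$, and $S(i)$ is the simple module at vertex $i$. The indecomposable $\Lambda_n$-modules are the modules $[a,b]$ with $1\le a<b\le n+1$, where $[a,b]$ has composition factors $S(a),S(a+1),\dots,S(b-1)$ (each once) and socle $S(a)$. A complete exceptional sequence is a sequence $(X_1,\dots,X_n)$ of indecomposable modules with $\operatorname{Ext}^1(X_i,X_j)=0$ for $i\ge j$ and $\operatorname{Hom}(X_i,X_j)=0$ for $i>j$; $\mathbf E(\operatorname{mod}\Lambda_n)$ is the set of isomorphism classes of these. For a sequence of indecomposable modules put $\operatorname{soc}(X_1,\dots,X_t)=(s_1,\dots,s_t)$, where the socle of $X_i$ is $S(s_i)$. $\mathbf P(n)$ is the set of parking functions for $n$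 cars: the sequences $(f_1,\dots,f_n)$ with $f_i\in\{1,\dots,n\}$ such that $|\{x\mid f_x\le i\}|\ge i$ for all $1\le i\le n$. For a poset $Q$, $\mathbf M(Q)$ denotes the set of maximal chains in $Q$. $\mathbf{Nc}(n+1)$ is the poset of non-crossing partitions of $\{1,\dots,n+1\}$ (if $i<i'<j<j'$ with $i,j$ in the same part and $i',j'$ in the same part, then all four lie in the same part), with $P\le P'$ iff every part of $P$ is contained in a part of $P'$. $\mathbf A(\operatorname{mod}\Lambda_n)$ is the poset, ordered by inclusion, of thick subcategories of $\operatorname{mod}\Lambda_n$ (full subcategories closed under kernels, cokernels and extensions). The map $A\colon\mathbf{Nc}(n+1)\to\mathbf A(\operatorname{mod}\Lambda_n)$ is the poset isomorphism sending $P$ to the thick subcategory whose indecomposable objects are the modules $[a,b]$ with $a<b$ in the same part of $P$ (equivalently, to the antichain of its simple objects, namely the modules $[a,b]$ with $a<b$ in the same part of $P$ and no element of this part strictly between $a$ and $b$). $\mathbf M(A)$ is the induced map on maximal chains. For a maximal chain $0=\mathcal A(0)\subset\mathcal A(1)\subset\dots\subset\mathcal A(n)=\operatorname{mod}\Lambda_n$ in $\mathbf A(\operatorname{mod}\Lambda_n)$, let $M^{\mathcal A(i)}_{\mathcal A(i-1)}$ be the unique (up to isomorphism) indecomposable module in $\mathcal A(i)\cap\mathcal A(i-1)^\perp$, where $\mathcal C^\perp$ consists of all modules $U$ with $\operatorname{Hom}(\mathcal C,U)=0=\operatorname{Ext}^1(\mathcal C,U)$. The bijection $M$ is given by $M(\mathcal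 A(0),\dots,\mathcal A(n))=\bigl(M^{\mathcal A(n)}_{\mathcal A(n-1)},\dots,M^{\mathcal A(2)}_{\mathcal A(1)},M^{\mathcal A(1)}_{\mathcal A(0)}\bigr)$. If $P<P'$ are neighbors in $\mathbf{Nc}(n+1)$, then $P'$ is obtained from $P$ by replacing two parts $P_i,P_j$ by their union, where $\min P_i<\min P_j$; $\lambda'(P,P')$ is the largest element of $P_i$ which is smaller than all elements of $P_j$. The map $\lambda$ (Stanley's bijection) is given by $\lambda(P^{(0)},\dots,P^{(n)})=\bigl(\lambda'(P^{(0)},P^{(1)}),\lambda'(P^{(1)},P^{(2)}),\dots,\lambda'(P^{(n-1)},P^{(n)})\bigr)$.
   Formalization: The commutativity is stated with λ read in reverse order: rev∘λ = soc∘M∘M(A). With the stated orders λ = soc∘M∘M(A) fails for n=2: the chain 1|2|3 < 12|3 < 123 has λ=(1,2), but M gives (S(2),S(1)) with socles (2,1). *)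

theory Defs
  imports Complex_Main "HOL-Library.Function_Algebras" "HOL-Library.Disjoint_Sets"
    "HOL-Library.FuncSet"
begin

section \<open>Representations of the linear quiver\<close>

text \<open>
  Modules over the path algebra of the quiver \<open>1 \<leftarrow> 2 \<leftarrow> \<dots> \<leftarrow> n\<close> over a field
  are identified, as usual, with representations of the quiver. The vector spaces of a
  representation are finite-dimensional subspaces of the space of all sequences over the field, which
  contains a copy of every finite-dimensional space. Linear maps between such subspaces are given
  as restrictions of linear endomorphisms of the ambient space (every linear map between
  subspaces extends); their values off the subspace are irrelevant.
\<close>

definition scl :: "'k::field \<Rightarrow> (nat \<Rightarrow> 'k) \<Rightarrow> nat \<Rightarrow> 'k" where
  "scl c v = (\<lambda>i. c * v i)"

global_interpretation ambient: vector_space "scl :: 'k::field \<Rightarrow> (nat \<Rightarrow> 'k) \<Rightarrow> nat \<Rightarrow> 'k"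
  by unfold_locales (auto simp: scl_def plus_fun_def algebra_simps)

abbreviation lin :: "((nat \<Rightarrow> 'k::field) \<Rightarrow> nat \<Rightarrow> 'k) \<Rightarrow> bool" where
  "lin \<equiv> Vector_Spaces.linear scl scl"

text \<open>
  \<open>arrow X i\<close> is the map \<open>X\<^sub>i\<^sub>+\<^sub>1 \<rightarrow> X\<^sub>i\<close>. Only the spaces at \<open>1, \<dots>, n\<close> and the arrows
  at \<open>1, \<dots>, n - 1\<close> matter; everything else is unconstrained and ignored.
\<close>

record 'k rep =
  space :: "nat \<Rightarrow> (nat \<Rightarrow> 'k) set"
  arrow :: "nat \<Rightarrow> (nat \<Rightarrow> 'k) \<Rightarrow> nat \<Rightarrow> 'k"

definition is_rep :: "nat \<Rightarrow> 'k::field rep \<Rightarrow> bool" where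
  "is_rep n X \<longleftrightarrow>
     (\<forall>i\<in>{1..n}. ambient.subspace (space X i) \<and>
        (\<exists>B. finite B \<and> space X i = ambient.span B)) \<and>
     (\<forall>i\<in>{1..<n}. lin (arrow X i) \<and> arrow X i ` space X (Suc i) \<subseteq> space X i)"

definition zero_rep :: "nat \<Rightarrow> 'k::field rep \<Rightarrow> bool" where
  "zero_rep n X \<longleftrightarrow> is_rep n X \<and> (\<forall>i\<in>{1..n}. space X i = {0})"

definition is_mor :: "nat \<Rightarrow> 'k::field rep \<Rightarrow> 'k rep \<Rightarrow> (nat \<Rightarrow> (nat \<Rightarrow> 'k) \<Rightarrow> nat \<Rightarrow> 'k) \<Rightarrow> bool" where
  "is_mor n X Y f \<longleftrightarrow> is_rep n X \<and> is_rep n Y \<and>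
     (\<forall>i\<in>{1..n}. lin (f i) \<and> f i ` space X i \<subseteq> space Y i) \<and>
     (\<forall>i\<in>{1..<n}. \<forall>v\<in>space X (Suc i). f i (arrow X i v) = arrow Y i (f (Suc i) v))"

definition is_mono :: "nat \<Rightarrow> 'k::field rep \<Rightarrow> 'k rep \<Rightarrow> (nat \<Rightarrow> (nat \<Rightarrow> 'k) \<Rightarrow> nat \<Rightarrow> 'k) \<Rightarrow> bool" where
  "is_mono n X Y f \<longleftrightarrow> is_mor n X Y f \<and> (\<forall>i\<in>{1..n}. inj_on (f i) (space X i))"

definition is_epi :: "nat \<Rightarrow> 'k::field rep \<Rightarrow> 'k rep \<Rightarrow> (nat \<Rightarrow> (nat \<Rightarrow> 'k) \<Rightarrow> nat \<Rightarrow> 'k) \<Rightarrow> bool" where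
  "is_epi n X Y f \<longleftrightarrow> is_mor n X Y f \<and> (\<forall>i\<in>{1..n}. f i ` space X i = space Y i)"

definition iso :: "nat \<Rightarrow> 'k::field rep \<Rightarrow> 'k rep \<Rightarrow> bool" where
  "iso n X Y \<longleftrightarrow> (\<exists>f. is_mono n X Y f \<and> is_epi n X Y f)"

text \<open>\<open>X \<rightarrow> Y \<rightarrow> Z\<close> is exact at \<open>Y\<close>.\<close>

definition exact_at :: "nat \<Rightarrow> 'k::field rep \<Rightarrow> (nat \<Rightarrow> (nat \<Rightarrow> 'k) \<Rightarrow> nat \<Rightarrow> 'k) \<Rightarrow> 'k rep
    \<Rightarrow> (nat \<Rightarrow> (nat \<Rightarrow> 'k) \<Rightarrow> nat \<Rightarrow> 'k) \<Rightarrow> 'k rep \<Rightarrow> bool" where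
  "exact_at n X f Y g Z \<longleftrightarrow> is_mor n X Y f \<and> is_mor n Y Z g \<and>
     (\<forall>i\<in>{1..n}. f i ` space X i = {v \<in> space Y i. g i v = 0})"

definition short_exact :: "nat \<Rightarrow> 'k::field rep \<Rightarrow> (nat \<Rightarrow> (nat \<Rightarrow> 'k) \<Rightarrow> nat \<Rightarrow> 'k) \<Rightarrow> 'k rep
    \<Rightarrow> (nat \<Rightarrow> (nat \<Rightarrow> 'k) \<Rightarrow> nat \<Rightarrow> 'k) \<Rightarrow> 'k rep \<Rightarrow> bool" where
  "short_exact n X f Y g Z \<longleftrightarrow> is_mono n X Y f \<and> exact_at n X f Y g Z \<and> is_epi n Y Z g"

definition hom_zero :: "nat \<Rightarrow> 'k::field rep \<Rightarrow> 'k rep \<Rightarrow> bool" where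
  "hom_zero n X Y \<longleftrightarrow> (\<forall>f. is_mor n X Y f \<longrightarrow> (\<forall>i\<in>{1..n}. \<forall>v\<in>space X i. f i v = 0))"

text \<open>\<open>Ext\<^sup>1(Z, X) = 0\<close> for the Yoneda extension group: all extensions \<open>0 \<rightarrow> X \<rightarrow> Y \<rightarrow> Z \<rightarrow> 0\<close> split.\<close>

definition ext_zero :: "nat \<Rightarrow> 'k::field rep \<Rightarrow> 'k rep \<Rightarrow> bool" where
  "ext_zero n Z X \<longleftrightarrow> (\<forall>Y f g. short_exact n X f Y g Z \<longrightarrow>
     (\<exists>s. is_mor n Z Y s \<and> (\<forall>i\<in>{1..n}. \<forall>v\<in>space Z i. g i (s i v) = v)))"

section \<open>Submodules, indecomposable modules, socles\<close>

text \<open>A submodule of \<open>X\<close> is a family \<open>U\<close> of subspaces; as a module it is \<open>X\<lparr>space := U\<rparr>\<close>.\<close>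

definition submodule :: "nat \<Rightarrow> 'k::field rep \<Rightarrow> (nat \<Rightarrow> (nat \<Rightarrow> 'k) set) \<Rightarrow> bool" where
  "submodule n X U \<longleftrightarrow> is_rep n (X\<lparr>space := U\<rparr>) \<and> (\<forall>i\<in>{1..n}. U i \<subseteq> space X i)"

definition indecomposable :: "nat \<Rightarrow> 'k::field rep \<Rightarrow> bool" where
  "indecomposable n X \<longleftrightarrow> is_rep n X \<and> \<not> zero_rep n X \<and>
     (\<forall>U W. submodule n X U \<and> submodule n X W \<and>
        (\<forall>i\<in>{1..n}. space X i = {u + w |u w. u \<in> U i \<and> w \<in> W i} \<and> U i \<inter> W i = {0}) \<longrightarrow>
        zero_rep n (X\<lparr>space := U\<rparr>) \<or> zero_rep n (X\<lparr>space := W\<rparr>))"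

definition simple :: "nat \<Rightarrow> 'k::field rep \<Rightarrow> bool" where
  "simple n X \<longleftrightarrow> is_rep n X \<and> \<not> zero_rep n X \<and>
     (\<forall>U. submodule n X U \<longrightarrow>
        zero_rep n (X\<lparr>space := U\<rparr>) \<or> (\<forall>i\<in>{1..n}. U i = space X i))"

text \<open>
  The module \<open>[a, b]\<close>: a fixed line at the vertices \<open>a, \<dots>, b - 1\<close>, with identity maps between
  them. In particular \<open>[s, s + 1]\<close> is \<open>S(s)\<close>.
\<close>

definition interval_mod :: "nat \<Rightarrow> nat \<Rightarrow> 'k::field rep" where
  "interval_mod a b = \<lparr>
     space = (\<lambda>i. if a \<le> i \<and> i < b then ambient.span {\<lambda>j. if j = 0 then 1 else 0} else {0}),
     arrow = (\<lambda>i. if a \<le> i \<and> Suc i < b then id else (\<lambda>_. 0))\<rparr>"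

definition simple_mod :: "nat \<Rightarrow> 'k::field rep" where
  "simple_mod s = interval_mod s (Suc s)"

text \<open>The socle as the sum of all simple submodules.\<close>

definition socle :: "nat \<Rightarrow> 'k::field rep \<Rightarrow> 'k rep" where
  "socle n X = X\<lparr>space := \<lambda>i.
     ambient.span (\<Union>{U i |U. submodule n X U \<and> simple n (X\<lparr>space := U\<rparr>)})\<rparr>"

definition soc_index :: "nat \<Rightarrow> 'k::field rep \<Rightarrow> nat" where
  "soc_index n X = (THE s. s \<in> {1..n} \<and> iso n (socle n X) (simple_mod s))"

definition soc_seq :: "nat \<Rightarrow> 'k::field rep list \<Rightarrow> nat list" where
  "soc_seq n Xs = map (soc_index n) Xs"

section \<open>Complete exceptional sequences and parking functions\<close>

definition complete_exceptional :: "nat \<Rightarrow> 'k::field rep list \<Rightarrow> bool" where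
  "complete_exceptional n Xs \<longleftrightarrow> length Xs = n \<and>
     (\<forall>i<n. indecomposable n (Xs ! i)) \<and>
     (\<forall>i<n. \<forall>j\<le>i. ext_zero n (Xs ! i) (Xs ! j)) \<and>
     (\<forall>i<n. \<forall>j<i. hom_zero n (Xs ! i) (Xs ! j))"

text \<open>The isomorphism classes of complete exceptional sequences.\<close>

definition exc_classes :: "nat \<Rightarrow> 'k::field rep list set set" where
  "exc_classes n = {Xs. complete_exceptional n Xs} //
     {(Xs, Ys). complete_exceptional n Xs \<and> complete_exceptional n Ys \<and> list_all2 (iso n) Xs Ys}"

definition soc_class :: "nat \<Rightarrow> 'k::field rep list set \<Rightarrow> nat list" where
  "soc_class n E = the_elem (soc_seq n ` E)"

definition parking :: "nat \<Rightarrow> nat list set" where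
  "parking n = {f. length f = n \<and> set f \<subseteq> {1..n} \<and>
     (\<forall>i\<in>{1..n}. card {x. x < n \<and> f ! x \<le> i} \<ge> i)}"

section \<open>Maximal chains\<close>

text \<open>
  Maximal chains of \<open>Q\<close> with respect to the strict order \<open>lt\<close>, listed in increasing order
  (the posets considered here have only finite chains).
\<close>

definition max_chains :: "'a set \<Rightarrow> ('a \<Rightarrow> 'a \<Rightarrow> bool) \<Rightarrow> 'a list set" where
  "max_chains Q lt = {cs. sorted_wrt lt cs \<and> pred_on.maxchain Q lt (set cs)}"

definition consecutive :: "('a \<Rightarrow> 'a \<Rightarrow> 'b) \<Rightarrow> 'a list \<Rightarrow> 'b list" where
  "consecutive h cs = map2 h (butlast cs) (tl cs)"

section \<open>Non-crossing partitions and Stanley's labelling\<close>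

definition noncrossing :: "nat set set \<Rightarrow> bool" where
  "noncrossing P \<longleftrightarrow> (\<forall>i i' j j'. i < i' \<and> i' < j \<and> j < j' \<and>
     (\<exists>B\<in>P. i \<in> B \<and> j \<in> B) \<and> (\<exists>B\<in>P. i' \<in> B \<and> j' \<in> B) \<longrightarrow>
     (\<exists>B\<in>P. {i, i', j, j'} \<subseteq> B))"

definition Nc :: "nat \<Rightarrow> nat set set set" where
  "Nc m = {P. partition_on {1..m} P \<and> noncrossing P}"

definition nc_less :: "nat \<Rightarrow> nat set set \<Rightarrow> nat set set \<Rightarrow> bool" where
  "nc_less m P P' \<longleftrightarrow> refines {1..m} P P' \<and> P \<noteq> P'"

abbreviation nc_chains :: "nat \<Rightarrow> nat set set list set" where
  "nc_chains m \<equiv> max_chains (Nc m) (nc_less m)"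

definition stanley_label :: "nat set set \<Rightarrow> nat set set \<Rightarrow> nat" where
  "stanley_label P P' = (THE k. \<exists>Pi\<in>P. \<exists>Pj\<in>P. Min Pi < Min Pj \<and>
     P' = P - {Pi, Pj} \<union> {Pi \<union> Pj} \<and> k = Max {x\<in>Pi. \<forall>y\<in>Pj. x < y})"

text \<open>
  The labels are listed from the bottom of the chain to the top. The modules attached below to a
  chain of thick subcategories are listed from the top to the bottom, as required for an
  exceptional sequence, so one of the two lists has to be reversed for comparison: for \<open>n = 2\<close>
  the chain \<open>1|2|3 < 12|3 < 123\<close> has the labels \<open>(1, 2)\<close> and gives the exceptional sequence
  \<open>(S(2), S(1))\<close>, whose socles are \<open>(2, 1)\<close>.
\<close>

definition stanley :: "nat set set list \<Rightarrow> nat list" where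
  "stanley Ps = consecutive stanley_label Ps"

section \<open>Thick subcategories\<close>

text \<open>
  Full subcategories are given by their sets of objects. Non-emptiness, which is implicit in
  speaking of a subcategory here, puts the zero modules into every thick subcategory. Closure
  under isomorphism is the case of the kernel of a zero map.
\<close>

definition thick :: "nat \<Rightarrow> 'k::field rep set \<Rightarrow> bool" where
  "thick n C \<longleftrightarrow> C \<noteq> {} \<and> (\<forall>X\<in>C. is_rep n X) \<and>
     (\<forall>K k X f Y. X \<in> C \<and> Y \<in> C \<and> is_mono n K X k \<and> exact_at n K k X f Y \<longrightarrow> K \<in> C) \<and>
     (\<forall>X f Y q Q. X \<in> C \<and> Y \<in> C \<and> exact_at n X f Y q Q \<and> is_epi n Y Q q \<longrightarrow> Q \<in> C) \<and>
     (\<forall>X f Y g Z. X \<in> C \<and> Z \<in> C \<and> short_exact n X f Y g Z \<longrightarrow> Y \<in> C)"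

abbreviation thick_chains :: "nat \<Rightarrow> 'k::field rep set list set" where
  "thick_chains n \<equiv> max_chains {C. thick n C} (\<subset>)"

definition nc_thick :: "nat \<Rightarrow> nat set set \<Rightarrow> 'k::field rep set" where
  "nc_thick n P = (THE C. thick n C \<and>
     {X\<in>C. indecomposable n X} =
     {X. \<exists>B\<in>P. \<exists>a\<in>B. \<exists>b\<in>B. a < b \<and> iso n X (interval_mod a b)})"

definition perp :: "nat \<Rightarrow> 'k::field rep set \<Rightarrow> 'k rep set" where
  "perp n C = {U. is_rep n U \<and> (\<forall>X\<in>C. hom_zero n X U \<and> ext_zero n X U)}"

text \<open>
  The indecomposable modules in \<open>\<A>' \<inter> \<A>\<^sup>\<bottom>\<close>, which for neighbours form a single
  isomorphism class.
\<close>

definition step_class :: "nat \<Rightarrow> 'k::field rep set \<Rightarrow> 'k rep set \<Rightarrow> 'k rep set" where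
  "step_class n C C' = {X. indecomposable n X \<and> X \<in> C' \<inter> perp n C}"

text \<open>
  The value is the isomorphism class consisting of all sequences whose entries are chosen from
  the classes \<open>step_class\<close>, the top step coming first.
\<close>

definition chain_exc :: "nat \<Rightarrow> 'k::field rep set list \<Rightarrow> 'k rep list set" where
  "chain_exc n Cs = listset (rev (consecutive (step_class n) Cs))"

end

theory Submission
  imports Defs
begin

text \<open>
  The whole statement is about pairs of numbers, once three facts on modules are known.

  First, every indecomposable module is some \<open>[a, b]\<close> (\<open>indecomposable_interval\<close>). Second, for a
  representation \<open>U\<close>, put \<open>U\<^sub>0 = 0\<close> and consider the composite structure map
  \<open>U\<^sub>b\<^sub>-\<^sub>1 \<rightarrow> U\<^sub>a\<^sub>-\<^sub>1\<close>: its kernel is \<open>Hom([a, b], U)\<close> and its cokernel is \<open>Ext\<^sup>1([a, b], U)\<close>,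
  as \<open>0 \<rightarrow> [1, a] \<rightarrow> [1, b] \<rightarrow> [a, b] \<rightarrow> 0\<close> is a projective resolution
  (\<open>hom_zero_interval\<close>, \<open>ext_zero_interval\<close>). So \<open>U\<close> lies in \<open>[a, b]\<^sup>\<bottom>\<close> iff this map is bijective, and
  \<open>[c, d]\<close> lies there iff the vertices \<open>a - 1\<close> and \<open>b - 1\<close> are both inside or both outside the
  support \<open>{c, \<dots>, d - 1}\<close>; this is the relation \<open>compat\<close> below. Complete exceptional sequences are
  therefore the lists of \<open>n\<close> pairs that are compatible in this sense. Third, a representation is a
  direct sum of indecomposable ones (\<open>rep_induct\<close>), so that a thick subcategory is determined by
  the modules \<open>[a, b]\<close> that it contains (\<open>thick_subset\<close>).

  \<^bold>\<open>Socles and parking functions\<close> (\<open>exc_pairs_parking\<close>). In a list of \<open>n\<close> compatible pairs let \<open>m\<close> be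
  the largest left end, and look at the first pair \<open>(m, b)\<close> that has it. If \<open>b\<close> were not \<open>m + 1\<close>,
  no pair would have \<open>m + 1\<close> as an end, and deleting this point would leave too many pairs on too
  few points. So the pair is \<open>(m, m + 1)\<close>. Removing it and identifying \<open>m\<close> with \<open>m + 1\<close>
  gives a compatible list for \<open>n - 1\<close>, with the other left ends unchanged; this step is reversible,
  because no pair before \<open>(m, m + 1)\<close> has \<open>m\<close> as an end and no pair after it has \<open>m + 1\<close>. A
  parking function for \<open>n\<close> cars is in the same way one for \<open>n - 1\<close> cars into which a maximum
  \<open>m \<le> n\<close> is inserted at its first position. Induction on \<open>n\<close> gives the bijection.

  \<^bold>\<open>Thick subcategories\<close> (\<open>nc_thick_bij\<close>). By the five lemma the representations for which a given
  structure map \<open>X\<^sub>j \<rightarrow> X\<^sub>i\<close> is bijective form a thick subcategory. For a non-crossing partition \<open>P\<close>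
  impose this for all vertices \<open>i < j\<close> that no \<open>[x, y]\<close> with \<open>x\<close>, \<open>y\<close> in a common part
  separates; then exactly these \<open>[x, y]\<close> remain (\<open>separating_pair\<close>). Conversely kernels, cokernels and
  extensions of maps between interval modules show that the \<open>[a, b]\<close> in a thick subcategory come from a
  non-crossing partition (\<open>thick_partition\<close>).

  \<^bold>\<open>Commutativity.\<close> Maximal chains of non-crossing partitions merge two parts in each step
  (\<open>nc_chain_covers\<close>). If the parts \<open>A\<close> and \<open>B\<close> are merged, where \<open>Min A < Min B\<close>, the only
  \<open>[c, d]\<close> with \<open>c\<close>, \<open>d\<close> in a common new part which is compatible with all old ones has
  \<open>d = Max B\<close>, and \<open>c\<close> is Stanley's label (\<open>covers_interval\<close>). Its socle is \<open>S(c)\<close>, whence the two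
  sequences of numbers agree.
\<close>

section \<open>Compatible pairs and parking functions\<close>

text \<open>
  The pair \<open>(a, b)\<close> stands for the module \<open>[a, b]\<close>, and \<open>compat p q\<close> says that the module of \<open>p\<close> is
  right perpendicular to the module of \<open>q\<close>. In an exceptional sequence \<open>p\<close> comes before \<open>q\<close>.
\<close>

definition compat :: "nat \<times> nat \<Rightarrow> nat \<times> nat \<Rightarrow> bool" where
  "compat p q \<longleftrightarrow> (fst p < snd q \<and> snd q \<le> snd p \<longleftrightarrow> fst p < fst q \<and> fst q \<le> snd p)"

definition compat_seq :: "nat \<Rightarrow> (nat \<times> nat) list \<Rightarrow> bool" where
  "compat_seq N ps \<longleftrightarrow> (\<forall>p\<in>set ps. 1 \<le> fst p \<and> fst p < snd p \<and> snd p \<le> N) \<and> sorted_wrt compat ps"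

text \<open>
  \<open>contract m\<close> identifies the points \<open>m\<close> and \<open>m + 1\<close>. It has two increasing sections:
  \<open>expand_le m\<close>, which misses \<open>m + 1\<close>, and \<open>expand_lt m\<close>, which misses \<open>m\<close>.
\<close>

definition contract :: "nat \<Rightarrow> nat \<Rightarrow> nat" where
  "contract m x = (if x \<le> m then x else x - 1)"

definition expand_le :: "nat \<Rightarrow> nat \<Rightarrow> nat" where
  "expand_le m x = (if x \<le> m then x else Suc x)"

definition expand_lt :: "nat \<Rightarrow> nat \<Rightarrow> nat" where
  "expand_lt m x = (if x < m then x else Suc x)"

abbreviation on_pair :: "(nat \<Rightarrow> nat) \<Rightarrow> nat \<times> nat \<Rightarrow> nat \<times> nat" where
  "on_pair f \<equiv> map_prod f f"

lemma split_first_max: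
  fixes h :: "'a \<Rightarrow> nat"
  assumes "xs \<noteq> []"
  obtains ys x zs where "xs = ys @ x # zs" "\<forall>y\<in>set ys. h y < h x" "\<forall>z\<in>set zs. h z \<le> h x"
proof -
  define m where "m = Max (h ` set xs)"
  have "m \<in> h ` set xs" unfolding m_def using assms by (intro Max_in) auto
  then have "\<exists>x\<in>set xs. h x = m" by auto
  from split_list_first_propE[OF this] obtain ys x zs
    where *: "xs = ys @ x # zs" "h x = m" "\<forall>y\<in>set ys. h y \<noteq> m" by blast
  moreover have "\<forall>y\<in>set xs. h y \<le> m" unfolding m_def by simp
  ultimately show ?thesis by (intro that[of ys x zs]) (auto simp: order_less_le)
qed

text \<open>
  These are the points that become free around the first pair with the largest left end \<open>m\<close>: a pair
  before it that had \<open>m\<close> as right end would contain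
  the vertex \<open>m - 1\<close> but not \<open>b - 1\<close> in its support, and the other cases are alike.
\<close>

lemma compat_seq_below_first_max:
  assumes "compat_seq N (xs @ (m, b) # ys)" "\<forall>p\<in>set xs. fst p < m" "\<forall>p\<in>set ys. fst p \<le> m"
  shows "\<forall>p\<in>set xs. fst p \<noteq> m \<and> snd p \<noteq> m"
    and "\<forall>p\<in>set ys. fst p \<noteq> Suc m \<and> snd p \<noteq> Suc m"
    and "b \<noteq> Suc m \<Longrightarrow> \<forall>p\<in>set xs. fst p \<noteq> Suc m \<and> snd p \<noteq> Suc m"
proof -
  have mb: "m < b" and xs: "\<forall>p\<in>set xs. compat p (m, b) \<and> fst p < snd p"
    and ys: "\<forall>p\<in>set ys. compat (m, b) p"
    using assms(1) unfolding compat_seq_def by (auto simp: sorted_wrt_append)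
  show "\<forall>p\<in>set xs. fst p \<noteq> m \<and> snd p \<noteq> m"
  proof
    fix p assume p: "p \<in> set xs"
    then show "fst p \<noteq> m \<and> snd p \<noteq> m"
      using xs[rule_format, OF p] assms(2)[rule_format, OF p] mb unfolding compat_def by auto
  qed
  show "\<forall>p\<in>set ys. fst p \<noteq> Suc m \<and> snd p \<noteq> Suc m"
  proof
    fix p assume p: "p \<in> set ys"
    then show "fst p \<noteq> Suc m \<and> snd p \<noteq> Suc m"
      using ys[rule_format, OF p] assms(3)[rule_format, OF p] mb unfolding compat_def by auto
  qed
  assume b: "b \<noteq> Suc m"
  show "\<forall>p\<in>set xs. fst p \<noteq> Suc m \<and> snd p \<noteq> Suc m"
  proof
    fix p assume p: "p \<in> set xs"
    then show "fst p \<noteq> Suc m \<and> snd p \<noteq> Suc m"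
      using xs[rule_format, OF p] assms(2)[rule_format, OF p] mb b unfolding compat_def by auto
  qed
qed

lemma contract_less_iff: "a \<noteq> m \<or> b \<noteq> Suc m \<Longrightarrow> contract m a < contract m b \<longleftrightarrow> a < b"
  unfolding contract_def by auto

lemma contract_le_iff: "a \<noteq> Suc m \<or> b \<noteq> m \<Longrightarrow> contract m a \<le> contract m b \<longleftrightarrow> a \<le> b"
  unfolding contract_def by auto

text \<open>
  The identification of \<open>m\<close> and \<open>m + 1\<close> can change a comparison only between these two points. The
  asymmetry of \<open>compat\<close> is what makes one of the two conditions suffice for pairs \<open>p\<close>, \<open>q\<close> on
  different sides of \<open>(m, m + 1)\<close>.
\<close>

lemma compat_contract:
  assumes "(fst p \<noteq> m \<and> snd p \<noteq> m) \<or> (fst q \<noteq> Suc m \<and> snd q \<noteq> Suc m)"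
  shows "compat (on_pair (contract m) p) (on_pair (contract m) q) \<longleftrightarrow> compat p q"
proof -
  have "contract m (fst p) < contract m x \<longleftrightarrow> fst p < x" "contract m x \<le> contract m (snd p) \<longleftrightarrow> x \<le> snd p"
    if "x = fst q \<or> x = snd q" for x
    using assms that by (intro contract_less_iff contract_le_iff; auto)+
  then show ?thesis unfolding compat_def fst_map_prod snd_map_prod by (simp only: simp_thms)
qed

lemma compat_seq_contract:
  assumes "compat_seq (Suc N) (xs @ ys)" "1 \<le> m" "m \<le> N"
    and xs: "\<forall>p\<in>set xs. fst p \<noteq> m \<and> snd p \<noteq> m" and ys: "\<forall>p\<in>set ys. fst p \<noteq> Suc m \<and> snd p \<noteq> Suc m"
  shows "compat_seq N (map (on_pair (contract m)) (xs @ ys))"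
proof -
  note c = assms(1)[unfolded compat_seq_def sorted_wrt_append]
  have 1: "1 \<le> contract m a \<and> contract m a < contract m b \<and> contract m b \<le> N"
    if "1 \<le> a" "a < b" "b \<le> Suc N" "(a \<noteq> m \<and> b \<noteq> m) \<or> (a \<noteq> Suc m \<and> b \<noteq> Suc m)" for a b
    using that assms(2,3) unfolding contract_def by (auto split: if_splits)
  have 2: "1 \<le> fst q \<and> fst q < snd q \<and> snd q \<le> Suc N" if "q \<in> set xs \<union> set ys" for q
    using conjunct1[OF c, rule_format, of q] that by simp
  have "1 \<le> fst p \<and> fst p < snd p \<and> snd p \<le> N" if "p \<in> set (map (on_pair (contract m)) (xs @ ys))" for p
  proof -
    obtain q where q: "q \<in> set xs \<union> set ys" "p = on_pair (contract m) q"
      using \<open>p \<in> _\<close> unfolding set_map set_append by (rule imageE)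
    then have "(fst q \<noteq> m \<and> snd q \<noteq> m) \<or> (fst q \<noteq> Suc m \<and> snd q \<noteq> Suc m)" using xs ys by blast
    then show ?thesis using 1[of "fst q" "snd q"] 2[OF q(1)] q(2) by simp
  qed
  moreover have "sorted_wrt compat (map (on_pair (contract m)) (xs @ ys))"
    unfolding sorted_wrt_map sorted_wrt_append map_append
  proof (intro conjI ballI)
    have cs: "sorted_wrt compat xs" "sorted_wrt compat ys" "\<forall>x\<in>set xs. \<forall>y\<in>set ys. compat x y" 
      using c by blast+
    show "sorted_wrt (\<lambda>x y. compat (on_pair (contract m) x) (on_pair (contract m) y)) xs"
      using cs(1) by (rule sorted_wrt_mono_rel[rotated]) (use xs in \<open>simp only: compat_contract simp_thms\<close>)
    show "sorted_wrt (\<lambda>x y. compat (on_pair (contract m) x) (on_pair (contract m) y)) ys"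
      using cs(2) by (rule sorted_wrt_mono_rel[rotated]) (use ys in \<open>simp only: compat_contract simp_thms\<close>)
    fix p q assume "p \<in> set (map (on_pair (contract m)) xs)" "q \<in> set (map (on_pair (contract m)) ys)"
    then have "p \<in> on_pair (contract m) ` set xs" "q \<in> on_pair (contract m) ` set ys" by simp_all
    then obtain p' q' where "p' \<in> set xs" "p = on_pair (contract m) p'" "q' \<in> set ys" "q = on_pair (contract m) q'"
      by (elim imageE)
    then show "compat p q" using cs(3) xs by (simp only: compat_contract simp_thms)
  qed
  ultimately show ?thesis unfolding compat_seq_def by blast
qed

lemma expand_lt_props: "fst (on_pair (expand_lt m) p) \<noteq> m \<and> snd (on_pair (expand_lt m) p) \<noteq> m"
  by (cases p) (auto simp: expand_lt_def)
lemma expand_le_props: "fst (on_pair (expand_le m) p) \<noteq> Suc m \<and> snd (on_pair (expand_le m) p) \<noteq> Suc m"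
  by (cases p) (auto simp: expand_le_def)
lemma contract_expand: "contract m (expand_lt m x) = x" "contract m (expand_le m x) = x"
  by (auto simp: contract_def expand_lt_def expand_le_def)
lemma expand_contract: "x \<noteq> m \<Longrightarrow> expand_lt m (contract m x) = x" "x \<noteq> Suc m \<Longrightarrow> expand_le m (contract m x) = x"
  by (auto simp: contract_def expand_lt_def expand_le_def)

text \<open>
  The inverse of the contraction: every pair before \<open>(m, m + 1)\<close> is moved away from \<open>m\<close>, and every
  pair after it away from \<open>m + 1\<close>, which is exactly what compatibility with \<open>(m, m + 1)\<close> demands.
\<close>

lemma compat_seq_expand:
  assumes c: "compat_seq N (xs @ ys)" and m: "1 \<le> m" "m \<le> N"
    and xs: "\<forall>p\<in>set xs. fst p < m" and ys: "\<forall>p\<in>set ys. fst p \<le> m"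
  shows "compat_seq (Suc N) (map (on_pair (expand_lt m)) xs @ (m, Suc m) # map (on_pair (expand_le m)) ys)"
proof -
  note c = c[unfolded compat_seq_def sorted_wrt_append]
  let ?f = "on_pair (expand_lt m)" and ?g = "on_pair (expand_le m)"
  have cf: "on_pair (contract m) (?f p) = p" "on_pair (contract m) (?g p) = p" for p
    by (cases p; simp add: contract_expand)+
  have cc: "compat (?f p) (?f q) \<longleftrightarrow> compat p q" "compat (?f p) (?g q) \<longleftrightarrow> compat p q"
    "compat (?g p) (?g q) \<longleftrightarrow> compat p q" for p q
    using compat_contract[of "?f p" m "?f q"] compat_contract[of "?f p" m "?g q"]
      compat_contract[of "?g p" m "?g q"] unfolding cf
    using expand_lt_props[of m p] expand_le_props[of m q] by simp_all
  have "1 \<le> fst p \<and> fst p < snd p \<and> snd p \<le> Suc N"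
    if "p \<in> set (map ?f xs @ (m, Suc m) # map ?g ys)" for p
  proof -
    have q: "1 \<le> fst q \<and> fst q < snd q \<and> snd q \<le> N" if "q \<in> set xs \<union> set ys" for q 
      using conjunct1[OF c, rule_format, of q] that by simp
    have *: "1 \<le> fst (?f q) \<and> fst (?f q) < snd (?f q) \<and> snd (?f q) \<le> Suc N"
      "1 \<le> fst (?g q) \<and> fst (?g q) < snd (?g q) \<and> snd (?g q) \<le> Suc N"
      if "q \<in> set xs \<union> set ys" for q
      using q[OF that] by (simp_all add: expand_lt_def expand_le_def)
    from that consider "p = (m, Suc m)" | q where "q \<in> set xs" "p = ?f q" | q where "q \<in> set ys" "p = ?g q"
      by auto
    then show ?thesis using * m by cases auto
  qed
  moreover have "sorted_wrt compat (map ?f xs @ (m, Suc m) # map ?g ys)"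
    unfolding sorted_wrt_append sorted_wrt.simps sorted_wrt_map
  proof (intro conjI ballI)
    have cs: "sorted_wrt compat xs" "sorted_wrt compat ys" "\<forall>x\<in>set xs. \<forall>y\<in>set ys. compat x y" 
      using c by blast+
    show "sorted_wrt (\<lambda>x y. compat (?f x) (?f y)) xs" "sorted_wrt (\<lambda>x y. compat (?g x) (?g y)) ys"
      unfolding cc by (rule cs)+
    fix q assume q: "q \<in> set (map ?g ys)"
    then obtain q' where q': "q' \<in> set ys" "q = ?g q'" unfolding set_map by (rule imageE)
    show "compat (m, Suc m) q" 
      using expand_le_props[of m q'] unfolding q'(2) compat_def fst_conv snd_conv by linarith
  next
    fix p q assume p: "p \<in> set (map ?f xs)" and q: "q \<in> set ((m, Suc m) # map ?g ys)"
    obtain p' where p': "p' \<in> set xs" "p = ?f p'" using p unfolding set_map by (rule imageE)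
    show "compat p q"
    proof (cases "q = (m, Suc m)")
      case True
      then show ?thesis
        using expand_lt_props[of m p'] unfolding p'(2) compat_def \<open>q = (m, Suc m)\<close> fst_conv snd_conv by linarith
    next
      case False
      then have "q \<in> ?g ` set ys" using q by simp
      then obtain q' where q': "q' \<in> set ys" "q = ?g q'" by (rule imageE)
      then show ?thesis using c p' unfolding q'(2) p'(2) cc by blast
    qed
  qed
  ultimately show ?thesis unfolding compat_seq_def by blast
qed

lemma compat_seq_remove_vertex:
  assumes c: "compat_seq (Suc N) (xs @ (m, b) # ys)" "\<forall>p\<in>set xs. fst p < m" "\<forall>p\<in>set ys. fst p \<le> m"
    and b: "b \<noteq> Suc m"
  shows "compat_seq N (map (on_pair (contract m)) (xs @ (m, b) # ys))"
proof -
  have m: "1 \<le> m" "m < b" "b \<le> Suc N" using c(1) by (auto simp: compat_seq_def)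
  have "\<forall>p\<in>set (xs @ (m, b) # ys). fst p \<noteq> Suc m \<and> snd p \<noteq> Suc m"
    using compat_seq_below_first_max(2)[OF c] compat_seq_below_first_max(3)[OF c b] b
    unfolding set_append list.set Un_iff ball_Un by simp
  from compat_seq_contract[of N "[]", unfolded append_Nil, OF c(1) _ _ _ this] show ?thesis using m b by simp
qed

lemma compat_seq_contract_simple:
  assumes c: "compat_seq (Suc N) (xs @ (m, b) # ys)" "\<forall>p\<in>set xs. fst p < m" "\<forall>p\<in>set ys. fst p \<le> m"
    and b: "b = Suc m"
  shows "compat_seq N (map (on_pair (contract m)) (xs @ ys))"
proof -
  have "1 \<le> m" "b \<le> Suc N" "compat_seq (Suc N) (xs @ ys)" using c(1) by (auto simp: compat_seq_def sorted_wrt_append)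
  then show ?thesis
    using compat_seq_below_first_max(1,2)[OF c] b by (intro compat_seq_contract) simp_all
qed

text \<open>
  The bound is the rank of the Grothendieck group, but it also follows by induction: either the first
  pair with the largest left end is simple and can be contracted, or the point after its left end is
  isolated and can be deleted.
\<close>

lemma compat_seq_length: "compat_seq (Suc n) ps \<Longrightarrow> length ps \<le> n"
proof (induction n arbitrary: ps)
  case 0
  have "ps = []" using 0 unfolding compat_seq_def by (cases ps) auto
  then show ?case by simp
next
  case (Suc n)
  show ?case
  proof (cases "ps = []")
    case False
    obtain xs p ys where ps: "ps = xs @ p # ys" "\<forall>q\<in>set xs. fst q < fst p" "\<forall>q\<in>set ys. fst q \<le> fst p"
      using split_first_max[OF False, of fst] by metis
    obtain m b where p: "p = (m, b)" by force
    note c = Suc.prems[unfolded ps p]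
    show ?thesis
    proof (cases "b = Suc m")
      case True
      from compat_seq_contract_simple[OF c _ _ True] Suc.IH show ?thesis using ps p by fastforce
    next
      case False
      from compat_seq_remove_vertex[OF c _ _ False] Suc.IH show ?thesis using ps p by fastforce
    qed
  qed simp
qed

definition exc_pairs :: "nat \<Rightarrow> (nat \<times> nat) list set" where
  "exc_pairs n = {ps. length ps = n \<and> compat_seq (Suc n) ps}"

lemma exc_pairs_insert:
  assumes "xs @ ys \<in> exc_pairs n" "1 \<le> m" "m \<le> Suc n" "\<forall>p\<in>set xs. fst p < m" "\<forall>p\<in>set ys. fst p \<le> m"
  shows "map (on_pair (expand_lt m)) xs @ (m, Suc m) # map (on_pair (expand_le m)) ys \<in> exc_pairs (Suc n)"
  using assms compat_seq_expand[of "Suc n" xs ys m] unfolding exc_pairs_def by auto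

lemma fst_expand:
  "\<forall>p\<in>set xs. fst p < m \<Longrightarrow> map fst (map (on_pair (expand_lt m)) xs) = map fst xs"
  "\<forall>p\<in>set xs. fst p \<le> m \<Longrightarrow> map fst (map (on_pair (expand_le m)) xs) = map fst xs"
  by (auto simp: expand_lt_def expand_le_def)

text \<open>
  With the maximal number of pairs there is no isolated point to spare, so the first pair
  with the largest left end is \<open>(m, m + 1)\<close>.
\<close>

lemma exc_pairs_decompose:
  assumes "ps \<in> exc_pairs (Suc n)"
  obtains xs m ys where "xs @ ys \<in> exc_pairs n" "1 \<le> m" "m \<le> Suc n" "\<forall>p\<in>set xs. fst p < m" "\<forall>p\<in>set ys. fst p \<le> m"
    "ps = map (on_pair (expand_lt m)) xs @ (m, Suc m) # map (on_pair (expand_le m)) ys"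
proof -
  have "ps \<noteq> []" using assms unfolding exc_pairs_def by auto
  then obtain xs p ys where ps: "ps = xs @ p # ys" "\<forall>q\<in>set xs. fst q < fst p" "\<forall>q\<in>set ys. fst q \<le> fst p"
    using split_first_max[of ps fst] by metis
  obtain m b where p: "p = (m, b)" by force
  have c: "compat_seq (Suc (Suc n)) (xs @ (m, b) # ys)" "length xs + length ys = n"
    using assms ps p unfolding exc_pairs_def by auto
  have h: "\<forall>q\<in>set xs. fst q < m" "\<forall>q\<in>set ys. fst q \<le> m" using ps p by auto
  have b: "b = Suc m"
  proof (rule ccontr)
    assume "b \<noteq> Suc m"
    from compat_seq_length[OF compat_seq_remove_vertex[OF c(1) h this]] c(2) show False by simp
  qed
  let ?c = "on_pair (contract m)"
  note ne = compat_seq_below_first_max[OF c(1) h]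
  have "map ?c xs @ map ?c ys \<in> exc_pairs n"
    using compat_seq_contract_simple[OF c(1) h b] c(2) unfolding exc_pairs_def by simp
  moreover have "1 \<le> m" "m \<le> Suc n" using c(1) unfolding compat_seq_def by auto
  moreover have "\<forall>p\<in>set (map ?c xs). fst p < m" "\<forall>p\<in>set (map ?c ys). fst p \<le> m"
    using h by (auto simp: contract_def)
  moreover have "map (on_pair (expand_lt m)) (map ?c xs) = xs" "map (on_pair (expand_le m)) (map ?c ys) = ys"
    using ne by (auto simp: expand_contract intro!: map_idI)
  ultimately show ?thesis using that[of "map ?c xs" "map ?c ys" m] ps p b by simp
qed

lemma parking_iff: "f \<in> parking n \<longleftrightarrow> length f = n \<and> set f \<subseteq> {1..n} \<and> (\<forall>i\<in>{1..n}. i \<le> length (filter (\<lambda>x. x \<le> i) f))"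
  unfolding parking_def by (auto simp: length_filter_conv_card)

lemma parking_rev: "rev f \<in> parking n \<longleftrightarrow> f \<in> parking n"
  unfolding parking_iff by (simp add: rev_filter[symmetric])

text \<open>
  A maximum \<open>m\<close> has no influence on the number of entries \<open>\<le> i\<close> for \<open>i < m\<close>, and for \<open>i \<ge> m\<close> all
  entries are counted, so that the condition for \<open>i\<close> holds anyway.
\<close>

lemma parking_insert_max:
  assumes "\<forall>x\<in>set g. x < m" "\<forall>x\<in>set h. x \<le> m"
  shows "g @ m # h \<in> parking (Suc n) \<longleftrightarrow> g @ h \<in> parking n \<and> 1 \<le> m \<and> m \<le> Suc n"
proof -
  have all: "filter (\<lambda>x. x \<le> i) (g @ h) = g @ h" if "m \<le> i" for i
    using assms that by (intro filter_True) fastforce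
  show ?thesis
  proof
    assume f: "g @ m # h \<in> parking (Suc n)"
    have len: "length (g @ h) = n" and set: "set (g @ m # h) \<subseteq> {1..Suc n}"
      and cnt: "\<And>i. i \<in> {1..Suc n} \<Longrightarrow> i \<le> length (filter (\<lambda>x. x \<le> i) (g @ m # h))"
      using f by (auto simp: parking_iff)
    have c: "i \<le> length (filter (\<lambda>x. x \<le> i) (g @ h))" if "i \<in> {1..n}" for i
    proof (cases "m \<le> i")
      case True then show ?thesis using all[OF True] len that by simp
    next
      case False then show ?thesis using cnt[of i] that by simp
    qed
    have "set (g @ h) \<subseteq> {1..n}"
    proof
      fix x assume x: "x \<in> set (g @ h)"
      \<comment> \<open>The condition for \<open>i = n\<close> says that all entries are at most \<open>n\<close>.\<close>
      have "n \<ge> 1" using x len by (cases n) auto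
      then have "filter (\<lambda>x. x \<le> n) (g @ h) = g @ h"
        using c[of n] len by (metis (no_types, lifting) atLeastAtMost_iff filter_True le_antisym length_filter_le length_filter_less linorder_not_less order_refl)
      then have "x \<le> n" using x by (metis (no_types, lifting) filter_id_conv)
      then show "x \<in> {1..n}" using x set by auto
    qed
    then show "g @ h \<in> parking n \<and> 1 \<le> m \<and> m \<le> Suc n" using len set c by (auto simp: parking_iff)
  next
    assume a: "g @ h \<in> parking n \<and> 1 \<le> m \<and> m \<le> Suc n"
    then have len: "length (g @ h) = n" and set: "set (g @ h) \<subseteq> {1..n}"
      and cnt: "\<And>i. i \<in> {1..n} \<Longrightarrow> i \<le> length (filter (\<lambda>x. x \<le> i) (g @ h))"
      by (auto simp: parking_iff)
    have "i \<le> length (filter (\<lambda>x. x \<le> i) (g @ m # h))" if "i \<in> {1..Suc n}" for i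
    proof (cases "m \<le> i")
      case True
      have "length (filter (\<lambda>x. x \<le> i) g) + length (filter (\<lambda>x. x \<le> i) h) = n"
        using arg_cong[OF all[OF True], of length] len by simp
      then show ?thesis using True that by simp
    next
      case False then show ?thesis using cnt[of i] that a by simp
    qed
    then show "g @ m # h \<in> parking (Suc n)" using len set a by (fastforce simp: parking_iff)
  qed
qed

lemma first_max_unique:
  fixes g h :: "nat list"
  assumes "g @ m # h = g' @ m' # h'" "\<forall>x\<in>set g. x < m" "\<forall>x\<in>set h. x \<le> m" "\<forall>x\<in>set g'. x < m'" "\<forall>x\<in>set h'. x \<le> m'"
  shows "g = g' \<and> m = m' \<and> h = h'"
proof -
  have "Max (set (g @ m # h)) = m" "Max (set (g' @ m' # h')) = m'"
    using assms(2-5) by (auto intro!: Max_eqI)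
  then have "m = m'" using assms(1) by simp
  moreover have "m \<notin> set g" "m' \<notin> set g'" using assms by auto
  moreover have "takeWhile (\<lambda>x. x \<noteq> m) (a @ m # b) = a" if "m \<notin> set a" for a b
    using that by (induction a) auto
  ultimately have "g = g'" using assms(1) by metis
  then show ?thesis using assms(1) \<open>m = m'\<close> by simp
qed

text \<open>
  Both sides have the same recursive structure: an object for \<open>n + 1\<close> is an object for \<open>n\<close> together with
  a new largest entry \<open>m\<close> and a place for its first occurrence.
\<close>

theorem exc_pairs_parking: "bij_betw (map fst) (exc_pairs n) (parking n)"
proof (induction n)
  case 0
  have "exc_pairs 0 = {[]}" "parking 0 = {[]}" by (auto simp: exc_pairs_def compat_seq_def parking_iff)
  then show ?case by simp
next
  case (Suc n)
  show ?case
  proof (rule bij_betw_imageI)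
    show "inj_on (map fst) (exc_pairs (Suc n))"
    proof (rule inj_onI)
      fix ps ps' assume ps: "ps \<in> exc_pairs (Suc n)" and ps': "ps' \<in> exc_pairs (Suc n)" and eq: "map fst ps = map fst ps'"
      from exc_pairs_decompose[OF ps] obtain xs m ys where 1: "xs @ ys \<in> exc_pairs n" 
        "\<forall>p\<in>set xs. fst p < m" "\<forall>p\<in>set ys. fst p \<le> m"
        "ps = map (on_pair (expand_lt m)) xs @ (m, Suc m) # map (on_pair (expand_le m)) ys" by metis
      from exc_pairs_decompose[OF ps'] obtain xs' m' ys' where 2: "xs' @ ys' \<in> exc_pairs n" 
        "\<forall>p\<in>set xs'. fst p < m'" "\<forall>p\<in>set ys'. fst p \<le> m'"
        "ps' = map (on_pair (expand_lt m')) xs' @ (m', Suc m') # map (on_pair (expand_le m')) ys'" by metis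
      have "map fst xs @ m # map fst ys = map fst xs' @ m' # map fst ys'"
        using eq unfolding 1(4) 2(4) by (simp del: map_map add: fst_expand 1 2)
      then have e: "map fst xs = map fst xs'" "m = m'" "map fst ys = map fst ys'"
        using first_max_unique[of "map fst xs" m "map fst ys" "map fst xs'" m' "map fst ys'"] 1 2 by auto
      then have "map fst (xs @ ys) = map fst (xs' @ ys')" by simp
      then have "xs @ ys = xs' @ ys'" using inj_onD[OF bij_betw_imp_inj_on[OF Suc]] 1(1) 2(1) by blast
      then have "xs = xs'" "ys = ys'" using e(1) by (auto dest: map_eq_imp_length_eq)
      then show "ps = ps'" using 1 2 e by simp
    qed
    show "map fst ` exc_pairs (Suc n) = parking (Suc n)"
    proof (intro equalityI subsetI)
      fix f assume "f \<in> map fst ` exc_pairs (Suc n)"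
      then obtain ps where ps: "ps \<in> exc_pairs (Suc n)" "f = map fst ps" by blast
      from exc_pairs_decompose[OF ps(1)] obtain xs m ys where 1: "xs @ ys \<in> exc_pairs n" "1 \<le> m" "m \<le> Suc n" 
        "\<forall>p\<in>set xs. fst p < m" "\<forall>p\<in>set ys. fst p \<le> m"
        "ps = map (on_pair (expand_lt m)) xs @ (m, Suc m) # map (on_pair (expand_le m)) ys" by metis
      then have "f = map fst xs @ m # map fst ys" using ps(2) by (simp del: map_map add: fst_expand)
      moreover have "map fst xs @ map fst ys \<in> parking n" using bij_betwE[OF Suc] 1(1) by fastforce
      ultimately show "f \<in> parking (Suc n)" using 1 by (simp add: parking_insert_max)
    next
      fix f assume f: "f \<in> parking (Suc n)"
      then have "f \<noteq> []" by (auto simp: parking_iff)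
      then obtain g m h where g: "f = g @ m # h" "\<forall>x\<in>set g. x < m" "\<forall>x\<in>set h. x \<le> m"
        using split_first_max[of f id] by (metis id_apply)
      then have p: "g @ h \<in> parking n" "1 \<le> m" "m \<le> Suc n" using f parking_insert_max[of g m h n] by auto
      then obtain qs where qs: "qs \<in> exc_pairs n" "g @ h = map fst qs" using bij_betw_imp_surj_on[OF Suc] by blast
      then obtain xs ys where xy: "qs = xs @ ys" "g = map fst xs" "h = map fst ys" 
        by (metis append_eq_map_conv)
      have "map (on_pair (expand_lt m)) xs @ (m, Suc m) # map (on_pair (expand_le m)) ys \<in> exc_pairs (Suc n)"
        using exc_pairs_insert qs(1) xy p g by auto
      moreover have "map fst (map (on_pair (expand_lt m)) xs @ (m, Suc m) # map (on_pair (expand_le m)) ys) = f"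
        using xy g by (simp del: map_map add: fst_expand)
      ultimately show "f \<in> map fst ` exc_pairs (Suc n)" by (metis image_eqI)
    qed
  qed
qed

section \<open>Linear algebra\<close>

lemma lin_iff: "lin f \<longleftrightarrow> (\<forall>x y. f (x + y) = f x + f y) \<and> (\<forall>c x. f (scl c x) = scl c (f x))"
  by (simp add: Vector_Spaces.linear_iff ambient.vector_space_axioms)

lemma lin_add: "lin f \<Longrightarrow> f (x + y) = f x + f y"
  and lin_scl: "lin f \<Longrightarrow> f (scl c x) = scl c (f x)"
  by (simp_all add: lin_iff)

lemma scl_simps [simp]: "scl 0 v = 0" "scl 1 v = v" "scl c 0 = 0" "scl c v 0 = c * v 0"
  by (simp_all add: scl_def fun_eq_iff)

lemma scl_apply: "scl c v t = c * v t"
  by (simp add: scl_def)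

lemma lin_zero: "lin f \<Longrightarrow> f 0 = 0"
  using lin_scl[of f 0 0] by simp

lemma lin_diff: assumes "lin f" shows "f (x - y) = f x - f y"
  using lin_add[OF assms, of "x - y" y] by (simp add: algebra_simps)

lemma lin_comp: "lin f \<Longrightarrow> lin g \<Longrightarrow> lin (f \<circ> g)"
  by (simp add: lin_iff)

lemma lin_comp': "lin f \<Longrightarrow> lin g \<Longrightarrow> lin (\<lambda>x. f (g x))"
  by (simp add: lin_iff)

lemma lin_id [simp]: "lin id" "lin (\<lambda>x. x)"
  by (simp_all add: lin_iff)

lemma lin_0 [simp]: "lin (\<lambda>_. 0)" "lin 0"
  by (simp_all add: lin_iff)

lemma lin_plus: "lin f \<Longrightarrow> lin g \<Longrightarrow> lin (\<lambda>x. f x + g x)"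
  by (simp add: lin_iff ambient.scale_right_distrib algebra_simps)

lemma lin_coord: "lin (\<lambda>v. scl (v t) u)"
  by (simp add: lin_iff scl_def fun_eq_iff algebra_simps)

lemmas subspace_0 = ambient.subspace_0
  and subspace_add = ambient.subspace_add
  and subspace_scale = ambient.subspace_scale
  and subspace_diff = ambient.subspace_diff

lemma subspace_singleton_0 [simp]: "ambient.subspace {0}"
  by (rule ambient.subspace_single_0)

text \<open>
  The dimension \<open>ambient.dim\<close> is meaningful only for these subspaces, as the ambient space of all
  sequences is infinite-dimensional.
\<close>

definition fin_dim :: "(nat \<Rightarrow> 'k::field) set \<Rightarrow> bool" where
  "fin_dim S \<longleftrightarrow> ambient.subspace S \<and> (\<exists>B. finite B \<and> S = ambient.span B)"

lemma fin_dim_subspace: "fin_dim S \<Longrightarrow> ambient.subspace S"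
  by (simp add: fin_dim_def)

lemma fin_dim_span: "finite B \<Longrightarrow> fin_dim (ambient.span B)"
  unfolding fin_dim_def using ambient.subspace_span by blast

lemma fin_dim_0 [simp]: "fin_dim {0}"
  using fin_dim_span[of "{}"] by simp

lemma independent_in_fin_dim:
  assumes "fin_dim S" "ambient.independent B" "B \<subseteq> S"
  shows "finite B \<and> card B \<le> ambient.dim S"
proof -
  obtain A where A: "finite A" "S = ambient.span A" using assms(1) unfolding fin_dim_def by blast
  obtain C where C: "C \<subseteq> S" "ambient.independent C" "S \<subseteq> ambient.span C" "card C = ambient.dim S"
    by (rule ambient.basis_exists[of S])
  have "finite C" using ambient.independent_span_bound[OF A(1) C(2)] C(1) A(2) by blast
  moreover have "B \<subseteq> ambient.span C" using assms(3) C(3) by (rule subset_trans)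
  ultimately show ?thesis using ambient.independent_span_bound[OF _ assms(2)] C(4) by metis
qed

lemma fin_dim_mono:
  assumes "fin_dim S" "ambient.subspace T" "T \<subseteq> S"
  shows "fin_dim T"
proof -
  obtain C where C: "C \<subseteq> T" "ambient.independent C" "T \<subseteq> ambient.span C" "card C = ambient.dim T"
    by (rule ambient.basis_exists[of T])
  have "finite C" using independent_in_fin_dim[OF assms(1) C(2)] C(1) assms(3) by simp
  moreover have "T = ambient.span C" using C(3) ambient.span_minimal[OF C(1) assms(2)] by (rule subset_antisym)
  ultimately show ?thesis unfolding fin_dim_def using assms(2) by blast
qed

lemma dim_mono_fin_dim:
  assumes "fin_dim S" "T \<subseteq> S"
  shows "ambient.dim T \<le> ambient.dim S"
proof -
  obtain C where C: "C \<subseteq> T" "ambient.independent C" "T \<subseteq> ambient.span C" "card C = ambient.dim T"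
    by (rule ambient.basis_exists[of T])
  then show ?thesis using independent_in_fin_dim[OF assms(1) C(2)] assms(2) by simp
qed

lemma dim_less_fin_dim:
  assumes "fin_dim S" "ambient.subspace T" "T \<subset> S"
  shows "ambient.dim T < ambient.dim S"
proof -
  obtain C where C: "C \<subseteq> T" "ambient.independent C" "T \<subseteq> ambient.span C" "card C = ambient.dim T"
    by (rule ambient.basis_exists[of T])
  have sp: "ambient.span C \<subseteq> T" using ambient.span_minimal[OF C(1) assms(2)] .
  obtain x where x: "x \<in> S" "x \<notin> T" using assms(3) by blast
  have "x \<notin> ambient.span C" using x sp by blast
  then have "ambient.independent (insert x C)" "x \<notin> C"
    using ambient.independent_insertI[OF _ C(2)] ambient.span_base by blast+
  moreover have "insert x C \<subseteq> S" using x C(1) assms(3) by blast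
  ultimately show ?thesis using independent_in_fin_dim[OF assms(1), of "insert x C"] C(4)
    by auto
qed

interpretation ambient_pair: vector_space_pair "scl :: 'k::field \<Rightarrow> _" "scl :: 'k \<Rightarrow> _"
  by unfold_locales

lemma lin_left_inverse:
  assumes "lin f" "ambient.subspace S" "inj_on f S"
  obtains g where "lin g" "\<And>v. v \<in> S \<Longrightarrow> g (f v) = v"
  using ambient_pair.linear_exists_left_inverse_on[OF assms] by blast

text \<open>
  Morphisms are required to be restrictions of linear endomorphisms of the ambient space; this lemma
  provides the endomorphism when a map is only given on a subspace.
\<close>

lemma lin_extend:
  assumes S: "ambient.subspace S"
    and add: "\<And>x y. x \<in> S \<Longrightarrow> y \<in> S \<Longrightarrow> h (x + y) = h x + h y"
    and scale: "\<And>c x. x \<in> S \<Longrightarrow> h (scl c x) = scl c (h x)"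
  obtains g where "lin g" "\<And>x. x \<in> S \<Longrightarrow> g x = h x"
proof -
  obtain B where B: "B \<subseteq> S" "ambient.independent B" "S \<subseteq> ambient.span B" "card B = ambient.dim S"
    by (rule ambient.basis_exists[of S])
  obtain g where g: "lin g" "\<forall>x\<in>B. g x = h x"
    using ambient_pair.linear_independent_extend[OF B(2)] by blast
  have "ambient.subspace {x \<in> S. g x = h x}"
    unfolding ambient.subspace_def
    using subspace_0[OF S] subspace_add[OF S] subspace_scale[OF S] add scale scale[of 0 0] 
    by (auto simp: lin_add[OF g(1)] lin_scl[OF g(1)] lin_zero[OF g(1)])
  moreover have "B \<subseteq> {x \<in> S. g x = h x}" using B(1) g(2) by blast
  ultimately have "ambient.span B \<subseteq> {x \<in> S. g x = h x}" by (rule ambient.span_minimal[rotated])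
  then show thesis using B(3) g(1) by (intro that[of g]) blast+
qed

text \<open>
  The projection onto \<open>U\<close> along \<open>W\<close>, first defined on \<open>U + W\<close> and then extended.
\<close>

lemma lin_projection:
  assumes U: "ambient.subspace U" and W: "ambient.subspace W" and UW: "U \<inter> W = {0}"
  obtains p where "lin p" "\<And>u. u \<in> U \<Longrightarrow> p u = u" "\<And>w. w \<in> W \<Longrightarrow> p w = 0"
proof -
  define S where "S = {u + w |u w. u \<in> U \<and> w \<in> W}"
  define h where "h x = (SOME u. u \<in> U \<and> x - u \<in> W)" for x
  have h: "h (u + w) = u" if "u \<in> U" "w \<in> W" for u w
    unfolding h_def
  proof (rule some_equality)
    show "u \<in> U \<and> u + w - u \<in> W" using that by simp
    fix u' assume u': "u' \<in> U \<and> u + w - u' \<in> W"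
    then have "u - u' \<in> U" using subspace_diff[OF U] that by blast
    moreover have "u - u' = (u + w - u') - w" by simp
    then have "u - u' \<in> W" using subspace_diff[OF W] that u' by metis
    ultimately have "u - u' = 0" using UW by blast
    then show "u' = u" by simp
  qed
  have S: "ambient.subspace S" unfolding S_def by (rule ambient.subspace_sums[OF U W])
  obtain p where p: "lin p" "\<And>x. x \<in> S \<Longrightarrow> p x = h x"
  proof (rule lin_extend[OF S])
    fix x y assume "x \<in> S" "y \<in> S"
    then obtain u w u' w' where "x = u + w" "y = u' + w'" and *: "u \<in> U" "w \<in> W" "u' \<in> U" "w' \<in> W"
      unfolding S_def by blast
    moreover then have "x + y = (u + u') + (w + w')" by (simp add: algebra_simps)
    ultimately show "h (x + y) = h x + h y" using subspace_add[OF U] subspace_add[OF W] h by metis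
  next
    fix x c assume "x \<in> S"
    then obtain u w where "x = u + w" "u \<in> U" "w \<in> W" unfolding S_def by blast
    moreover then have "scl c x = scl c u + scl c w" by (simp add: ambient.scale_right_distrib)
    ultimately show "h (scl c x) = scl c (h x)" using subspace_scale[OF U] subspace_scale[OF W] h by metis
  qed blast
  have sum: "u + w \<in> S" if "u \<in> U" "w \<in> W" for u w using that unfolding S_def by blast
  have "u \<in> S" "h u = u" if "u \<in> U" for u
    using sum[OF that subspace_0[OF W]] h[OF that subspace_0[OF W]] by simp_all
  moreover have "w \<in> S" "h w = 0" if "w \<in> W" for w
    using sum[OF subspace_0[OF U] that] h[OF subspace_0[OF U] that] by simp_all
  ultimately show thesis using p by (intro that[of p]) auto
qed

section \<open>Structure maps and morphisms\<close>

lemma is_repI: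
  assumes "\<And>i. 1 \<le> i \<Longrightarrow> i \<le> n \<Longrightarrow> fin_dim (space X i)"
    and "\<And>i. 1 \<le> i \<Longrightarrow> i < n \<Longrightarrow> lin (arrow X i)"
    and "\<And>i v. 1 \<le> i \<Longrightarrow> i < n \<Longrightarrow> v \<in> space X (Suc i) \<Longrightarrow> arrow X i v \<in> space X i"
  shows "is_rep n X"
  using assms unfolding is_rep_def fin_dim_def by (auto simp: image_subset_iff)

lemma rep_fin_dim: "is_rep n X \<Longrightarrow> 1 \<le> i \<Longrightarrow> i \<le> n \<Longrightarrow> fin_dim (space X i)"
  unfolding is_rep_def fin_dim_def by simp

lemma rep_subspace: "is_rep n X \<Longrightarrow> 1 \<le> i \<Longrightarrow> i \<le> n \<Longrightarrow> ambient.subspace (space X i)"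
  by (rule fin_dim_subspace[OF rep_fin_dim])

lemma rep_lin: "is_rep n X \<Longrightarrow> 1 \<le> i \<Longrightarrow> i < n \<Longrightarrow> lin (arrow X i)"
  unfolding is_rep_def by simp

lemma rep_arrow: "is_rep n X \<Longrightarrow> 1 \<le> i \<Longrightarrow> i < n \<Longrightarrow> v \<in> space X (Suc i) \<Longrightarrow> arrow X i v \<in> space X i"
  unfolding is_rep_def by (auto simp: image_subset_iff)

text \<open>
  A vertex \<open>0\<close> carrying the zero space is added, with zero maps. Then \<open>Hom([a, b], U)\<close> and
  \<open>Ext\<^sup>1([a, b], U)\<close> are kernel and cokernel of a structure map also for \<open>a = 1\<close>, where
  \<open>[a, b]\<close> is projective.
\<close>

definition vsp :: "'k::field rep \<Rightarrow> nat \<Rightarrow> (nat \<Rightarrow> 'k) set" where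
  "vsp X i = (if i = 0 then {0} else space X i)"

definition varr :: "'k::field rep \<Rightarrow> nat \<Rightarrow> (nat \<Rightarrow> 'k) \<Rightarrow> nat \<Rightarrow> 'k" where
  "varr X i = (if i = 0 then \<lambda>_. 0 else arrow X i)"

definition vmap :: "(nat \<Rightarrow> (nat \<Rightarrow> 'k::field) \<Rightarrow> nat \<Rightarrow> 'k) \<Rightarrow> nat \<Rightarrow> (nat \<Rightarrow> 'k) \<Rightarrow> nat \<Rightarrow> 'k" where
  "vmap f i = (if i = 0 then \<lambda>_. 0 else f i)"

lemma v_pos [simp]: "0 < i \<Longrightarrow> vsp X i = space X i" "0 < i \<Longrightarrow> varr X i = arrow X i" "0 < i \<Longrightarrow> vmap f i = f i"
  by (simp_all add: vsp_def varr_def vmap_def)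

lemma v_0 [simp]: "vsp X 0 = {0}" "varr X 0 = (\<lambda>_. 0)" "vmap f 0 = (\<lambda>_. 0)"
  by (simp_all add: vsp_def varr_def vmap_def)

text \<open>
  \<open>down X i j\<close> is the composite structure map \<open>X\<^sub>j \<rightarrow> X\<^sub>i\<close> for \<open>i \<le> j\<close>.
\<close>

primrec down :: "'k::field rep \<Rightarrow> nat \<Rightarrow> nat \<Rightarrow> (nat \<Rightarrow> 'k) \<Rightarrow> nat \<Rightarrow> 'k" where
  "down X i 0 = id"
| "down X i (Suc j) = (if i \<le> j then down X i j \<circ> varr X j else id)"

lemma down_same [simp]: "down X i i v = v"
  by (cases i) auto

lemma vsp_subspace: "is_rep n X \<Longrightarrow> i \<le> n \<Longrightarrow> ambient.subspace (vsp X i)"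
  using fin_dim_subspace[OF rep_fin_dim[of n X i]] by (cases "i = 0") auto

lemma varr_lin: "is_rep n X \<Longrightarrow> i < n \<Longrightarrow> lin (varr X i)"
  using rep_lin[of n X i] by (cases "i = 0") auto

lemma varr_in: "is_rep n X \<Longrightarrow> i < n \<Longrightarrow> v \<in> vsp X (Suc i) \<Longrightarrow> varr X i v \<in> vsp X i"
  using rep_arrow[of n X i v] by (cases "i = 0") auto

lemma down_lin: "is_rep n X \<Longrightarrow> j \<le> n \<Longrightarrow> lin (down X i j)"
proof (induction j)
  case (Suc j)
  then show ?case using lin_comp[OF _ varr_lin, of "down X i j" n X j] by simp
qed simp

lemma down_in: "is_rep n X \<Longrightarrow> j \<le> n \<Longrightarrow> i \<le> j \<Longrightarrow> v \<in> vsp X j \<Longrightarrow> down X i j v \<in> vsp X i"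
proof (induction j arbitrary: v)
  case (Suc j)
  then show ?case using varr_in[of n X j v] by (cases "i = Suc j") (auto simp del: v_pos)
qed simp

lemma varr_down: "i < j \<Longrightarrow> varr X i (down X (Suc i) j v) = down X i j v"
proof (induction j arbitrary: v)
  case (Suc j)
  show ?case
  proof (cases "i = j")
    case False
    then show ?thesis using Suc by auto
  qed auto
qed simp

lemma down_down: "i \<le> j \<Longrightarrow> j \<le> k \<Longrightarrow> down X i j (down X j k v) = down X i k v"
proof (induction k arbitrary: v)
  case (Suc k)
  then show ?case by (cases "j = Suc k") auto
qed simp

lemma mor_rep: "is_mor n X Y f \<Longrightarrow> is_rep n X" "is_mor n X Y f \<Longrightarrow> is_rep n Y"
  by (simp_all add: is_mor_def)

lemma is_morI:
  assumes "is_rep n X" "is_rep n Y" "\<And>i. 1 \<le> i \<Longrightarrow> i \<le> n \<Longrightarrow> lin (f i)"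
    and "\<And>i v. 1 \<le> i \<Longrightarrow> i \<le> n \<Longrightarrow> v \<in> space X i \<Longrightarrow> f i v \<in> space Y i"
    and "\<And>i v. 1 \<le> i \<Longrightarrow> i < n \<Longrightarrow> v \<in> space X (Suc i) \<Longrightarrow> f i (arrow X i v) = arrow Y i (f (Suc i) v)"
  shows "is_mor n X Y f"
  using assms unfolding is_mor_def by (auto simp: image_subset_iff)

lemma mor_lin: "is_mor n X Y f \<Longrightarrow> 1 \<le> i \<Longrightarrow> i \<le> n \<Longrightarrow> lin (f i)"
  and mor_in: "is_mor n X Y f \<Longrightarrow> 1 \<le> i \<Longrightarrow> i \<le> n \<Longrightarrow> v \<in> space X i \<Longrightarrow> f i v \<in> space Y i"
  and mor_arrow: "is_mor n X Y f \<Longrightarrow> 1 \<le> i \<Longrightarrow> i < n \<Longrightarrow> v \<in> space X (Suc i)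
    \<Longrightarrow> f i (arrow X i v) = arrow Y i (f (Suc i) v)"
  unfolding is_mor_def by (auto simp: image_subset_iff)

lemma vmap_lin: "is_mor n X Y f \<Longrightarrow> i \<le> n \<Longrightarrow> lin (vmap f i)"
  using mor_lin[of n X Y f i] by (cases "i = 0") auto

lemma vmap_in: "is_mor n X Y f \<Longrightarrow> i \<le> n \<Longrightarrow> v \<in> vsp X i \<Longrightarrow> vmap f i v \<in> vsp Y i"
  using mor_in[of n X Y f i v] by (cases "i = 0") auto

lemma vmap_varr: "is_mor n X Y f \<Longrightarrow> i < n \<Longrightarrow> v \<in> vsp X (Suc i)
    \<Longrightarrow> vmap f i (varr X i v) = varr Y i (vmap f (Suc i) v)"
  using mor_arrow[of n X Y f i v] by (cases "i = 0") auto

lemma vmap_down: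
  assumes f: "is_mor n X Y f"
  shows "j \<le> n \<Longrightarrow> i \<le> j \<Longrightarrow> v \<in> vsp X j \<Longrightarrow> vmap f i (down X i j v) = down Y i j (vmap f j v)"
proof (induction j arbitrary: v)
  case (Suc j)
  then show ?case
    using varr_in[OF mor_rep(1)[OF f], of j v] vmap_varr[OF f, of j v]
    by (cases "i = Suc j") (auto simp del: v_pos)
qed simp

lemma mor_comp: "is_mor n X Y f \<Longrightarrow> is_mor n Y Z g \<Longrightarrow> is_mor n X Z (\<lambda>i. g i \<circ> f i)"
  unfolding is_mor_def by (auto simp: image_subset_iff intro: lin_comp)

lemma mono_epi_iso: "is_mor n X Y f \<Longrightarrow> (\<And>i. 1 \<le> i \<Longrightarrow> i \<le> n \<Longrightarrow> bij_betw (f i) (space X i) (space Y i)) \<Longrightarrow> iso n X Y"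
  unfolding iso_def is_mono_def is_epi_def bij_betw_def by (intro exI[of _ f]) simp

lemma isoE:
  assumes "iso n X Y"
  obtains f where "is_mor n X Y f" "\<And>i. 1 \<le> i \<Longrightarrow> i \<le> n \<Longrightarrow> bij_betw (f i) (space X i) (space Y i)"
  using assms unfolding iso_def is_mono_def is_epi_def bij_betw_def by auto

lemma iso_rep: "iso n X Y \<Longrightarrow> is_rep n X" "iso n X Y \<Longrightarrow> is_rep n Y"
  by (auto elim!: isoE dest: mor_rep)

lemma iso_refl: "is_rep n X \<Longrightarrow> iso n X X"
  by (rule mono_epi_iso[of n X X "\<lambda>_. id"]) (auto intro!: is_morI)

lemma iso_trans: assumes "iso n X Y" "iso n Y Z" shows "iso n X Z"
proof -
  obtain f where f: "is_mor n X Y f" "\<And>i. 1 \<le> i \<Longrightarrow> i \<le> n \<Longrightarrow> bij_betw (f i) (space X i) (space Y i)"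
    using isoE[OF assms(1)] by blast
  obtain g where g: "is_mor n Y Z g" "\<And>i. 1 \<le> i \<Longrightarrow> i \<le> n \<Longrightarrow> bij_betw (g i) (space Y i) (space Z i)"
    using isoE[OF assms(2)] by blast
  show ?thesis using mor_comp[OF f(1) g(1)] f(2) g(2) by (intro mono_epi_iso) (auto intro: bij_betw_trans)
qed

lemma iso_sym: assumes "iso n X Y" shows "iso n Y X"
proof -
  obtain f where f: "is_mor n X Y f" "\<And>i. 1 \<le> i \<Longrightarrow> i \<le> n \<Longrightarrow> bij_betw (f i) (space X i) (space Y i)"
    using isoE[OF assms] by blast
  have "\<exists>g. lin g \<and> (\<forall>v\<in>space X i. g (f i v) = v)" if "i \<in> {1..n}" for i
    using lin_left_inverse[of "f i" "space X i"] mor_lin[OF f(1)] f(2) that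
      fin_dim_subspace[OF rep_fin_dim[OF mor_rep(1)[OF f(1)]]]
    by (metis atLeastAtMost_iff bij_betw_imp_inj_on)
  then obtain g where g: "\<forall>i\<in>{1..n}. lin (g i) \<and> (\<forall>v\<in>space X i. g i (f i v) = v)" by metis
  have ex: "\<exists>u\<in>space X i. w = f i u" if "1 \<le> i" "i \<le> n" "w \<in> space Y i" for i w
    using f(2)[OF that(1,2)] that(3) unfolding bij_betw_def by blast
  have "is_mor n Y X g"
  proof (rule is_morI)
    fix i v assume i: "1 \<le> i" "i < n" and v: "v \<in> space Y (Suc i)"
    obtain u where u: "u \<in> space X (Suc i)" "v = f (Suc i) u" using ex[of "Suc i" v] i v by auto
    then have "arrow Y i v = f i (arrow X i u)" using mor_arrow[OF f(1) i] by simp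
    then show "g i (arrow Y i v) = arrow X i (g (Suc i) v)"
      using g i u rep_arrow[OF mor_rep(1)[OF f(1)] i u(1)] by simp
  qed (use g ex mor_rep[OF f(1)] in force)+
  moreover have "bij_betw (g i) (space Y i) (space X i)" if "1 \<le> i" "i \<le> n" for i
  proof (rule bij_betw_byWitness[where f' = "f i"])
    show "\<forall>a\<in>space Y i. f i (g i a) = a" "g i ` space Y i \<subseteq> space X i" using ex[OF that] g that by force+
    show "\<forall>a'\<in>space X i. g i (f i a') = a'" using g that by auto
    show "f i ` space X i \<subseteq> space Y i" using mor_in[OF f(1) that] by blast
  qed
  ultimately show ?thesis by (rule mono_epi_iso)
qed

definition inj_down :: "'k::field rep \<Rightarrow> nat \<Rightarrow> nat \<Rightarrow> bool" where
  "inj_down X i j \<longleftrightarrow> (\<forall>v\<in>vsp X j. down X i j v = 0 \<longrightarrow> v = 0)"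

definition surj_down :: "'k::field rep \<Rightarrow> nat \<Rightarrow> nat \<Rightarrow> bool" where
  "surj_down X i j \<longleftrightarrow> vsp X i \<subseteq> down X i j ` vsp X j"

lemma vmap_bij:
  assumes "\<forall>i. 1 \<le> i \<longrightarrow> i \<le> n \<longrightarrow> bij_betw (f i) (space X i) (space Y i)" "i \<le> n"
  shows "bij_betw (vmap f i) (vsp X i) (vsp Y i)"
  using assms by (cases "i = 0") (auto simp: bij_betw_def)

lemma iso_down:
  assumes "iso n X Y" "i \<le> j" "j \<le> n"
  shows "inj_down X i j \<longleftrightarrow> inj_down Y i j" "surj_down X i j \<longleftrightarrow> surj_down Y i j"
proof -
  have *: "(inj_down Y i j \<longrightarrow> inj_down X i j) \<and> (surj_down X i j \<longrightarrow> surj_down Y i j)" if iso: "iso n X Y" for X Y :: "'a rep"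
  proof -
    obtain f where f: "is_mor n X Y f" "\<And>i. 1 \<le> i \<Longrightarrow> i \<le> n \<Longrightarrow> bij_betw (f i) (space X i) (space Y i)"
      using isoE[OF iso] by blast
    have i: "i \<le> n" using assms by simp
    have b: "bij_betw (vmap f i) (vsp X i) (vsp Y i)" if "i \<le> n" for i
      using f(2) that by (intro vmap_bij) auto
    have "v = 0" if "inj_down Y i j" "v \<in> vsp X j" "down X i j v = 0" for v
    proof -
      have "down Y i j (vmap f j v) = 0"
        using vmap_down[OF f(1) assms(3,2) that(2)] that(3) lin_zero[OF vmap_lin[OF f(1) i]] by simp
      then have "vmap f j v = vmap f j 0"
        using that(1) vmap_in[OF f(1) assms(3) that(2)] lin_zero[OF vmap_lin[OF f(1) assms(3)]] unfolding inj_down_def by simp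
      then show "v = 0" using b[OF assms(3)] that(2) subspace_0[OF vsp_subspace[OF mor_rep(1)[OF f(1)] assms(3)]]
        unfolding bij_betw_def by (blast dest: inj_onD)
    qed
    moreover have "w \<in> down Y i j ` vsp Y j" if surj: "surj_down X i j" and w: "w \<in> vsp Y i" for w
    proof -
      obtain v where v: "v \<in> vsp X i" "w = vmap f i v" using b[OF i] w unfolding bij_betw_def by blast
      obtain u where u: "u \<in> vsp X j" "v = down X i j u" using surj v(1) unfolding surj_down_def by blast
      then show ?thesis using vmap_down[OF f(1) assms(3,2) u(1)] v vmap_in[OF f(1) assms(3) u(1)] by auto
    qed
    ultimately show ?thesis unfolding inj_down_def surj_down_def by blast
  qed
  show "inj_down X i j \<longleftrightarrow> inj_down Y i j" "surj_down X i j \<longleftrightarrow> surj_down Y i j"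
    using *[OF assms(1)] *[OF iso_sym[OF assms(1)]] by blast+
qed

section \<open>Interval modules\<close>

\<comment> \<open>Vertices occur as \<open>a - 1\<close> and \<open>b - 1\<close>; rewriting \<open>1\<close> to \<open>Suc 0\<close> would hide these terms from instantiated rules.\<close>
declare One_nat_def [simp del]

abbreviation unit0 :: "nat \<Rightarrow> 'k::field" where
  "unit0 \<equiv> (\<lambda>j. if j = 0 then 1 else 0)"

lemma unit0_span: "v \<in> ambient.span {unit0} \<longleftrightarrow> v = scl (v 0) unit0"
proof
  assume "v \<in> ambient.span {unit0}"
  then obtain c where "v = scl c unit0" unfolding ambient.span_singleton by blast
  then show "v = scl (v 0) unit0" by simp
next
  assume "v = scl (v 0) unit0"
  then show "v \<in> ambient.span {unit0}" unfolding ambient.span_singleton by blast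
qed

lemma interval_space: "space (interval_mod a b) i = (if a \<le> i \<and> i < b then ambient.span {unit0} else {0})"
  and interval_arrow: "arrow (interval_mod a b) i = (if a \<le> i \<and> Suc i < b then id else (\<lambda>_. 0))"
  by (simp_all add: interval_mod_def)

lemma interval_rep: "is_rep n (interval_mod a b)"
  by (rule is_repI) (auto simp: interval_space interval_arrow fin_dim_span ambient.span_zero)

lemma unit0_nonzero: "unit0 \<noteq> 0"
proof
  assume "(unit0 :: nat \<Rightarrow> 'a) = 0"
  from fun_cong[OF this, of 0] show False by simp
qed

lemma unit0_in: "a \<le> i \<Longrightarrow> i < b \<Longrightarrow> unit0 \<in> space (interval_mod a b) i"
  by (simp add: interval_space ambient.span_base)

lemma interval_vsp: "1 \<le> a \<Longrightarrow> vsp (interval_mod a b) i = (if a \<le> i \<and> i < b then ambient.span {unit0} else {0})"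
  by (cases "i = 0") (auto simp: interval_space)

lemma interval_down:
  assumes "1 \<le> a" 
  shows "a \<le> i \<Longrightarrow> i \<le> j \<Longrightarrow> j < b \<Longrightarrow> down (interval_mod a b) i j v = v"
proof (induction j)
  case (Suc j)
  then show ?case using assms by (cases "i = Suc j") (auto simp: interval_arrow)
qed simp

lemma interval_inj_down:
  assumes "1 \<le> a" "i \<le> j" "j \<le> n"
  shows "inj_down (interval_mod a b :: 'k::field rep) i j \<longleftrightarrow> (a \<le> j \<and> j < b \<longrightarrow> a \<le> i \<and> i < b)"
proof (cases "a \<le> j \<and> j < b")
  case True
  show ?thesis
  proof (cases "a \<le> i")
    case True
    then show ?thesis using \<open>a \<le> j \<and> j < b\<close> assms interval_down[OF assms(1) True assms(2), of b, where ?'a = 'k]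
      by (simp add: inj_down_def)
  next
    case False
    have "down (interval_mod a b) i j (unit0 :: nat \<Rightarrow> 'k) \<in> vsp (interval_mod a b) i"
      using True by (intro down_in[OF interval_rep assms(3,2)]) (auto simp: interval_vsp interval_space assms ambient.span_base)
    then show ?thesis using True False unit0_nonzero[where ?'a = 'k]
      by (auto simp: inj_down_def interval_vsp interval_space assms intro!: bexI[of _ unit0] ambient.span_base)
  qed
next
  case False
  then show ?thesis by (auto simp: inj_down_def interval_vsp interval_space assms)
qed

lemma interval_surj_down:
  assumes "1 \<le> a" "i \<le> j" "j \<le> n"
  shows "surj_down (interval_mod a b :: 'k::field rep) i j \<longleftrightarrow> (a \<le> i \<and> i < b \<longrightarrow> a \<le> j \<and> j < b)"
proof (cases "a \<le> i \<and> i < b")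
  case True
  show ?thesis
  proof (cases "j < b")
    case j: True
    have "down (interval_mod a b :: 'k rep) i j = id"
      using interval_down[OF assms(1) _ assms(2) j, where ?'a = 'k] True by auto
    then show ?thesis using True j assms by (simp add: surj_down_def interval_vsp interval_space)
  next
    case False
    then have "vsp (interval_mod a b :: 'k rep) j = {0}" by (simp add: interval_vsp interval_space assms)
    then have "down (interval_mod a b :: 'k rep) i j ` vsp (interval_mod a b) j = {0}"
      using lin_zero[OF down_lin[OF interval_rep assms(3)]] by simp
    moreover have "(unit0 :: nat \<Rightarrow> 'k) \<in> vsp (interval_mod a b) i" using True by (simp add: interval_vsp interval_space assms ambient.span_base)
    ultimately show ?thesis using True False unit0_nonzero[where ?'a = 'k] unfolding surj_down_def by auto
  qed
next
  case False
  have "0 \<in> vsp (interval_mod a b :: 'k rep) j"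
    by (rule subspace_0[OF vsp_subspace[OF interval_rep assms(3)]])
  moreover have "down (interval_mod a b) i j (0 :: nat \<Rightarrow> 'k) = 0"
    by (rule lin_zero[OF down_lin[OF interval_rep assms(3)]])
  ultimately have "0 \<in> down (interval_mod a b :: 'k rep) i j ` vsp (interval_mod a b) j" 
    by (metis imageI)
  then show ?thesis using False by (auto simp: surj_down_def interval_vsp interval_space assms)
qed

text \<open>
  The morphism \<open>[a, b] \<rightarrow> U\<close> that sends the generator of \<open>[a, b]\<close> at its top vertex \<open>b - 1\<close> to
  \<open>u\<close>. It exists iff \<open>u\<close> vanishes in \<open>U\<^sub>a\<^sub>-\<^sub>1\<close>.
\<close>

definition vector_mor :: "'k::field rep \<Rightarrow> nat \<Rightarrow> nat \<Rightarrow> (nat \<Rightarrow> 'k) \<Rightarrow> nat \<Rightarrow> (nat \<Rightarrow> 'k) \<Rightarrow> nat \<Rightarrow> 'k" where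
  "vector_mor U a b u = (\<lambda>i. if a \<le> i \<and> i < b then (\<lambda>v. scl (v 0) (down U i (b - 1) u)) else (\<lambda>_. 0))"

lemma vector_mor:
  assumes U: "is_rep n U" and ab: "1 \<le> a" "a < b" "b \<le> Suc n"
    and u: "u \<in> vsp U (b - 1)" "down U (a - 1) (b - 1) u = 0"
  shows "is_mor n (interval_mod a b) U (vector_mor U a b u)"
proof (rule is_morI[OF interval_rep U])
  have b: "b - 1 \<le> n" using ab by simp
  fix i assume i: "1 \<le> i" "i \<le> n"
  show "lin (vector_mor U a b u i)" by (simp add: vector_mor_def lin_coord)
  have s: "ambient.subspace (space U i)" using vsp_subspace[OF U i(2)] i by simp
  fix v assume "v \<in> space (interval_mod a b :: 'a rep) i"
  show "vector_mor U a b u i v \<in> space U i"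
  proof (cases "a \<le> i \<and> i < b")
    case True
    then have "down U i (b - 1) u \<in> space U i" using down_in[OF U b _ u(1), of i] i by auto
    then show ?thesis using True by (simp add: vector_mor_def subspace_scale[OF s])
  qed (auto simp: vector_mor_def subspace_0[OF s])
next
  fix i v assume i: "1 \<le> i" "i < n" and v: "v \<in> space (interval_mod a b :: 'a rep) (Suc i)"
  have l: "lin (arrow U i)" using rep_lin[OF U i] .
  show "vector_mor U a b u i (arrow (interval_mod a b) i v) = arrow U i (vector_mor U a b u (Suc i) v)"
  proof (cases "a \<le> Suc i \<and> Suc i < b")
    case True
    then have "arrow U i (down U (Suc i) (b - 1) u) = down U i (b - 1) u"
      using varr_down[of i "b - 1" U u] i by auto
    then have *: "arrow U i (vector_mor U a b u (Suc i) v) = scl (v 0) (down U i (b - 1) u)"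
      using True by (simp add: vector_mor_def lin_scl[OF l])
    show ?thesis
    proof (cases "a \<le> i")
      case False
      then have "a - 1 = i" using True by auto
      then show ?thesis unfolding * using u(2) False by (simp add: vector_mor_def)
    qed (use * True in \<open>simp add: vector_mor_def interval_arrow\<close>)
  next
    case False
    then have "v = 0" using v by (auto simp: interval_space)
    then show ?thesis using False by (simp add: vector_mor_def lin_zero[OF l] interval_arrow)
  qed
qed

text \<open>
  A morphism from \<open>[a, b]\<close> is determined by the image of the generator at \<open>b - 1\<close>, which is an
  arbitrary element of the kernel of \<open>U\<^sub>b\<^sub>-\<^sub>1 \<rightarrow> U\<^sub>a\<^sub>-\<^sub>1\<close>.
\<close>

lemma hom_zero_interval:
  assumes U: "is_rep n U" and ab: "1 \<le> a" "a < b" "b \<le> Suc n"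
  shows "hom_zero n (interval_mod a b) U \<longleftrightarrow> inj_down U (a - 1) (b - 1)"
proof
  have b: "b - 1 \<le> n" "1 \<le> b - 1" "a \<le> b - 1" "b - 1 < b" "a - 1 \<le> b - 1" using ab by auto
  assume h: "hom_zero n (interval_mod a b) U"
  show "inj_down U (a - 1) (b - 1)" unfolding inj_down_def
  proof (intro ballI impI)
    fix u assume u: "u \<in> vsp U (b - 1)" "down U (a - 1) (b - 1) u = 0"
    have "vector_mor U a b u (b - 1) unit0 = 0"
      using h vector_mor[OF U ab u] unit0_in[OF b(3,4), where ?'a = 'a] b(1,2) unfolding hom_zero_def by auto
    then show "u = 0" using b by (simp add: vector_mor_def)
  qed
next
  have b: "b - 1 \<le> n" "1 \<le> b - 1" "a \<le> b - 1" "b - 1 < b" "a - 1 \<le> b - 1" using ab by auto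
  assume inj: "inj_down U (a - 1) (b - 1)"
  show "hom_zero n (interval_mod a b) U" unfolding hom_zero_def
  proof (intro allI impI ballI)
    fix f i v
    assume f: "is_mor n (interval_mod a b) U f" and i: "i \<in> {1..n}" and v: "v \<in> space (interval_mod a b :: 'a rep) i"
    let ?I = "interval_mod a b :: 'a rep"
    have e: "unit0 \<in> vsp ?I (b - 1)" using b unit0_in[OF b(3,4)] by simp
    have "down ?I (a - 1) (b - 1) unit0 = 0"
      using down_in[OF interval_rep b(1,5) e] ab by (simp add: interval_vsp interval_space split: if_splits)
    then have "down U (a - 1) (b - 1) (vmap f (b - 1) unit0) = 0"
      using vmap_down[OF f b(1,5) e] lin_zero[OF vmap_lin[OF f, of "a - 1"]] b by simp
    then have 0: "vmap f (b - 1) unit0 = 0" using inj vmap_in[OF f b(1) e] unfolding inj_down_def by blast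
    show "f i v = 0"
    proof (cases "a \<le> i \<and> i < b")
      case True
      have "vmap f i (down ?I i (b - 1) unit0) = 0"
        using vmap_down[OF f b(1) _ e, of i] 0 True lin_zero[OF down_lin[OF U b(1)]] by auto
      then have "f i unit0 = 0" using interval_down[OF ab(1), of i "b - 1" b, where ?'a = 'a] True i b by auto
      moreover have "v = scl (v 0) unit0" using v True by (simp add: interval_space unit0_span)
      ultimately show ?thesis using lin_scl[OF mor_lin[OF f], of i "v 0" unit0] i by simp
    next
      case False
      then have "v = 0" using v by (auto simp: interval_space)
      then show ?thesis using lin_zero[OF mor_lin[OF f]] i by simp
    qed
  qed
qed

lemma short_exactD:
  assumes "short_exact n X f Y g Z"
  shows "is_mor n X Y f" "is_mor n Y Z g"
    and "i \<le> n \<Longrightarrow> inj_on (vmap f i) (vsp X i)"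
    and "i \<le> n \<Longrightarrow> vmap f i ` vsp X i = {v \<in> vsp Y i. vmap g i v = 0}"
    and "i \<le> n \<Longrightarrow> vmap g i ` vsp Y i = vsp Z i"
proof -
  note se = assms[unfolded short_exact_def exact_at_def is_mono_def is_epi_def]
  show "is_mor n X Y f" "is_mor n Y Z g" using se by blast+
  assume i: "i \<le> n"
  show "inj_on (vmap f i) (vsp X i)" using se i by (cases "i = 0") simp_all
  show "vmap f i ` vsp X i = {v \<in> vsp Y i. vmap g i v = 0}" 
  proof (cases "i = 0")
    case False
    then show ?thesis using se i by (simp only: v_pos neq0_conv) simp
  qed auto
  show "vmap g i ` vsp Y i = vsp Z i" using se i by (cases "i = 0") simp_all
qed

text \<open>
  A preimage \<open>y\<close> of the generator of \<open>[a, b]\<close> defines a splitting if it vanishes at \<open>a - 1\<close>. Its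
  image there comes from \<open>U\<^sub>a\<^sub>-\<^sub>1\<close>, hence by surjectivity from \<open>U\<^sub>b\<^sub>-\<^sub>1\<close>, and \<open>y\<close> can be corrected.
\<close>

lemma ext_zero_if_surj:
  assumes U: "is_rep n U" and ab: "1 \<le> a" "a < b" "b \<le> Suc n"
    and surj: "surj_down U (a - 1) (b - 1)"
  shows "ext_zero n (interval_mod a b) U"
  unfolding ext_zero_def
proof (intro allI impI)
  let ?I = "interval_mod a b :: 'a rep"
  have b: "b - 1 \<le> n" "1 \<le> b - 1" "a \<le> b - 1" "b - 1 < b" "a - 1 \<le> b - 1" "a - 1 \<le> n" using ab by auto
  fix Y f g assume se: "short_exact n U f Y g ?I"
  note f = short_exactD(1)[OF se] and g = short_exactD(2)[OF se]
  note Y = mor_rep(2)[OF f]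
  have e: "unit0 \<in> vsp ?I (b - 1)" using b unit0_in[OF b(3,4)] by simp
  then have "unit0 \<in> vmap g (b - 1) ` vsp Y (b - 1)" unfolding short_exactD(5)[OF se b(1)] .
  then obtain y where y: "y \<in> vsp Y (b - 1)" "vmap g (b - 1) y = unit0" by auto
  have "down ?I (a - 1) (b - 1) unit0 = 0"
    using down_in[OF interval_rep b(1,5) e] ab by (simp add: interval_vsp interval_space split: if_splits)
  then have "vmap g (a - 1) (down Y (a - 1) (b - 1) y) = 0" using vmap_down[OF g b(1,5) y(1)] y(2) by simp
  then obtain u' where u': "u' \<in> vsp U (a - 1)" "down Y (a - 1) (b - 1) y = vmap f (a - 1) u'"
    using short_exactD(4)[OF se b(6)] down_in[OF Y b(1,5) y(1)] by blast
  then obtain u where u: "u \<in> vsp U (b - 1)" "u' = down U (a - 1) (b - 1) u"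
    using surj unfolding surj_down_def by blast
  define z where "z = y - vmap f (b - 1) u"
  have fu: "vmap f (b - 1) u \<in> {v \<in> vsp Y (b - 1). vmap g (b - 1) v = 0}"
    using short_exactD(4)[OF se b(1)] u(1) by blast
  have z: "z \<in> vsp Y (b - 1)" "vmap g (b - 1) z = unit0"
    unfolding z_def using y fu subspace_diff[OF vsp_subspace[OF Y b(1)]]
    by (auto simp: lin_diff[OF vmap_lin[OF g b(1)]])
  have z0: "down Y (a - 1) (b - 1) z = 0"
    unfolding z_def lin_diff[OF down_lin[OF Y b(1)]] using u'(2) u vmap_down[OF f b(1,5) u(1)] by simp
  show "\<exists>s. is_mor n ?I Y s \<and> (\<forall>i\<in>{1..n}. \<forall>v\<in>space ?I i. g i (s i v) = v)"
  proof (intro exI conjI ballI)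
    show "is_mor n ?I Y (vector_mor Y a b z)" by (rule vector_mor[OF Y ab z(1) z0])
    fix i v assume i: "i \<in> {1..n}" and v: "v \<in> space ?I i"
    have l: "lin (g i)" using mor_lin[OF g] i by simp
    show "g i (vector_mor Y a b z i v) = v"
    proof (cases "a \<le> i \<and> i < b")
      case True
      have "g i (down Y i (b - 1) z) = down ?I i (b - 1) unit0"
        using vmap_down[OF g b(1) _ z(1), of i] True i z(2) by auto
      also have "\<dots> = unit0" using True by (intro interval_down[OF ab(1)]) auto
      finally have "g i (vector_mor Y a b z i v) = scl (v 0) unit0"
        using True by (simp add: vector_mor_def lin_scl[OF l])
      moreover have "v = scl (v 0) unit0" using v True by (simp add: interval_space unit0_span)
      ultimately show ?thesis by simp
    next
      case False
      then have "v = 0" using v by (auto simp: interval_space)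
      then show ?thesis using False by (simp add: vector_mor_def lin_zero[OF l])
    qed
  qed
qed

text \<open>
  \<open>push\<close> frees the coordinate \<open>0\<close> and \<open>pull\<close> forgets it. In this way the direct sum of a subspace
  and a line is again a subspace of the ambient space.
\<close>

definition push :: "(nat \<Rightarrow> 'k::field) \<Rightarrow> nat \<Rightarrow> 'k" where
  "push v = (\<lambda>j. if j = 0 then 0 else v (j - 1))"

definition pull :: "(nat \<Rightarrow> 'k::field) \<Rightarrow> nat \<Rightarrow> 'k" where
  "pull v = (\<lambda>j. v (Suc j))"

lemma push_pull_simps [simp]: "pull (push v) = v" "push v 0 = 0" "pull 0 = 0" "push 0 = 0" "pull unit0 = 0"
  "pull (v + w) = pull v + pull w" "pull (scl c v) = scl c (pull v)"
  by (auto simp: push_def pull_def scl_def fun_eq_iff)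

lemma pull_unit: "pull (push v + unit0) = v" and push_unit: "(push v + unit0) 0 = 1"
  by (auto simp: push_def pull_def fun_eq_iff)

lemma push_lin: "lin push" and pull_lin: "lin pull"
  by (auto simp: lin_iff push_def pull_def scl_def fun_eq_iff)

lemma push_pull: "push (pull v) + scl (v 0) unit0 = v"
  by (auto simp: push_def pull_def scl_def fun_eq_iff)

lemma fin_dim_pull:
  fixes S :: "(nat \<Rightarrow> 'k::field) set"
  assumes "fin_dim S"
  shows "fin_dim {w. pull w \<in> S \<and> (Q \<or> w 0 = 0)}"
proof -
  obtain B where B: "finite B" "S = ambient.span B" using assms unfolding fin_dim_def by blast
  let ?B = "insert unit0 (push ` B)"
  let ?T = "{w. pull w \<in> S \<and> (Q \<or> w 0 = 0)}"
  have "fin_dim (ambient.span ?B)" by (rule fin_dim_span) (use B in simp)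
  moreover have "ambient.subspace ?T"
    unfolding ambient.subspace_def
    using subspace_0[OF fin_dim_subspace[OF assms]] subspace_add[OF fin_dim_subspace[OF assms]]
      subspace_scale[OF fin_dim_subspace[OF assms]] by auto
  moreover have "?T \<subseteq> ambient.span ?B"
  proof
    fix w assume "w \<in> ?T"
    then have "push (pull w) \<in> push ` ambient.span B" using B by auto
    also have "\<dots> = ambient.span (push ` B)" by (rule ambient_pair.linear_span_image[OF push_lin, symmetric])
    also have "\<dots> \<subseteq> ambient.span ?B" by (rule ambient.span_mono) auto
    finally have "push (pull w) + scl (w 0) unit0 \<in> ambient.span ?B"
      by (intro ambient.span_add ambient.span_scale) (auto intro: ambient.span_base)
    then show "w \<in> ambient.span ?B" by (simp only: push_pull)
  qed
  ultimately show ?thesis by (rule fin_dim_mono)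
qed

text \<open>
  An element \<open>u\<close> of \<open>U\<^sub>a\<^sub>-\<^sub>1\<close> defines the extension of \<open>[a, b]\<close> by \<open>U\<close> whose underlying spaces are
  those of the direct sum and in which the generator is mapped to \<open>u\<close> at the vertex \<open>a - 1\<close>. A
  splitting exhibits \<open>u\<close> as an image of \<open>U\<^sub>b\<^sub>-\<^sub>1\<close>.
\<close>

lemma surj_if_ext_zero:
  assumes U: "is_rep n U" and ab: "1 \<le> a" "a < b" "b \<le> Suc n"
    and ext: "ext_zero n (interval_mod a b) U"
  shows "surj_down U (a - 1) (b - 1)"
proof (cases "a = 1")
  case True
  then have "vsp U (a - 1) = {0}" by simp
  moreover have "0 \<in> down U (a - 1) (b - 1) ` vsp U (b - 1)"
    using ab lin_zero[OF down_lin[OF U, of "b - 1" "a - 1"]] subspace_0[OF vsp_subspace[OF U, of "b - 1"]] 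
    by (metis diff_Suc_1 diff_le_mono imageI)
  ultimately show ?thesis unfolding surj_down_def by simp
next
  case a1: False
  let ?I = "interval_mod a b :: 'a rep"
  have b: "b - 1 \<le> n" "1 \<le> b - 1" "a \<le> b - 1" "b - 1 < b" "a - 1 \<le> b - 1" "a - 1 \<le> n" using ab by auto
  show ?thesis unfolding surj_down_def
  proof
    fix u assume "u \<in> vsp U (a - 1)"
    then have u: "u \<in> space U (a - 1)" using a1 ab by simp
    define P where "P i \<longleftrightarrow> a \<le> i \<and> i < b" for i
    \<comment> \<open>The line of \<open>[a, b]\<close> is the coordinate \<open>0\<close>; the term with \<open>u\<close> is the only deviation from the direct sum.\<close>
    define Y :: "'a rep" where "Y = \<lparr>space = (\<lambda>i. {w. pull w \<in> space U i \<and> (P i \<or> w 0 = 0)}),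
      arrow = (\<lambda>i w. push (arrow U i (pull w) + scl (w 0) (if i = a - 1 then u else 0)) 
        + scl (w 0) (if P i \<and> P (Suc i) then unit0 else 0))\<rparr>"
    have Ysp: "w \<in> space Y i \<longleftrightarrow> pull w \<in> space U i \<and> (P i \<or> w 0 = 0)" for w i
      by (simp add: Y_def)
    have Yarr: "arrow Y i w = push (arrow U i (pull w) + scl (w 0) (if i = a - 1 then u else 0)) 
        + scl (w 0) (if P i \<and> P (Suc i) then unit0 else 0)" for i w
      by (simp add: Y_def)
    have Y: "is_rep n Y"
    proof (rule is_repI)
      fix i assume i: "1 \<le> i" "i \<le> n"
      show "fin_dim (space Y i)" using fin_dim_pull[OF rep_fin_dim[OF U i], of "P i"] by (simp add: Y_def)
    next
      fix i assume i: "1 \<le> i" "i < n"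
      have "lin (\<lambda>w. push (arrow U i (pull w) + scl (w 0) c) + scl (w 0) d)" for c d
        by (intro lin_plus lin_comp'[OF push_lin] lin_comp'[OF rep_lin[OF U i]] pull_lin lin_coord)
      then show "lin (arrow Y i)" by (simp add: Y_def)
      fix w assume w: "w \<in> space Y (Suc i)"
      note s = fin_dim_subspace[OF rep_fin_dim[OF U i(1)]]
      have "arrow U i (pull w) \<in> space U i" using rep_arrow[OF U i] w by (simp add: Ysp)
      then have "arrow U i (pull w) + scl (w 0) (if i = a - 1 then u else 0) \<in> space U i"
        using i u by (intro subspace_add[OF s] subspace_scale[OF s]) (auto simp: subspace_0[OF s])
      then show "arrow Y i w \<in> space Y i"
        unfolding Ysp Yarr by auto
    qed
    have f: "is_mor n U Y (\<lambda>_. push)"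
      by (rule is_morI[OF U Y]) (auto simp: push_lin Ysp Yarr)
    have g: "is_mor n Y ?I (\<lambda>_ w. scl (w 0) unit0)"
    proof (rule is_morI[OF Y interval_rep])
      fix i w assume "1 \<le> i" "i \<le> n" "w \<in> space Y i"
      then show "scl (w 0) unit0 \<in> space ?I i" by (auto simp: Ysp interval_space P_def unit0_span)
    next
      fix i w assume i: "1 \<le> i" "i < n" "w \<in> space Y (Suc i)"
      then show "scl (arrow Y i w 0) unit0 = arrow ?I i (scl (w 0) unit0)"
        by (auto simp: Ysp Yarr interval_arrow P_def)
    qed (rule lin_coord)
    have inj: "inj push" by (metis injI push_pull_simps(1))
    have "push ` space U i = {w \<in> space Y i. scl (w 0) unit0 = 0}" for i
    proof (intro equalityI subsetI)
      fix w assume "w \<in> {w \<in> space Y i. scl (w 0) unit0 = 0}"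
      then have w: "pull w \<in> space U i" "scl (w 0) (unit0 :: nat \<Rightarrow> 'a) = 0" by (auto simp: Ysp)
      then have "w = push (pull w)" using push_pull[of w] unfolding w(2) by simp
      then show "w \<in> push ` space U i" using w(1) by blast
    qed (auto simp: Ysp)
    moreover have "(\<lambda>w. scl (w 0) unit0) ` space Y i = space ?I i" if i: "1 \<le> i" "i \<le> n" for i
    proof (intro equalityI subsetI)
      fix v assume v: "v \<in> space ?I i"
      then have "v = scl (v 0) unit0" "P i \<or> v = 0" by (auto simp: interval_space P_def unit0_span split: if_splits)
      moreover have "scl (v 0) unit0 \<in> space Y i" 
        using calculation(2) subspace_0[OF fin_dim_subspace[OF rep_fin_dim[OF U i]]] by (auto simp: Ysp)
      ultimately show "v \<in> (\<lambda>w. scl (w 0) unit0) ` space Y i" by force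
    qed (use mor_in[OF g i] in auto)
    ultimately have "short_exact n U (\<lambda>_. push) Y (\<lambda>_ w. scl (w 0) unit0) ?I"
      unfolding short_exact_def is_mono_def is_epi_def exact_at_def using f g inj by (auto intro: inj_on_subset)
    then obtain s where s: "is_mor n ?I Y s" "\<forall>i\<in>{1..n}. \<forall>v\<in>space ?I i. scl (s i v 0) unit0 = v"
      using ext unfolding ext_zero_def by blast
    define z where "z = s (b - 1) unit0"
    have e: "unit0 \<in> space ?I (b - 1)" by (rule unit0_in[OF b(3,4)])
    have z: "z \<in> space Y (b - 1)" unfolding z_def by (rule mor_in[OF s(1) b(2,1) e])
    have "scl (z 0) unit0 = (unit0 :: nat \<Rightarrow> 'a)" unfolding z_def using s(2) b e by auto
    from fun_cong[OF this, of 0] have z0: "z 0 = 1" by simp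
    have Yd: "down Y i (b - 1) z = push (down U i (b - 1) (pull z)) + unit0" if "a \<le> i" "i \<le> b - 1" for i
      using that(2,1)
    proof (induction i rule: inc_induct)
      case base
      show ?case using push_pull[of z] z0 by simp
    next
      case (step i)
      have "P i" "P (Suc i)" "i \<noteq> a - 1" "0 < i" using step ab by (auto simp: P_def)
      have "down Y i (b - 1) z = arrow Y i (down Y (Suc i) (b - 1) z)"
        using varr_down[OF step(2), of Y z] \<open>0 < i\<close> by simp
      also have "down Y (Suc i) (b - 1) z = push (down U (Suc i) (b - 1) (pull z)) + unit0"
        by (rule step(3)) (use step in simp)
      also have "arrow Y i \<dots> = push (arrow U i (down U (Suc i) (b - 1) (pull z))) + unit0"
        unfolding Yarr pull_unit push_unit using \<open>P i\<close> \<open>P (Suc i)\<close> \<open>i \<noteq> a - 1\<close> by simp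
      also have "arrow U i (down U (Suc i) (b - 1) (pull z)) = down U i (b - 1) (pull z)"
        using varr_down[OF step(2), of U "pull z"] \<open>0 < i\<close> by simp
      finally show ?case .
    qed
    have lt: "a - 1 < b - 1" "Suc (a - 1) = a" "0 < a - 1" using ab a1 by auto
    have "\<not> P (a - 1)" using lt by (auto simp: P_def)
    have "down Y (a - 1) (b - 1) z = arrow Y (a - 1) (down Y a (b - 1) z)"
      using varr_down[OF lt(1), of Y z] lt by simp
    also have "down Y a (b - 1) z = push (down U a (b - 1) (pull z)) + unit0"
      using Yd[of a] b by simp
    also have "arrow Y (a - 1) \<dots> = push (arrow U (a - 1) (down U a (b - 1) (pull z)) + u)"
      unfolding Yarr pull_unit push_unit using \<open>\<not> P (a - 1)\<close> by simp
    also have "arrow U (a - 1) (down U a (b - 1) (pull z)) = down U (a - 1) (b - 1) (pull z)"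
      using varr_down[OF lt(1), of U "pull z"] lt by simp
    finally have "down Y (a - 1) (b - 1) z = push (down U (a - 1) (b - 1) (pull z) + u)" .
    moreover have "down Y (a - 1) (b - 1) z = 0"
    proof -
      have e': "unit0 \<in> vsp ?I (b - 1)" using e b by simp
      have "down ?I (a - 1) (b - 1) unit0 = 0"
        using down_in[OF interval_rep b(1,5) e'] ab by (simp add: interval_vsp interval_space split: if_splits)
      then show ?thesis unfolding z_def using vmap_down[OF s(1) b(1,5) e'] b 
        lin_zero[OF vmap_lin[OF s(1) b(6)]] by simp
    qed
    ultimately have "push (down U (a - 1) (b - 1) (pull z) + u) = 0" by simp
    from arg_cong[OF this, of pull] have "down U (a - 1) (b - 1) (pull z) + u = 0" by (simp only: push_pull_simps)
    then have "u = scl (- 1) (down U (a - 1) (b - 1) (pull z))"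
      unfolding ambient.scale_minus_left ambient.scale_one by (rule minus_unique[symmetric])
    then have "u = down U (a - 1) (b - 1) (scl (- 1) (pull z))" unfolding lin_scl[OF down_lin[OF U b(1)]] .
    moreover have "scl (- 1) (pull z) \<in> vsp U (b - 1)"
      by (rule subspace_scale[OF vsp_subspace[OF U b(1)]]) (use z b in \<open>simp add: Ysp\<close>)
    ultimately show "u \<in> down U (a - 1) (b - 1) ` vsp U (b - 1)" by blast
  qed
qed

lemma ext_zero_interval:
  assumes U: "is_rep n U" and ab: "1 \<le> a" "a < b" "b \<le> Suc n"
  shows "ext_zero n (interval_mod a b) U \<longleftrightarrow> surj_down U (a - 1) (b - 1)"
  using ext_zero_if_surj[OF assms] surj_if_ext_zero[OF assms] by blast

lemma hom_zero_iso: assumes "iso n X X'" shows "hom_zero n X U \<longleftrightarrow> hom_zero n X' U"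
proof -
  have *: "hom_zero n X' U" if iso: "iso n X X'" and h: "hom_zero n X U" for X X' :: "'a rep"
    unfolding hom_zero_def
  proof (intro allI impI ballI)
    fix f i v assume f: "is_mor n X' U f" and i: "i \<in> {1..n}" and v: "v \<in> space X' i"
    obtain p where p: "is_mor n X X' p" "\<And>i. 1 \<le> i \<Longrightarrow> i \<le> n \<Longrightarrow> bij_betw (p i) (space X i) (space X' i)"
      using isoE[OF iso] by blast
    obtain w where w: "w \<in> space X i" "v = p i w" using p(2)[of i] i v unfolding bij_betw_def by auto
    then show "f i v = 0" using mor_comp[OF p(1) f] h i unfolding hom_zero_def by fastforce
  qed
  show ?thesis using *[OF assms] *[OF iso_sym[OF assms]] by blast
qed

lemma ext_zero_iso: assumes "iso n X X'" shows "ext_zero n X U \<longleftrightarrow> ext_zero n X' U"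
proof -
  have *: "ext_zero n X U" if iso: "iso n X X'" and ext: "ext_zero n X' U" for X X' :: "'a rep"
    unfolding ext_zero_def
  proof (intro allI impI)
    fix Y f g assume se: "short_exact n U f Y g X"
    obtain p where p: "is_mor n X X' p" "\<And>i. 1 \<le> i \<Longrightarrow> i \<le> n \<Longrightarrow> bij_betw (p i) (space X i) (space X' i)"
      using isoE[OF iso] by blast
    note f = short_exactD(1)[OF se] and g = short_exactD(2)[OF se]
    have p0: "p i v = 0 \<longleftrightarrow> v = 0" if "i \<in> {1..n}" "v \<in> space X i" for i v
    proof -
      have "0 \<in> space X i" "p i 0 = 0" "inj_on (p i) (space X i)"
        using that p(2)[of i] lin_zero[OF mor_lin[OF p(1)]] 
          subspace_0[OF fin_dim_subspace[OF rep_fin_dim[OF mor_rep(1)[OF p(1)]]]] by (auto simp: bij_betw_def)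
      then show ?thesis using that(2) by (metis inj_onD)
    qed
    have "(p i \<circ> g i) ` space Y i = space X' i" if "i \<in> {1..n}" for i
    proof -
      have "g i ` space Y i = space X i" using se that unfolding short_exact_def is_epi_def by blast
      then show ?thesis using p(2)[of i] that unfolding bij_betw_def image_comp[symmetric] by simp
    qed
    moreover have "f i ` space U i = {v \<in> space Y i. (p i \<circ> g i) v = 0}" if "i \<in> {1..n}" for i
    proof -
      have "f i ` space U i = {v \<in> space Y i. g i v = 0}" using se that unfolding short_exact_def exact_at_def by blast
      also have "\<dots> = {v \<in> space Y i. (p i \<circ> g i) v = 0}" using p0[OF that] mor_in[OF g] that by auto
      finally show ?thesis .
    qed
    ultimately have "short_exact n U f Y (\<lambda>i. p i \<circ> g i) X'"
      using se mor_comp[OF g p(1)] unfolding short_exact_def is_epi_def exact_at_def by simp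
    then obtain s where s: "is_mor n X' Y s" "\<forall>i\<in>{1..n}. \<forall>v\<in>space X' i. (p i \<circ> g i) (s i v) = v"
      using ext unfolding ext_zero_def by blast
    show "\<exists>s. is_mor n X Y s \<and> (\<forall>i\<in>{1..n}. \<forall>v\<in>space X i. g i (s i v) = v)"
    proof (intro exI conjI ballI)
      show "is_mor n X Y (\<lambda>i. s i \<circ> p i)" by (rule mor_comp[OF p(1) s(1)])
      fix i v assume i: "i \<in> {1..n}" and v: "v \<in> space X i"
      have pv: "p i v \<in> space X' i" using mor_in[OF p(1)] i v by auto
      then have "p i (g i (s i (p i v))) = p i v" using s(2) i by auto
      moreover have "g i (s i (p i v)) \<in> space X i" using mor_in[OF g] mor_in[OF s(1)] pv i by auto
      ultimately show "g i ((s i \<circ> p i) v) = v" using p(2)[of i] i v by (auto simp: bij_betw_def dest: inj_onD)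
    qed
  qed
  show ?thesis using *[OF assms] *[OF iso_sym[OF assms]] by blast
qed

section \<open>Direct sums and indecomposable modules\<close>

definition direct_sum :: "nat \<Rightarrow> 'k::field rep \<Rightarrow> (nat \<Rightarrow> (nat \<Rightarrow> 'k) set) \<Rightarrow> (nat \<Rightarrow> (nat \<Rightarrow> 'k) set) \<Rightarrow> bool" where
  "direct_sum n X U W \<longleftrightarrow> submodule n X U \<and> submodule n X W \<and>
     (\<forall>i\<in>{1..n}. space X i = {u + w |u w. u \<in> U i \<and> w \<in> W i} \<and> U i \<inter> W i = {0})"

abbreviation sub :: "'k::field rep \<Rightarrow> (nat \<Rightarrow> (nat \<Rightarrow> 'k) set) \<Rightarrow> 'k rep" where
  "sub X U \<equiv> X\<lparr>space := U\<rparr>"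

lemma submoduleI:
  assumes "is_rep n X"
    and "\<And>i. 1 \<le> i \<Longrightarrow> i \<le> n \<Longrightarrow> ambient.subspace (U i)"
    and "\<And>i. 1 \<le> i \<Longrightarrow> i \<le> n \<Longrightarrow> U i \<subseteq> space X i"
    and "\<And>i v. 1 \<le> i \<Longrightarrow> i < n \<Longrightarrow> v \<in> U (Suc i) \<Longrightarrow> arrow X i v \<in> U i"
  shows "submodule n X U"
  unfolding submodule_def
proof (intro conjI ballI is_repI)
  fix i assume "1 \<le> i" "i \<le> n"
  then show "fin_dim (space (sub X U) i)"
    using fin_dim_mono[OF rep_fin_dim[OF assms(1)] assms(2,3)] by simp
qed (use assms rep_lin[OF assms(1)] in auto)

lemma submoduleD:
  assumes "submodule n X U"
  shows "is_rep n (sub X U)"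
    and "1 \<le> i \<Longrightarrow> i \<le> n \<Longrightarrow> ambient.subspace (U i)"
    and "1 \<le> i \<Longrightarrow> i \<le> n \<Longrightarrow> U i \<subseteq> space X i"
    and "1 \<le> i \<Longrightarrow> i < n \<Longrightarrow> v \<in> U (Suc i) \<Longrightarrow> arrow X i v \<in> U i"
proof -
  show r: "is_rep n (sub X U)" using assms by (simp add: submodule_def)
  show "1 \<le> i \<Longrightarrow> i \<le> n \<Longrightarrow> ambient.subspace (U i)" using fin_dim_subspace[OF rep_fin_dim[OF r]] by simp
  show "1 \<le> i \<Longrightarrow> i \<le> n \<Longrightarrow> U i \<subseteq> space X i" using assms by (simp add: submodule_def)
  show "1 \<le> i \<Longrightarrow> i < n \<Longrightarrow> v \<in> U (Suc i) \<Longrightarrow> arrow X i v \<in> U i" using rep_arrow[OF r] by simp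
qed

lemma incl_mor:
  assumes "is_rep n X" "submodule n X U"
  shows "is_mor n (sub X U) X (\<lambda>_. id)"
  using submoduleD[OF assms(2)] by (intro is_morI assms) auto

lemma mor_to_sub:
  assumes "is_mor n X Y f" "submodule n Y U" "\<And>i v. 1 \<le> i \<Longrightarrow> i \<le> n \<Longrightarrow> v \<in> space X i \<Longrightarrow> f i v \<in> U i"
  shows "is_mor n X (sub Y U) f"
  by (rule is_morI) (use assms mor_rep[OF assms(1)] mor_lin[OF assms(1)] mor_arrow[OF assms(1)] submoduleD(1)[OF assms(2)] in auto)

lemma mor_from_sub:
  assumes "is_mor n X Y f" "submodule n X U"
  shows "is_mor n (sub X U) Y f"
  using mor_comp[OF incl_mor[OF mor_rep(1)[OF assms(1)] assms(2)] assms(1)] by (simp add: comp_def)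

lemma mor_plus:
  assumes "is_mor n X Y f" "is_mor n X Y g"
  shows "is_mor n X Y (\<lambda>i v. f i v + g i v)"
proof (rule is_morI)
  note Y = mor_rep(2)[OF assms(1)]
  fix i assume i: "1 \<le> i" "i \<le> n"
  show "lin (\<lambda>v. f i v + g i v)" using mor_lin[OF assms(1) i] mor_lin[OF assms(2) i] by (rule lin_plus)
  fix v assume "v \<in> space X i"
  then show "f i v + g i v \<in> space Y i"
    using subspace_add[OF rep_subspace[OF Y i]] mor_in[OF assms(1) i] mor_in[OF assms(2) i] by blast
next
  fix i v assume i: "1 \<le> i" "i < n" and v: "v \<in> space X (Suc i)"
  show "f i (arrow X i v) + g i (arrow X i v) = arrow Y i (f (Suc i) v + g (Suc i) v)"
    using mor_arrow[OF assms(1) i v] mor_arrow[OF assms(2) i v] lin_add[OF rep_lin[OF mor_rep(2)[OF assms(1)] i]] by simp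
qed (use mor_rep[OF assms(1)] in auto)

lemma direct_sum_sym: "direct_sum n X U W \<Longrightarrow> direct_sum n X W U"
  unfolding direct_sum_def
proof (elim conjE, intro conjI ballI)
  fix i assume *: "\<forall>i\<in>{1..n}. space X i = {u + w |u w. u \<in> U i \<and> w \<in> W i} \<and> U i \<inter> W i = {0}" and i: "i \<in> {1..n}"
  have "{u + w |u w. u \<in> U i \<and> w \<in> W i} = {u + w |u w. u \<in> W i \<and> w \<in> U i}" 
    by (metis (no_types, opaque_lifting) add.commute)
  then show "space X i = {u + w |u w. u \<in> W i \<and> w \<in> U i}" using * i by simp
  show "W i \<inter> U i = {0}" using * i by (simp add: Int_commute)
qed

lemma direct_sum_projection:
  assumes X: "is_rep n X" and ds: "direct_sum n X U W"
  shows "\<exists>p. is_mor n X (sub X U) p \<and>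
    (\<forall>i\<in>{1..n}. (\<forall>u\<in>U i. p i u = u) \<and> (\<forall>w\<in>W i. p i w = 0))"
proof -
  have U: "submodule n X U" and W: "submodule n X W" using ds by (auto simp: direct_sum_def)
  have sum: "\<exists>u\<in>U i. \<exists>w\<in>W i. x = u + w" if "1 \<le> i" "i \<le> n" "x \<in> space X i" for i x
    using ds that unfolding direct_sum_def by fastforce
  have "\<exists>p. lin p \<and> (\<forall>u\<in>U i. p u = u) \<and> (\<forall>w\<in>W i. p w = 0)" if "i \<in> {1..n}" for i
  proof -
    have "U i \<inter> W i = {0}" "1 \<le> i" "i \<le> n" using ds that by (auto simp: direct_sum_def)
    then show ?thesis using lin_projection[OF submoduleD(2)[OF U] submoduleD(2)[OF W], of i i] by metis
  qed
  then obtain p where "\<forall>i\<in>{1..n}. lin (p i) \<and> (\<forall>u\<in>U i. p i u = u) \<and> (\<forall>w\<in>W i. p i w = 0)" by metis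
  then have p: "lin (p i)" "u \<in> U i \<Longrightarrow> p i u = u" "w \<in> W i \<Longrightarrow> p i w = 0" if "1 \<le> i" "i \<le> n" for i u w
    using that by auto
  have pu: "p i (u + w) = u" if "1 \<le> i" "i \<le> n" "u \<in> U i" "w \<in> W i" for i u w
    using p[OF that(1,2)] that(3,4) by (simp add: lin_add)
  have "is_mor n X (sub X U) p"
  proof (rule is_morI[OF X submoduleD(1)[OF U]])
    fix i v assume i: "1 \<le> i" "i \<le> n" and v: "v \<in> space X i"
    then show "p i v \<in> space (sub X U) i" using sum[OF i v] pu[OF i] by auto
  next
    fix i v assume i: "1 \<le> i" "i < n" and "v \<in> space X (Suc i)"
    then obtain u w where uw: "u \<in> U (Suc i)" "w \<in> W (Suc i)" "v = u + w" using sum[of "Suc i" v] by auto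
    have "arrow X i v = arrow X i u + arrow X i w" using lin_add[OF rep_lin[OF X i]] uw by simp
    then show "p i (arrow X i v) = arrow (sub X U) i (p (Suc i) v)"
      using pu[of i "arrow X i u" "arrow X i w"] pu[OF _ _ uw(1,2)] uw(3) i 
        submoduleD(4)[OF U i uw(1)] submoduleD(4)[OF W i uw(2)] by simp
  qed (use p in auto)
  then show ?thesis using p(2,3) by (intro exI[of _ p]) simp
qed

lemma direct_sum_short_exact:
  assumes X: "is_rep n X" and ds: "direct_sum n X U W"
  shows "\<exists>p. short_exact n (sub X W) (\<lambda>_. id) X p (sub X U) \<and> is_mor n X X p"
proof -
  have U: "submodule n X U" and W: "submodule n X W" using ds by (auto simp: direct_sum_def)
  have sum: "space X i = {u + w |u w. u \<in> U i \<and> w \<in> W i}" if "1 \<le> i" "i \<le> n" for i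
    using ds that unfolding direct_sum_def by auto
  obtain p where p: "is_mor n X (sub X U) p"
    and *: "\<forall>i\<in>{1..n}. (\<forall>u\<in>U i. p i u = u) \<and> (\<forall>w\<in>W i. p i w = 0)"
    using direct_sum_projection[OF assms] by blast
  have pU: "p i u = u" if "1 \<le> i" "i \<le> n" "u \<in> U i" for i u using * that by simp
  have pW: "p i w = 0" if "1 \<le> i" "i \<le> n" "w \<in> W i" for i w using * that by simp
  have vp: "v - p i v \<in> W i" if i: "1 \<le> i" "i \<le> n" and v: "v \<in> space X i" for i v
  proof -
    obtain u w where uw: "u \<in> U i" "w \<in> W i" "v = u + w" using v unfolding sum[OF i] by blast
    then have "p i v = u" using pU[OF i] pW[OF i] lin_add[OF mor_lin[OF p i]] by simp
    then show ?thesis using uw by simp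
  qed
  have "id ` W i = {v \<in> space X i. p i v = 0}" if i: "1 \<le> i" "i \<le> n" for i
    using vp[OF i] pW[OF i] submoduleD(3)[OF W i] by (auto simp: image_iff) force
  moreover have "p i ` space X i = U i" if i: "1 \<le> i" "i \<le> n" for i
    using pU[OF i] submoduleD(3)[OF U i] mor_in[OF p i] by force
  ultimately have "short_exact n (sub X W) (\<lambda>_. id) X p (sub X U)"
    unfolding short_exact_def is_mono_def is_epi_def exact_at_def 
    using incl_mor[OF X W] p by auto
  moreover have "is_mor n X X p"
    using mor_comp[OF p incl_mor[OF X U]] by (simp add: comp_def)
  ultimately show ?thesis by blast
qed

definition total_dim :: "nat \<Rightarrow> 'k::field rep \<Rightarrow> nat" where
  "total_dim n X = (\<Sum>i\<in>{1..n}. ambient.dim (space X i))"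

lemma total_dim_less:
  assumes X: "is_rep n X" and ds: "direct_sum n X U W" and W: "\<not> zero_rep n (sub X W)"
  shows "total_dim n (sub X U) < total_dim n X"
proof -
  have U: "submodule n X U" and Wm: "submodule n X W" using ds by (auto simp: direct_sum_def)
  have "\<exists>i\<in>{1..n}. W i \<noteq> {0}" using W submoduleD(1)[OF Wm] by (simp add: zero_rep_def)
  then obtain i where i: "i \<in> {1..n}" "W i \<noteq> {0}" by blast
  have i': "1 \<le> i" "i \<le> n" using i by auto
  have W0: "0 \<in> W i" using subspace_0[OF submoduleD(2)[OF Wm i']] .
  then obtain w where w: "w \<in> W i" "w \<noteq> 0" using i(2) by blast
  have "w \<notin> U i" using w ds i(1) unfolding direct_sum_def by blast
  then have "U i \<subset> space X i" using submoduleD(3)[OF U i'] submoduleD(3)[OF Wm i'] w(1) by blast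
  then have "ambient.dim (U i) < ambient.dim (space X i)"
    by (rule dim_less_fin_dim[OF rep_fin_dim[OF X i'] submoduleD(2)[OF U i']])
  moreover have "ambient.dim (U j) \<le> ambient.dim (space X j)" if "j \<in> {1..n}" for j
    using that by (intro dim_mono_fin_dim rep_fin_dim[OF X] submoduleD(3)[OF U]) auto
  ultimately show ?thesis unfolding total_dim_def using i(1) by (intro sum_strict_mono_ex1) auto
qed

text \<open>
  The existence part of the Krull-Schmidt theorem, in the form of an induction rule.
\<close>

lemma rep_induct [consumes 1, case_names zero indecomposable direct_sum]:
  assumes "is_rep n X"
    and zero: "\<And>X. zero_rep n X \<Longrightarrow> P X"
    and indec: "\<And>X. indecomposable n X \<Longrightarrow> P X"
    and sum: "\<And>X U W. is_rep n X \<Longrightarrow> direct_sum n X U W \<Longrightarrow> P (sub X U) \<Longrightarrow> P (sub X W) \<Longrightarrow> P X"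
  shows "P X"
  using assms(1)
proof (induction "total_dim n X" arbitrary: X rule: less_induct)
  case less
  show ?case
  proof (cases "zero_rep n X \<or> indecomposable n X")
    case False
    then obtain U W where ds: "direct_sum n X U W" and nz: "\<not> zero_rep n (sub X U)" "\<not> zero_rep n (sub X W)"
      using less(2) unfolding indecomposable_def direct_sum_def by blast
    have "P (sub X U)"
      using less(1)[OF total_dim_less[OF less(2) ds nz(2)]] ds submoduleD(1) unfolding direct_sum_def by blast
    moreover have "P (sub X W)"
      using less(1)[OF total_dim_less[OF less(2) direct_sum_sym[OF ds] nz(1)]] ds submoduleD(1) unfolding direct_sum_def by blast
    ultimately show ?thesis by (rule sum[OF less(2) ds])
  qed (use zero indec in blast)
qed

text \<open>
  Let \<open>a\<close> be the lowest vertex of the support, and \<open>t\<close> the highest one with \<open>X\<^sub>t \<rightarrow> X\<^sub>a\<close> different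
  from zero. An element \<open>v\<close> of \<open>X\<^sub>t\<close> with non-zero image in \<open>X\<^sub>a\<close> generates a copy of
  \<open>[a, t + 1]\<close>, and for a linear form on \<open>X\<^sub>a\<close> which does not vanish on this image the elements
  that the form annihilates after mapping them to \<open>X\<^sub>a\<close> form a complement.
\<close>

lemma indecomposable_interval:
  assumes X: "indecomposable n X"
  obtains a b where "1 \<le> a" "a < b" "b \<le> Suc n" "iso n X (interval_mod a b)"
proof -
  have rep: "is_rep n X" and nz: "\<not> zero_rep n X" using X by (auto simp: indecomposable_def)
  have s0: "0 \<in> space X i" if "1 \<le> i" "i \<le> n" for i
    using subspace_0[OF fin_dim_subspace[OF rep_fin_dim[OF rep that]]] .
  define a where "a = (LEAST i. 1 \<le> i \<and> i \<le> n \<and> space X i \<noteq> {0})"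
  have "\<exists>i. 1 \<le> i \<and> i \<le> n \<and> space X i \<noteq> {0}" using nz rep by (auto simp: zero_rep_def)
  then have a: "1 \<le> a" "a \<le> n" "space X a \<noteq> {0}" unfolding a_def by (metis (mono_tags, lifting) LeastI)+
  have below: "space X i = {0}" if "1 \<le> i" "i < a" for i
    using not_less_Least[of i "\<lambda>i. 1 \<le> i \<and> i \<le> n \<and> space X i \<noteq> {0}"] that a(2) unfolding a_def[symmetric] by auto
  define T where "T = {t \<in> {a..n}. \<exists>v\<in>space X t. down X a t v \<noteq> 0}"
  have fin: "finite T" by (simp add: T_def)
  have "a \<in> T" using a s0[OF a(1,2)] by (auto simp: T_def)
  define t where "t = Max T"
  have "t \<in> T" unfolding t_def using fin \<open>a \<in> T\<close> by (intro Max_in) auto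
  then obtain v where t: "a \<le> t" "t \<le> n" and v: "v \<in> space X t" "down X a t v \<noteq> 0" by (auto simp: T_def)
  have above: "down X a i x = 0" if "t < i" "i \<le> n" "x \<in> space X i" for i x
  proof (rule ccontr)
    assume "down X a i x \<noteq> 0"
    then have "i \<in> T" using that t by (auto simp: T_def)
    then show False using Max_ge[OF fin] that(1) unfolding t_def by fastforce
  qed
  have t1: "1 \<le> t" "0 < t" using a t by auto
  define d where "d i = down X i t v" for i
  have dt: "down X a i (d i) = d a" if "a \<le> i" "i \<le> t" for i using that unfolding d_def by (rule down_down)
  have dX: "d i \<in> space X i" if "1 \<le> i" "i \<le> t" for i
    using down_in[OF rep t(2) that(2), of v] v(1) t1 that unfolding d_def by simp
  have darr: "arrow X i (d (Suc i)) = d i" if "1 \<le> i" "i < t" for i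
    using varr_down[OF that(2), of X v] that unfolding d_def by simp
  \<comment> \<open>The linear form is a coordinate of the ambient space.\<close>
  obtain c where c: "d a c \<noteq> 0" using v(2) unfolding d_def[symmetric] by (auto simp: fun_eq_iff)
  define b where "b = Suc t"
  have ab: "1 \<le> a" "a < b" "b \<le> Suc n" "b - 1 = t" using a t by (auto simp: b_def)
  define U where "U i = (if a \<le> i \<and> i < b then range (\<lambda>k. scl k (d i)) else {0})" for i
  define W where "W i = {x \<in> space X i. a \<le> i \<longrightarrow> down X a i x c = 0}" for i
  have Us: "scl k (d i) \<in> U i" if "a \<le> i" "i \<le> t" for i k using that by (auto simp: U_def b_def)
  have lin_down: "lin (down X a i)" if "i \<le> n" for i by (rule down_lin[OF rep that])
  have U: "submodule n X U"
  proof (rule submoduleI[OF rep])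
    fix i assume i: "1 \<le> i" "i \<le> n"
    show "ambient.subspace (U i)" unfolding U_def ambient.span_singleton[symmetric] by simp
    show "U i \<subseteq> space X i"
      using dX i subspace_scale[OF rep_subspace[OF rep i]] s0[OF i] by (auto simp: U_def b_def)
  next
    fix i x assume i: "1 \<le> i" "i < n" and x: "x \<in> U (Suc i)"
    show "arrow X i x \<in> U i"
    proof (cases "a \<le> Suc i \<and> Suc i < b")
      case True
      then obtain k where "x = scl k (d (Suc i))" using x by (auto simp: U_def)
      then have *: "arrow X i x = scl k (d i)" using darr[of i] True i lin_scl[OF rep_lin[OF rep i]] by (auto simp: b_def)
      show ?thesis
      proof (cases "a \<le> i")
        case False
        then have "d i = 0" using dX[of i] below[of i] True i by (auto simp: b_def)
        then show ?thesis unfolding * using False by (simp add: U_def)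
      qed (use * Us[of i] True in \<open>auto simp: b_def\<close>)
    next
      case False
      then have "arrow X i x = 0" using x lin_zero[OF rep_lin[OF rep i]] by (auto simp: U_def)
      then show ?thesis using subspace_0[of "U i"] unfolding U_def ambient.span_singleton[symmetric] by (auto simp: ambient.span_zero)
    qed
  qed
  have W: "submodule n X W"
  proof (rule submoduleI[OF rep])
    fix i assume i: "1 \<le> i" "i \<le> n"
    note s = rep_subspace[OF rep i]
    show "ambient.subspace (W i)"
      unfolding ambient.subspace_def W_def 
      using subspace_0[OF s] subspace_add[OF s] subspace_scale[OF s] 
      by (auto simp: lin_zero[OF lin_down[OF i(2)]] lin_add[OF lin_down[OF i(2)]] lin_scl[OF lin_down[OF i(2)]] scl_apply)
    show "W i \<subseteq> space X i" by (auto simp: W_def)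
  next
    fix i x assume i: "1 \<le> i" "i < n" and x: "x \<in> W (Suc i)"
    have "down X a (Suc i) x = down X a i (arrow X i x)" if "a \<le> i" using that i by simp
    then show "arrow X i x \<in> W i" using x rep_arrow[OF rep i] by (auto simp: W_def)
  qed
  have "direct_sum n X U W"
    unfolding direct_sum_def
  proof (intro conjI ballI U W)
    fix i assume "i \<in> {1..n}"
    then have i: "1 \<le> i" "i \<le> n" by auto
    note s = rep_subspace[OF rep i]
    show "space X i = {u + w |u w. u \<in> U i \<and> w \<in> W i}"
    proof (intro equalityI subsetI)
      fix x assume x: "x \<in> space X i"
      show "x \<in> {u + w |u w. u \<in> U i \<and> w \<in> W i}"
      proof (cases "a \<le> i \<and> i < b")
        case True
        define k where "k = down X a i x c / d a c"
        have "down X a i (x - scl k (d i)) c = 0"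
          using c dt[of i] True unfolding lin_diff[OF lin_down[OF i(2)]] lin_scl[OF lin_down[OF i(2)]]
          by (simp add: scl_def k_def b_def)
        moreover have "scl k (d i) \<in> U i" using Us True by (simp add: b_def)
        moreover have "x - scl k (d i) \<in> space X i"
          using \<open>scl k (d i) \<in> U i\<close> submoduleD(3)[OF U i] subspace_diff[OF s] x by blast
        ultimately have "scl k (d i) \<in> U i" "x - scl k (d i) \<in> W i" by (auto simp: W_def)
        moreover have "x = scl k (d i) + (x - scl k (d i))" by simp
        ultimately show ?thesis by blast
      next
        case False
        then have "x \<in> W i" using x above[of i x] i by (auto simp: W_def b_def)
        moreover have "0 \<in> U i" using False by (auto simp: U_def)
        ultimately show ?thesis by force
      qed
    qed (use submoduleD(3)[OF U i] submoduleD(3)[OF W i] subspace_add[OF s] in blast)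
    have "u = 0" if uU: "u \<in> U i" and uW: "u \<in> W i" for u
    proof (cases "a \<le> i \<and> i < b")
      case True
      then obtain k where k: "u = scl k (d i)" using uU by (auto simp: U_def)
      then have "down X a i u c = k * d a c"
        using dt[of i] True lin_scl[OF lin_down[OF i(2)]] by (simp add: b_def scl_def)
      then have "k = 0" using uW True c by (simp add: W_def)
      then show ?thesis using k by simp
    qed (use uU in \<open>auto simp: U_def\<close>)
    then show "U i \<inter> W i = {0}"
      using subspace_0[OF submoduleD(2)[OF U i]] subspace_0[OF submoduleD(2)[OF W i]] by blast
  qed
  then have "zero_rep n (sub X U) \<or> zero_rep n (sub X W)" and
    sp: "\<And>i. 1 \<le> i \<Longrightarrow> i \<le> n \<Longrightarrow> space X i = {u + w |u w. u \<in> U i \<and> w \<in> W i}"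
    using X unfolding indecomposable_def direct_sum_def by auto
  moreover have "\<not> zero_rep n (sub X U)"
  proof
    assume "zero_rep n (sub X U)"
    then have "U a = {0}" using a by (simp add: zero_rep_def)
    then show False using Us[of a 1] t c by auto
  qed
  ultimately have "zero_rep n (sub X W)" by blast
  then have "\<And>i. 1 \<le> i \<Longrightarrow> i \<le> n \<Longrightarrow> W i = {0}" by (simp add: zero_rep_def)
  then have XU: "space X i = U i" if "1 \<le> i" "i \<le> n" for i using sp[OF that] that by auto
  have vt: "v \<in> vsp X (b - 1)" using v t1 by (simp add: ab(4))
  have "down X (a - 1) t v \<in> vsp X (a - 1)" using vt t by (intro down_in[OF rep]) (auto simp: ab(4))
  moreover have "vsp X (a - 1) = {0}" using below[of "a - 1"] a by (cases "a = 1") auto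
  ultimately have v0: "down X (a - 1) (b - 1) v = 0" by (simp add: ab(4))
  note m = vector_mor[OF rep ab(1-3) vt v0]
  have "iso n (interval_mod a b) X"
  proof (rule mono_epi_iso[OF m])
    fix i assume i: "1 \<le> i" "i \<le> n"
    have m_eq: "vector_mor X a b v i x = scl (x 0) (d i)" if "a \<le> i" "i < b" for x
      using that by (simp add: vector_mor_def ab(4) d_def)
    show "bij_betw (vector_mor X a b v i) (space (interval_mod a b) i) (space X i)"
    proof (cases "a \<le> i \<and> i < b")
      case True
      have "d i \<noteq> 0" using dt[of i] True c lin_zero[OF lin_down[OF i(2)]] by (auto simp: b_def)
      have "inj_on (vector_mor X a b v i) (ambient.span {unit0})"
      proof (rule inj_onI)
        fix x y assume x: "x \<in> ambient.span {unit0}" and y: "y \<in> ambient.span {unit0}"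
          and "vector_mor X a b v i x = vector_mor X a b v i y"
        then have "x 0 = y 0" using m_eq True \<open>d i \<noteq> 0\<close> by simp
        then show "x = y" using x y unfolding unit0_span by simp
      qed
      moreover have "vector_mor X a b v i ` ambient.span {unit0} = range (\<lambda>k. scl k (d i))"
        unfolding ambient.span_singleton image_image using m_eq True by simp
      ultimately show ?thesis using True XU[OF i] by (simp add: bij_betw_def interval_space U_def)
    next
      case False
      then show ?thesis using XU[OF i] by (auto simp: bij_betw_def interval_space U_def vector_mor_def)
    qed
  qed
  then show thesis using that ab iso_sym by blast
qed

text \<open>
  Every non-zero submodule of \<open>[a, b]\<close> contains the line at the vertex \<open>a\<close>, so two of them always meet.
\<close>

lemma interval_indecomposable:
  assumes iso: "iso n X (interval_mod a b)" and ab: "1 \<le> a" "a < b" "b \<le> Suc n"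
  shows "indecomposable n X"
proof -
  let ?I = "interval_mod a b :: 'a rep"
  obtain f where f: "is_mor n X ?I f" "\<And>i. 1 \<le> i \<Longrightarrow> i \<le> n \<Longrightarrow> bij_betw (f i) (space X i) (space ?I i)"
    using isoE[OF iso] by blast
  note X = mor_rep(1)[OF f(1)]
  have an: "a \<le> n" using ab by simp
  have s0: "0 \<in> space X i" if "1 \<le> i" "i \<le> n" for i
    using subspace_0[OF rep_subspace[OF X that]] .
  have f0: "f i x = 0 \<longleftrightarrow> x = 0" if "1 \<le> i" "i \<le> n" "x \<in> space X i" for i x
    using f(2)[OF that(1,2)] s0[OF that(1,2)] that(3) lin_zero[OF mor_lin[OF f(1) that(1,2)]] 
    unfolding bij_betw_def by (metis inj_onD)
  have bottom: "\<exists>x\<in>U a. x \<noteq> 0" if U: "submodule n X U" and nz: "\<not> zero_rep n (sub X U)" for U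
  proof -
    have "\<exists>i\<in>{1..n}. U i \<noteq> {0}" using nz submoduleD(1)[OF U] by (simp add: zero_rep_def)
    then obtain i where "i \<in> {1..n}" "U i \<noteq> {0}" by blast
    then have i: "1 \<le> i" "i \<le> n" "U i \<noteq> {0}" by simp_all
    then obtain x where x: "x \<in> U i" "x \<noteq> 0" using subspace_0[OF submoduleD(2)[OF U i(1,2)]] by blast
    have xX: "x \<in> space X i" using x submoduleD(3)[OF U i(1,2)] by blast
    have fx: "f i x \<noteq> 0" "f i x \<in> space ?I i" using f0[OF i(1,2) xX] x mor_in[OF f(1) i(1,2) xX] by auto
    then have ia: "a \<le> i" "i < b" by (auto simp: interval_space split: if_splits)
    have "vsp (sub X U) i = U i" "vsp (sub X U) a = U a" using i ab by auto
    moreover have "varr (sub X U) j = varr X j" for j unfolding varr_def by simp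
    then have "down (sub X U) j k v = down X j k v" for j k v
      by (induction k arbitrary: v) simp_all
    ultimately have da: "down X a i x \<in> U a" using down_in[OF submoduleD(1)[OF U] i(2) ia(1), of x] x by simp
    have "f a (down X a i x) = down ?I a i (f i x)" using vmap_down[OF f(1) i(2) ia(1), of x] xX i ab by simp
    also have "\<dots> = f i x" by (rule interval_down[OF ab(1) order_refl ia])
    finally have "down X a i x \<noteq> 0" using fx lin_zero[OF mor_lin[OF f(1) ab(1) an]] by auto
    then show ?thesis using da by blast
  qed
  have "zero_rep n (sub X U) \<or> zero_rep n (sub X W)" if U: "submodule n X U" and W: "submodule n X W"
    and UW: "U a \<inter> W a = {0}" for U W
  proof (rule ccontr)
    assume "\<not> ?thesis"
    then obtain x y where x: "x \<in> U a" "x \<noteq> 0" and y: "y \<in> W a" "y \<noteq> 0" using bottom[OF U] bottom[OF W] by blast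
    have X': "x \<in> space X a" "y \<in> space X a" using x y submoduleD(3)[OF U ab(1) an] submoduleD(3)[OF W ab(1) an] by auto
    define c d where "c = f a x 0" "d = f a y 0"
    have fxy: "f a x = scl c unit0" "f a y = scl d unit0"
      using mor_in[OF f(1) ab(1) an X'(1)] mor_in[OF f(1) ab(1) an X'(2)] ab
      unfolding interval_space c_d_def unit0_span[symmetric] by auto
    have d: "d \<noteq> 0" using fxy(2) f0[OF ab(1) an X'(2)] y(2) by auto
    note l = mor_lin[OF f(1) ab(1) an]
    note sX = fin_dim_subspace[OF rep_fin_dim[OF X ab(1) an]]
    have "f a (scl d x - scl c y) = 0"
      unfolding lin_diff[OF l] lin_scl[OF l] fxy by (simp add: scl_def fun_eq_iff)
    then have "scl d x - scl c y = 0"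
      using f0[OF ab(1) an] subspace_diff[OF sX] subspace_scale[OF sX] X' by blast
    then have "scl d x = scl c y" by simp
    then have "scl d x \<in> U a \<inter> W a"
      using subspace_scale[OF submoduleD(2)[OF U ab(1) an] x(1)] subspace_scale[OF submoduleD(2)[OF W ab(1) an] y(1)] by (metis IntI)
    then show False using UW d x(2) by simp
  qed
  moreover have "\<not> zero_rep n X"
  proof
    assume "zero_rep n X"
    then have "space X a = {0}" using ab an by (simp add: zero_rep_def)
    then have "space ?I a = {f a 0}" using f(2)[OF ab(1) an] by (simp add: bij_betw_def)
    then show False using unit0_in[of a a b, where ?'a = 'a] ab lin_zero[OF mor_lin[OF f(1) ab(1) an]] unit0_nonzero[where ?'a = 'a] by simp
  qed
  ultimately show ?thesis unfolding indecomposable_def using X ab an by auto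
qed

section \<open>The socle\<close>

text \<open>
  The part of a simple module at its lowest vertex is a submodule, hence everything.
\<close>

lemma simple_submodule_kernel:
  assumes X: "is_rep n X" and U: "submodule n X U" and simple: "simple n (sub X U)"
    and i: "1 \<le> i" "i \<le> n" and v: "v \<in> U i"
  shows "varr X (i - 1) v = 0"
proof (cases "i = 1 \<or> v = 0")
  case True
  then show ?thesis using lin_zero[OF varr_lin[OF X, of "i - 1"]] i by auto
next
  case False
  have nz: "\<not> zero_rep n (sub X U)" using simple by (simp add: simple_def)
  define P where "P j \<longleftrightarrow> 1 \<le> j \<and> j \<le> n \<and> U j \<noteq> {0}" for j
  define m where "m = (LEAST j. P j)"
  have "P i" using v False i by (auto simp: P_def)
  then have Pm: "P m" and least: "\<And>j. j < m \<Longrightarrow> \<not> P j"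
    unfolding m_def by (auto intro: LeastI dest: not_less_Least)
  have m: "1 \<le> m" "m \<le> n" "U m \<noteq> {0}" using Pm by (auto simp: P_def)
  define V where "V j = (if j = m then U m else {0})" for j
  have "submodule n (sub X U) V"
  proof (rule submoduleI[OF submoduleD(1)[OF U]])
    fix j x assume j: "1 \<le> j" "j < n" and x: "x \<in> V (Suc j)"
    show "arrow (sub X U) j x \<in> V j"
    proof (cases "Suc j = m")
      case True
      then have "U j = {0}" using least[of j] j by (auto simp: P_def)
      then show ?thesis using submoduleD(4)[OF U j, of x] x True by (auto simp: V_def)
    next
      case False
      then have "x = 0" using x by (simp add: V_def)
      then show ?thesis using lin_zero[OF rep_lin[OF X j]] subspace_0[OF submoduleD(2)[OF U m(1,2)]] by (simp add: V_def)
    qed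
  next
    fix j assume j: "1 \<le> j" "j \<le> n"
    show "ambient.subspace (V j)" using submoduleD(2)[OF U m(1,2)] by (simp add: V_def)
    show "V j \<subseteq> space (sub X U) j" using subspace_0[OF submoduleD(2)[OF U j]] by (simp add: V_def)
  qed
  moreover have "\<not> zero_rep n (sub (sub X U) V)"
  proof
    assume "zero_rep n (sub (sub X U) V)"
    then have "V m = {0}" using m by (simp add: zero_rep_def)
    then show False using m by (simp add: V_def)
  qed
  ultimately have "\<forall>j\<in>{1..n}. V j = space (sub X U) j" using simple unfolding simple_def by blast
  then have VU: "\<And>j. 1 \<le> j \<Longrightarrow> j \<le> n \<Longrightarrow> V j = U j" by simp
  have "V i \<noteq> {0}" unfolding VU[OF i] using v False by blast
  then have "i = m" unfolding V_def by meson
  then have "i - 1 < m" "1 \<le> i - 1" "i - 1 < n" "Suc (i - 1) = i" using i False by auto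
  then have "U (i - 1) = {0}" using least[of "i - 1"] by (auto simp: P_def)
  then show ?thesis using submoduleD(4)[OF U, of "i - 1" v] \<open>1 \<le> i - 1\<close> \<open>i - 1 < n\<close> \<open>Suc (i - 1) = i\<close> v by simp
qed

lemma kernel_simple_submodule:
  assumes X: "is_rep n X" and i: "1 \<le> i" "i \<le> n" and v: "v \<in> space X i" "v \<noteq> 0" "varr X (i - 1) v = 0"
  defines "U \<equiv> \<lambda>j. if j = i then ambient.span {v} else {0}"
  shows "submodule n X U" "simple n (sub X U)"
proof -
  have s: "ambient.subspace (space X j)" if "1 \<le> j" "j \<le> n" for j
    by (rule rep_subspace[OF X that])
  show U: "submodule n X U"
  proof (rule submoduleI[OF X])
    fix j assume j: "1 \<le> j" "j \<le> n"
    show "ambient.subspace (U j)" by (simp add: U_def)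
    show "U j \<subseteq> space X j" using ambient.span_minimal[OF _ s[OF j], of "{v}"] v(1) subspace_0[OF s[OF j]] by (auto simp: U_def)
  next
    fix j x assume j: "1 \<le> j" "j < n" and x: "x \<in> U (Suc j)"
    have "arrow X j x = 0"
    proof (cases "Suc j = i")
      case True
      then obtain c where "x = scl c v" using x by (auto simp: U_def ambient.span_singleton)
      moreover have "arrow X j v = 0" using v(3) True j by auto
      ultimately show ?thesis using lin_scl[OF rep_lin[OF X j]] by simp
    next
      case False
      then show ?thesis using x lin_zero[OF rep_lin[OF X j]] by (simp add: U_def)
    qed
    then show "arrow X j x \<in> U j" by (simp add: U_def ambient.span_zero)
  qed
  show "simple n (sub X U)"
    unfolding simple_def
  proof (intro conjI allI impI)
    show "is_rep n (sub X U)" by (rule submoduleD(1)[OF U])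
    show "\<not> zero_rep n (sub X U)"
    proof
      assume "zero_rep n (sub X U)"
      then have "U i = {0}" using i by (simp add: zero_rep_def)
      then show False using v(2) ambient.span_base[of v "{v}"] by (simp add: U_def)
    qed
    fix V assume V: "submodule n (sub X U) V"
    note V' = submoduleD[OF V]
    have other: "V j = {0}" if "1 \<le> j" "j \<le> n" "j \<noteq> i" for j
      using V'(3)[OF that(1,2)] subspace_0[OF V'(2)[OF that(1,2)]] that(3) by (auto simp: U_def)
    show "zero_rep n (sub (sub X U) V) \<or> (\<forall>j\<in>{1..n}. V j = space (sub X U) j)"
    proof (cases "V i = {0}")
      case True
      then have "\<forall>j\<in>{1..n}. V j = {0}" using other by (metis atLeastAtMost_iff)
      then show ?thesis using V'(1) by (simp add: zero_rep_def)
    next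
      case False
      then obtain x where x: "x \<in> V i" "x \<noteq> 0" using subspace_0[OF V'(2)[OF i]] by blast
      then obtain c where c: "x = scl c v" using V'(3)[OF i] by (auto simp: U_def ambient.span_singleton)
      then have "c \<noteq> 0" using x by auto
      have "scl (1 / c) x \<in> V i" using subspace_scale[OF V'(2)[OF i] x(1)] .
      then have "v \<in> V i" using c \<open>c \<noteq> 0\<close> by simp
      then have "ambient.span {v} \<subseteq> V i" using ambient.span_minimal[OF _ V'(2)[OF i]] by simp
      then have "V i = U i" using V'(3)[OF i] by (auto simp: U_def)
      then show ?thesis using other by (auto simp: U_def)
    qed
  qed
qed

text \<open>
  The socle consists of the elements that are killed by the arrow leaving their vertex: such an element
  spans a simple submodule, and simple submodules consist of such elements.
\<close>

lemma socle_space: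
  assumes X: "is_rep n X" and i: "1 \<le> i" "i \<le> n"
  shows "space (socle n X) i = {v \<in> space X i. varr X (i - 1) v = 0}"
proof -
  let ?K = "{v \<in> space X i. varr X (i - 1) v = 0}"
  let ?S = "\<Union>{U i |U. submodule n X U \<and> simple n (sub X U)}"
  note s = rep_subspace[OF X i]
  have l: "lin (varr X (i - 1))" using varr_lin[OF X, of "i - 1"] i by simp
  have K: "ambient.subspace ?K"
    unfolding ambient.subspace_def using subspace_0[OF s] subspace_add[OF s] subspace_scale[OF s]
    by (auto simp: lin_zero[OF l] lin_add[OF l] lin_scl[OF l])
  have "?S \<subseteq> ?K"
    using simple_submodule_kernel[OF X _ _ i] submoduleD(3)[OF _ i] by blast
  then have "ambient.span ?S \<subseteq> ?K" using K by (rule ambient.span_minimal)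
  moreover have "?K \<subseteq> ambient.span ?S"
  proof
    fix v assume v: "v \<in> ?K"
    show "v \<in> ambient.span ?S"
    proof (cases "v = 0")
      case False
      define U where "U j = (if j = i then ambient.span {v} else {0})" for j
      have "submodule n X U" "simple n (sub X U)"
        using kernel_simple_submodule[OF X i, of v] v False unfolding U_def by auto
      then have "U i \<subseteq> ?S" by blast
      moreover have "v \<in> U i" by (simp add: U_def ambient.span_base)
      ultimately show ?thesis by (intro ambient.span_base) blast
    qed (simp add: ambient.span_zero)
  qed
  ultimately show ?thesis by (simp add: socle_def)
qed

lemma socle_rep: assumes X: "is_rep n X" shows "is_rep n (socle n X)"
proof (rule is_repI)
  fix i assume i: "1 \<le> i" "i \<le> n"
  have "ambient.subspace (space (socle n X) i)" by (simp add: socle_def)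
  moreover have "space (socle n X) i \<subseteq> space X i" by (auto simp: socle_space[OF X i])
  ultimately show "fin_dim (space (socle n X) i)" by (rule fin_dim_mono[OF rep_fin_dim[OF X i]])
next
  fix i assume i: "1 \<le> i" "i < n"
  show "lin (arrow (socle n X) i)" using rep_lin[OF X i] by (simp add: socle_def)
  fix v assume "v \<in> space (socle n X) (Suc i)"
  then have "arrow (socle n X) i v = 0" using socle_space[OF X, of "Suc i"] i by (simp add: socle_def)
  then show "arrow (socle n X) i v \<in> space (socle n X) i"
    by (simp add: socle_def ambient.span_zero)
qed

text \<open>
  In \<open>[a, b]\<close> all maps are injective except the one leaving the vertex \<open>a\<close>.
\<close>

lemma soc_index_interval:
  fixes X :: "'k::field rep"
  assumes iso: "iso n X (interval_mod a b)" and ab: "1 \<le> a" "a < b" "b \<le> Suc n"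
  shows "soc_index n X = a"
proof -
  let ?I = "interval_mod a b :: 'k rep" and ?S = "simple_mod :: nat \<Rightarrow> 'k rep"
  obtain f where f: "is_mor n X ?I f" "\<And>i. 1 \<le> i \<Longrightarrow> i \<le> n \<Longrightarrow> bij_betw (f i) (space X i) (space ?I i)"
    using isoE[OF iso] by blast
  note X = mor_rep(1)[OF f(1)]
  have an: "a \<le> n" using ab by simp
  have f0: "x = 0" if "1 \<le> i" "i \<le> n" "x \<in> space X i" "f i x = 0" for i x
    using f(2)[OF that(1,2)] subspace_0[OF fin_dim_subspace[OF rep_fin_dim[OF X that(1,2)]]] that(3,4) 
      lin_zero[OF mor_lin[OF f(1) that(1,2)]] 
    unfolding bij_betw_def by (metis inj_onD)
  have soc: "space (socle n X) i = (if i = a then space X a else {0})" if i: "1 \<le> i" "i \<le> n" for i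
  proof -
    have "varr X (i - 1) v = 0 \<longleftrightarrow> i = a \<or> v = 0" if v: "v \<in> space X i" for v
    proof (cases "i = 1")
      case True
      then show ?thesis
      proof (cases "i = a")
        case False
        then have "space ?I i = {0}" using True ab by (auto simp: interval_space)
        then show ?thesis using mor_in[OF f(1) i v] f0[OF i v] True by auto
      qed auto
    next
      case False
      then have j: "1 \<le> i - 1" "i - 1 < n" "i - 1 \<le> n" "Suc (i - 1) = i" using i by auto
      have "f (i - 1) (arrow X (i - 1) v) = arrow ?I (i - 1) (f i v)" using mor_arrow[OF f(1) j(1,2), of v] j v by simp
      moreover have "arrow X (i - 1) v \<in> space X (i - 1)" using rep_arrow[OF X j(1,2), of v] j v by simp
      moreover have "f i v \<in> space ?I i" by (rule mor_in[OF f(1) i v])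
      moreover have "f (i - 1) 0 = 0" by (rule lin_zero[OF mor_lin[OF f(1) j(1,3)]])
      moreover have "f i 0 = 0" by (rule lin_zero[OF mor_lin[OF f(1) i]])
      ultimately have 1: "arrow X (i - 1) v = 0 \<longleftrightarrow> arrow ?I (i - 1) (f i v) = 0" and 2: "f i v = 0 \<longleftrightarrow> v = 0"
        using f0[OF j(1,3), of "arrow X (i - 1) v"] f0[OF i v] by auto
      have "arrow ?I (i - 1) (f i v) = 0 \<longleftrightarrow> i = a \<or> f i v = 0"
        using \<open>f i v \<in> space ?I i\<close> j by (auto simp: interval_arrow interval_space split: if_splits)
      then show ?thesis using 1 2 j by simp
    qed
    then show ?thesis
      unfolding socle_space[OF X i] using subspace_0[OF rep_subspace[OF X i]] by auto
  qed
  have arr: "arrow (socle n X) i v = 0" if "1 \<le> i" "i < n" "v \<in> space (socle n X) (Suc i)" for i v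
    using that socle_space[OF X, of "Suc i"] by (simp add: socle_def)
  have sub: "space (socle n X) i \<subseteq> space X i" if "1 \<le> i" "i \<le> n" for i
    using socle_space[OF X that] by blast
  have "is_mor n (socle n X) (?S a) f"
  proof (rule is_morI)
    show "is_rep n (socle n X)" by (rule socle_rep[OF X])
    show "is_rep n (?S a)" unfolding simple_mod_def by (rule interval_rep)
    fix i assume i: "1 \<le> i" "i \<le> n"
    show "lin (f i)" by (rule mor_lin[OF f(1) i])
    fix v assume v: "v \<in> space (socle n X) i"
    show "f i v \<in> space (?S a) i"
      using v soc[OF i] mor_in[OF f(1) i, of v] lin_zero[OF mor_lin[OF f(1) i]] ab
      by (auto simp: simple_mod_def interval_space split: if_splits)
  next
    fix i v assume i: "1 \<le> i" "i < n" and v: "v \<in> space (socle n X) (Suc i)"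
    show "f i (arrow (socle n X) i v) = arrow (?S a) i (f (Suc i) v)"
      unfolding arr[OF i v] using lin_zero[OF mor_lin[OF f(1)], of i] i
      by (auto simp: simple_mod_def interval_arrow)
  qed
  moreover have "bij_betw (f i) (space (socle n X) i) (space (?S a) i)" if i: "1 \<le> i" "i \<le> n" for i
    using f(2)[OF i] soc[OF i] lin_zero[OF mor_lin[OF f(1) i]] ab
    by (auto simp: simple_mod_def interval_space bij_betw_def)
  ultimately have iso_a: "iso n (socle n X) (?S a)" by (rule mono_epi_iso)
  have uniq: "s = a" if s: "s \<in> {1..n}" and isos: "iso n (socle n X) (?S s)" for s
  proof (rule ccontr)
    assume "s \<noteq> a"
    have s': "1 \<le> s" "s \<le> n" using s by auto
    obtain g where g: "is_mor n (socle n X) (?S s) g" 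
      "\<And>i. 1 \<le> i \<Longrightarrow> i \<le> n \<Longrightarrow> bij_betw (g i) (space (socle n X) i) (space (?S s) i)"
      using isoE[OF isos] by blast
    have "space (?S s) s = g s ` {0}" using g(2)[OF s'] soc[OF s'] \<open>s \<noteq> a\<close> by (simp add: bij_betw_def)
    then have "space (?S s) s = {0}" using lin_zero[OF mor_lin[OF g(1) s']] by simp
    then show False using unit0_in[of s s "Suc s", where ?'a = 'k] unit0_nonzero[where ?'a = 'k] by (simp add: simple_mod_def)
  qed
  show ?thesis unfolding soc_index_def
  proof (rule the_equality)
    show "a \<in> {1..n} \<and> iso n (socle n X) (?S a)" using iso_a ab an by simp
  qed (use uniq in blast)
qed

section \<open>Vanishing of Hom and Ext on direct sums\<close>

lemma hom_zero_direct_sum: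
  assumes X: "is_rep n X" and ds: "direct_sum n X V W" 
    and "hom_zero n (sub X V) U" "hom_zero n (sub X W) U"
  shows "hom_zero n X U"
  unfolding hom_zero_def
proof (intro allI impI ballI)
  fix f i v assume f: "is_mor n X U f" and i: "i \<in> {1..n}" and v: "v \<in> space X i"
  have V: "submodule n X V" and W: "submodule n X W" using ds by (auto simp: direct_sum_def)
  obtain u w where uw: "u \<in> V i" "w \<in> W i" "v = u + w" using ds i v unfolding direct_sum_def by blast
  have "f i u = 0" "f i w = 0"
    using mor_from_sub[OF f V] mor_from_sub[OF f W] assms(3,4) i uw unfolding hom_zero_def by auto
  then show "f i v = 0" using uw(3) lin_add[OF mor_lin[OF f]] i by simp
qed

text \<open>
  The preimage of \<open>V\<close> in \<open>Y\<close> is an extension of \<open>V\<close> by \<open>U\<close>, the pullback of the given one.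
\<close>

lemma ext_zero_lift:
  assumes V: "submodule n X V" and ext: "ext_zero n (sub X V) U" and se: "short_exact n U f Y g X"
  obtains s where "is_mor n (sub X V) Y s" "\<And>i v. 1 \<le> i \<Longrightarrow> i \<le> n \<Longrightarrow> v \<in> V i \<Longrightarrow> g i (s i v) = v"
proof -
  note f = short_exactD(1)[OF se] and g = short_exactD(2)[OF se]
  note Y = mor_rep(2)[OF f]
  have mono: "inj_on (f i) (space U i)" and ex: "f i ` space U i = {v \<in> space Y i. g i v = 0}"
    and epi: "g i ` space Y i = space X i" if "i \<in> {1..n}" for i
    using se that unfolding short_exact_def is_mono_def exact_at_def is_epi_def by blast+
  define T where "T i = {y \<in> space Y i. g i y \<in> V i}" for i
  have T: "submodule n Y T"
  proof (rule submoduleI[OF Y])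
    fix i assume i: "1 \<le> i" "i \<le> n"
    note s = rep_subspace[OF Y i] and sV = submoduleD(2)[OF V i] and l = mor_lin[OF g i]
    show "ambient.subspace (T i)"
      unfolding ambient.subspace_def T_def using subspace_0[OF s] subspace_add[OF s] subspace_scale[OF s]
        subspace_0[OF sV] subspace_add[OF sV] subspace_scale[OF sV]
      by (auto simp: lin_zero[OF l] lin_add[OF l] lin_scl[OF l])
    show "T i \<subseteq> space Y i" by (auto simp: T_def)
  next
    fix i y assume i: "1 \<le> i" "i < n" and y: "y \<in> T (Suc i)"
    then have "y \<in> space Y (Suc i)" "g (Suc i) y \<in> V (Suc i)" by (auto simp: T_def)
    then show "arrow Y i y \<in> T i"
      using rep_arrow[OF Y i] mor_arrow[OF g i] submoduleD(4)[OF V i] by (simp add: T_def)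
  qed
  have f': "is_mor n U (sub Y T) f"
    by (rule mor_to_sub[OF f T])
      (use mor_in[OF f] ex subspace_0[OF submoduleD(2)[OF V]] in \<open>force simp: T_def\<close>)
  have g': "is_mor n (sub Y T) (sub X V) g"
    by (rule mor_to_sub[OF mor_from_sub[OF g T] V]) (auto simp: T_def)
  have "f i ` space U i = {v \<in> T i. g i v = 0}" if i: "i \<in> {1..n}" for i
    using ex[OF i] subspace_0[OF submoduleD(2)[OF V]] i by (auto simp: T_def)
  moreover have "g i ` T i = V i" if i: "i \<in> {1..n}" for i
  proof -
    have "V i \<subseteq> space X i" using submoduleD(3)[OF V] i by simp
    then show ?thesis using epi[OF i] by (auto simp: T_def)
  qed
  ultimately have "short_exact n U f (sub Y T) g (sub X V)"
    unfolding short_exact_def is_mono_def exact_at_def is_epi_def using f' g' mono by simp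
  then have "\<exists>s. is_mor n (sub X V) (sub Y T) s \<and> (\<forall>i\<in>{1..n}. \<forall>v\<in>space (sub X V) i. g i (s i v) = v)"
    using ext unfolding ext_zero_def by blast
  then obtain s where s: "is_mor n (sub X V) (sub Y T) s" "\<forall>i\<in>{1..n}. \<forall>v\<in>V i. g i (s i v) = v" by auto
  have "is_mor n (sub X V) Y s" using mor_comp[OF s(1) incl_mor[OF Y T]] by (simp add: comp_def)
  then show thesis using s(2) by (intro that) auto
qed

lemma ext_zero_direct_sum:
  assumes X: "is_rep n X" and ds: "direct_sum n X V W" 
    and ext: "ext_zero n (sub X V) U" "ext_zero n (sub X W) U"
  shows "ext_zero n X U"
  unfolding ext_zero_def
proof (intro allI impI)
  fix Y f g assume se: "short_exact n U f Y g X"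
  note g = short_exactD(2)[OF se]
  have V: "submodule n X V" and W: "submodule n X W" using ds by (auto simp: direct_sum_def)
  obtain s where s: "is_mor n (sub X V) Y s" "\<And>i v. 1 \<le> i \<Longrightarrow> i \<le> n \<Longrightarrow> v \<in> V i \<Longrightarrow> g i (s i v) = v"
    using ext_zero_lift[OF V ext(1) se] by blast
  obtain t where t: "is_mor n (sub X W) Y t" "\<And>i v. 1 \<le> i \<Longrightarrow> i \<le> n \<Longrightarrow> v \<in> W i \<Longrightarrow> g i (t i v) = v"
    using ext_zero_lift[OF W ext(2) se] by blast
  obtain p where p: "is_mor n X (sub X V) p" "\<forall>i\<in>{1..n}. (\<forall>u\<in>V i. p i u = u) \<and> (\<forall>w\<in>W i. p i w = 0)"
    using direct_sum_projection[OF X ds] by blast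
  obtain q where q: "is_mor n X (sub X W) q" "\<forall>i\<in>{1..n}. (\<forall>w\<in>W i. q i w = w) \<and> (\<forall>u\<in>V i. q i u = 0)"
    using direct_sum_projection[OF X direct_sum_sym[OF ds]] by blast
  let ?r = "\<lambda>i v. (s i \<circ> p i) v + (t i \<circ> q i) v"
  show "\<exists>r. is_mor n X Y r \<and> (\<forall>i\<in>{1..n}. \<forall>v\<in>space X i. g i (r i v) = v)"
  proof (intro exI conjI ballI)
    show "is_mor n X Y ?r" by (rule mor_plus[OF mor_comp[OF p(1) s(1)] mor_comp[OF q(1) t(1)]])
    fix i v assume i: "i \<in> {1..n}" and v: "v \<in> space X i"
    then have i': "1 \<le> i" "i \<le> n" by auto
    obtain u w where uw: "u \<in> V i" "w \<in> W i" "v = u + w" using ds i v unfolding direct_sum_def by blast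
    have "p i v = u" "q i v = w"
      using lin_add[OF mor_lin[OF p(1) i']] lin_add[OF mor_lin[OF q(1) i']] p(2) q(2) i uw by auto
    then show "g i (?r i v) = v"
      using lin_add[OF mor_lin[OF g i']] s(2)[OF i' uw(1)] t(2)[OF i' uw(2)] uw(3) by simp
  qed
qed

lemma hom_zero_zero: "zero_rep n X \<Longrightarrow> hom_zero n X U"
  unfolding hom_zero_def zero_rep_def
proof (intro allI impI ballI)
  fix f i v assume z: "is_rep n X \<and> (\<forall>i\<in>{1..n}. space X i = {0})" and f: "is_mor n X U f" and i: "i \<in> {1..n}" and v: "v \<in> space X i"
  have "v = 0" using z i v by auto
  then show "f i v = 0" using lin_zero[OF mor_lin[OF f]] i by auto
qed

lemma zero_mor:
  assumes "is_rep n X" "is_rep n Y"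
  shows "is_mor n X Y (\<lambda>_ _. 0)"
  using assms by (intro is_morI) (auto simp: subspace_0[OF fin_dim_subspace[OF rep_fin_dim[OF assms(2)]]] lin_zero[OF rep_lin[OF assms(2)]])

lemma ext_zero_zero: assumes z: "zero_rep n X" shows "ext_zero n X U"
  unfolding ext_zero_def
proof (intro allI impI)
  fix Y f g assume se: "short_exact n U f Y g X"
  note g = short_exactD(2)[OF se]
  show "\<exists>s. is_mor n X Y s \<and> (\<forall>i\<in>{1..n}. \<forall>v\<in>space X i. g i (s i v) = v)"
    using z lin_zero[OF mor_lin[OF g]] by (intro exI[of _ "\<lambda>_ _. 0"] conjI zero_mor mor_rep[OF g]) (auto simp: zero_rep_def)
qed

section \<open>Thick subcategories\<close>

lemma exact_v:
  assumes "exact_at n X f Y g Z"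
  shows "is_mor n X Y f" "is_mor n Y Z g"
    "i \<le> n \<Longrightarrow> vmap f i ` vsp X i = {v \<in> vsp Y i. vmap g i v = 0}"
proof -
  show "is_mor n X Y f" "is_mor n Y Z g" using assms unfolding exact_at_def by blast+
  assume i: "i \<le> n"
  show "vmap f i ` vsp X i = {v \<in> vsp Y i. vmap g i v = 0}"
  proof (cases "i = 0")
    case False
    then show ?thesis using assms i unfolding exact_at_def by simp
  qed auto
qed

lemma mono_v:
  assumes "is_mono n X Y f" "i \<le> n"
  shows "inj_on (vmap f i) (vsp X i)"
proof (cases "i = 0")
  case False
  then show ?thesis using assms unfolding is_mono_def by simp
qed simp

lemma epi_v:
  assumes "is_epi n X Y f" "i \<le> n"
  shows "vmap f i ` vsp X i = vsp Y i"
proof (cases "i = 0")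
  case False
  then show ?thesis using assms unfolding is_epi_def by simp
qed simp

abbreviation bij_down :: "'k::field rep \<Rightarrow> nat \<Rightarrow> nat \<Rightarrow> bool" where
  "bij_down X i j \<equiv> inj_down X i j \<and> surj_down X i j"

text \<open>
  This and the next two lemmas are instances of the five lemma, done by diagram chase.
\<close>

lemma bij_down_kernel:
  assumes mono: "is_mono n K X k" and exact: "exact_at n K k X f Y" and ij: "i \<le> j" "j \<le> n"
    and bX: "bij_down X i j" and bY: "bij_down Y i j"
  shows "bij_down K i j"
proof
  note k = exact_v(1)[OF exact] and f = exact_v(2)[OF exact]
  have i: "i \<le> n" using ij by simp
  note K = mor_rep(1)[OF k] and X = mor_rep(1)[OF f]
  have k0: "v = 0" if "t \<le> n" "v \<in> vsp K t" "vmap k t v = 0" for t v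
    using mono_v[OF mono that(1)] that(2,3) lin_zero[OF vmap_lin[OF k that(1)]] subspace_0[OF vsp_subspace[OF K that(1)]]
    by (metis inj_onD)
  show "inj_down K i j"
    unfolding inj_down_def
  proof (intro ballI impI)
    fix v assume v: "v \<in> vsp K j" "down K i j v = 0"
    have "down X i j (vmap k j v) = 0"
      using vmap_down[OF k ij(2,1) v(1)] v(2) lin_zero[OF vmap_lin[OF k i]] by simp
    then have "vmap k j v = 0" using bX vmap_in[OF k ij(2) v(1)] unfolding inj_down_def by blast
    then show "v = 0" by (rule k0[OF ij(2) v(1)])
  qed
  show "surj_down K i j"
    unfolding surj_down_def
  proof
    fix w assume w: "w \<in> vsp K i"
    have kw: "vmap k i w \<in> vsp X i" "vmap f i (vmap k i w) = 0" using exact_v(3)[OF exact i] w by blast+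
    obtain x where x: "x \<in> vsp X j" "vmap k i w = down X i j x" using bX kw(1) unfolding surj_down_def by blast
    have "down Y i j (vmap f j x) = 0" using vmap_down[OF f ij(2,1) x(1)] x(2) kw(2) by simp
    then have "vmap f j x = 0" using bY vmap_in[OF f ij(2) x(1)] unfolding inj_down_def by blast
    then obtain v where v: "v \<in> vsp K j" "x = vmap k j v" using exact_v(3)[OF exact ij(2)] x(1) by blast
    have dv: "down K i j v \<in> vsp K i" by (rule down_in[OF K ij(2,1) v(1)])
    have eq: "vmap k i (down K i j v) = vmap k i w" using vmap_down[OF k ij(2,1) v(1)] v(2) x(2) by simp
    have "down K i j v = w" by (rule inj_onD[OF mono_v[OF mono i] eq dv w])
    then show "w \<in> down K i j ` vsp K j" using v(1) by blast
  qed
qed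

lemma bij_down_cokernel:
  assumes exact: "exact_at n X f Y q Q" and epi: "is_epi n Y Q q" and ij: "i \<le> j" "j \<le> n"
    and bX: "bij_down X i j" and bY: "bij_down Y i j"
  shows "bij_down Q i j"
proof
  note f = exact_v(1)[OF exact] and q = exact_v(2)[OF exact]
  have i: "i \<le> n" using ij by simp
  note X = mor_rep(1)[OF f] and Y = mor_rep(1)[OF q]
  show "inj_down Q i j"
    unfolding inj_down_def
  proof (intro ballI impI)
    fix z assume z: "z \<in> vsp Q j" "down Q i j z = 0"
    obtain y where y: "y \<in> vsp Y j" "z = vmap q j y" using epi_v[OF epi ij(2)] z(1) by blast
    have dy: "down Y i j y \<in> vsp Y i" by (rule down_in[OF Y ij(2,1) y(1)])
    have "vmap q i (down Y i j y) = 0" using vmap_down[OF q ij(2,1) y(1)] y(2) z(2) by simp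
    then obtain x where x: "x \<in> vsp X i" "down Y i j y = vmap f i x" using exact_v(3)[OF exact i] dy by blast
    obtain x' where x': "x' \<in> vsp X j" "x = down X i j x'" using bX x(1) unfolding surj_down_def by blast
    have fx': "vmap f j x' \<in> vsp Y j" "vmap q j (vmap f j x') = 0" using exact_v(3)[OF exact ij(2)] x'(1) by blast+
    have "down Y i j (y - vmap f j x') = 0"
      unfolding lin_diff[OF down_lin[OF Y ij(2)]] using vmap_down[OF f ij(2,1) x'(1)] x(2) x'(2) by simp
    moreover have "y - vmap f j x' \<in> vsp Y j" using subspace_diff[OF vsp_subspace[OF Y ij(2)] y(1) fx'(1)] .
    ultimately have "y - vmap f j x' = 0" using bY unfolding inj_down_def by blast
    then show "z = 0" using y(2) fx'(2) by simp
  qed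
  show "surj_down Q i j"
    unfolding surj_down_def
  proof
    fix w assume w: "w \<in> vsp Q i"
    obtain y where y: "y \<in> vsp Y i" "w = vmap q i y" using epi_v[OF epi i] w by blast
    obtain y' where y': "y' \<in> vsp Y j" "y = down Y i j y'" using bY y(1) unfolding surj_down_def by blast
    have "w = down Q i j (vmap q j y')" using vmap_down[OF q ij(2,1) y'(1)] y y' by simp
    then show "w \<in> down Q i j ` vsp Q j" using vmap_in[OF q ij(2) y'(1)] by blast
  qed
qed

lemma bij_down_extension:
  assumes se: "short_exact n X f Y g Z" and ij: "i \<le> j" "j \<le> n"
    and bX: "bij_down X i j" and bZ: "bij_down Z i j"
  shows "bij_down Y i j"
proof
  note f = short_exactD(1)[OF se] and g = short_exactD(2)[OF se] and mono = short_exactD(3)[OF se]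
    and exact = short_exactD(4)[OF se] and epi = short_exactD(5)[OF se]
  have i: "i \<le> n" using ij by simp
  note X = mor_rep(1)[OF f] and Y = mor_rep(1)[OF g]
  show "inj_down Y i j"
    unfolding inj_down_def
  proof (intro ballI impI)
    fix y assume y: "y \<in> vsp Y j" "down Y i j y = 0"
    have "down Z i j (vmap g j y) = 0"
      using vmap_down[OF g ij(2,1) y(1)] y(2) lin_zero[OF vmap_lin[OF g i]] by simp
    then have "vmap g j y = 0" using bZ vmap_in[OF g ij(2) y(1)] unfolding inj_down_def by blast
    then obtain x where x: "x \<in> vsp X j" "y = vmap f j x" using exact[OF ij(2)] y(1) by blast
    have "vmap f i (down X i j x) = vmap f i 0"
      using vmap_down[OF f ij(2,1) x(1)] x(2) y(2) lin_zero[OF vmap_lin[OF f i]] by simp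
    then have "down X i j x = 0"
      using mono[OF i] down_in[OF X ij(2,1) x(1)] subspace_0[OF vsp_subspace[OF X i]] by (blast dest: inj_onD)
    then have "x = 0" using bX x(1) unfolding inj_down_def by blast
    then show "y = 0" using x(2) lin_zero[OF vmap_lin[OF f ij(2)]] by simp
  qed
  show "surj_down Y i j"
    unfolding surj_down_def
  proof
    fix y assume y: "y \<in> vsp Y i"
    obtain z where z: "z \<in> vsp Z j" "vmap g i y = down Z i j z"
      using bZ vmap_in[OF g i y] unfolding surj_down_def by blast
    obtain y' where y': "y' \<in> vsp Y j" "z = vmap g j y'" using epi[OF ij(2)] z(1) by blast
    have dy': "down Y i j y' \<in> vsp Y i" by (rule down_in[OF Y ij(2,1) y'(1)])
    have "vmap g i (y - down Y i j y') = 0"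
      unfolding lin_diff[OF vmap_lin[OF g i]] using vmap_down[OF g ij(2,1) y'(1)] y'(2) z(2) by simp
    moreover have "y - down Y i j y' \<in> vsp Y i" using subspace_diff[OF vsp_subspace[OF Y i] y dy'] .
    ultimately obtain x where x: "x \<in> vsp X i" "y - down Y i j y' = vmap f i x" using exact[OF i] by blast
    obtain x' where x': "x' \<in> vsp X j" "x = down X i j x'" using bX x(1) unfolding surj_down_def by blast
    have "y = down Y i j y' + vmap f i x" using x(2) by (simp add: algebra_simps)
    also have "\<dots> = down Y i j (y' + vmap f j x')"
      unfolding lin_add[OF down_lin[OF Y ij(2)]] using vmap_down[OF f ij(2,1) x'(1)] x'(2) by simp
    finally show "y \<in> down Y i j ` vsp Y j"
      using subspace_add[OF vsp_subspace[OF Y ij(2)] y'(1) vmap_in[OF f ij(2) x'(1)]] by blast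
  qed
qed

definition bij_cat :: "nat \<Rightarrow> (nat \<times> nat) set \<Rightarrow> 'k::field rep set" where
  "bij_cat n K = {X. is_rep n X \<and> (\<forall>(i, j)\<in>K. bij_down X i j)}"

definition zero_mod :: "'k::field rep" where
  "zero_mod = interval_mod 0 0"

lemma zero_mod: "zero_rep n zero_mod"
  unfolding zero_rep_def zero_mod_def by (auto simp: interval_rep interval_space)

lemma zero_rep_vsp: "zero_rep n Z \<Longrightarrow> i \<le> n \<Longrightarrow> vsp Z i = {0}"
  by (cases "i = 0") (auto simp: zero_rep_def)

lemma zero_bij_down:
  assumes Z: "zero_rep n Z" and ij: "i \<le> j" "j \<le> n"
  shows "bij_down Z i j"
proof -
  have "is_rep n Z" using Z by (simp add: zero_rep_def)
  from lin_zero[OF down_lin[OF this ij(2), of i]] show ?thesis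
    using zero_rep_vsp[OF Z, of i] zero_rep_vsp[OF Z, of j] ij by (simp add: inj_down_def surj_down_def)
qed

lemma bij_cat_thick:
  assumes K: "\<And>i j. (i, j) \<in> K \<Longrightarrow> i \<le> j \<and> j \<le> n"
  shows "thick n (bij_cat n K)"
  unfolding thick_def
proof (intro conjI allI impI ballI)
  have "zero_mod \<in> bij_cat n K"
    using zero_mod[of n] zero_bij_down[OF zero_mod[of n]] K unfolding bij_cat_def zero_rep_def by blast
  then show "bij_cat n K \<noteq> {}" by blast
  show "is_rep n X" if "X \<in> bij_cat n K" for X using that by (simp add: bij_cat_def)
next
  fix L k X f Y assume *: "X \<in> bij_cat n K \<and> Y \<in> bij_cat n K \<and> is_mono n L X k \<and> exact_at n L k X f Y"
  have "is_rep n L" using * mor_rep(1) unfolding is_mono_def by blast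
  moreover have "bij_down L i j" if ij: "(i, j) \<in> K" for i j
  proof (rule bij_down_kernel)
    show "i \<le> j" "j \<le> n" using K[OF ij] by auto
    show "bij_down X i j" "bij_down Y i j" using * ij unfolding bij_cat_def by auto
  qed (use * in blast)+
  ultimately show "L \<in> bij_cat n K" unfolding bij_cat_def by blast
next
  fix X f Y q Q assume *: "X \<in> bij_cat n K \<and> Y \<in> bij_cat n K \<and> exact_at n X f Y q Q \<and> is_epi n Y Q q"
  have "is_rep n Q" using * mor_rep(2) unfolding is_epi_def by blast
  moreover have "bij_down Q i j" if ij: "(i, j) \<in> K" for i j
  proof (rule bij_down_cokernel)
    show "i \<le> j" "j \<le> n" using K[OF ij] by auto
    show "bij_down X i j" "bij_down Y i j" using * ij unfolding bij_cat_def by auto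
  qed (use * in blast)+
  ultimately show "Q \<in> bij_cat n K" unfolding bij_cat_def by blast
next
  fix X f Y g Z assume *: "X \<in> bij_cat n K \<and> Z \<in> bij_cat n K \<and> short_exact n X f Y g Z"
  have "is_rep n Y" using * mor_rep(2)[OF short_exactD(1)] by blast
  moreover have "bij_down Y i j" if ij: "(i, j) \<in> K" for i j
  proof (rule bij_down_extension)
    show "i \<le> j" "j \<le> n" using K[OF ij] by auto
    show "bij_down X i j" "bij_down Z i j" using * ij unfolding bij_cat_def by auto
  qed (use * in blast)+
  ultimately show "Y \<in> bij_cat n K" unfolding bij_cat_def by blast
qed

lemma thick_rep: "thick n C \<Longrightarrow> X \<in> C \<Longrightarrow> is_rep n X"
  unfolding thick_def by blast

lemma thick_kernel: "thick n C \<Longrightarrow> X \<in> C \<Longrightarrow> Y \<in> C \<Longrightarrow> is_mono n K X k \<Longrightarrow> exact_at n K k X f Y \<Longrightarrow> K \<in> C"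
  unfolding thick_def by blast

lemma thick_cokernel: "thick n C \<Longrightarrow> X \<in> C \<Longrightarrow> Y \<in> C \<Longrightarrow> exact_at n X f Y q Q \<Longrightarrow> is_epi n Y Q q \<Longrightarrow> Q \<in> C"
  unfolding thick_def by blast

lemma thick_extension: "thick n C \<Longrightarrow> X \<in> C \<Longrightarrow> Z \<in> C \<Longrightarrow> short_exact n X f Y g Z \<Longrightarrow> Y \<in> C"
  unfolding thick_def by blast

text \<open>
  The zero module is the kernel of an identity map.
\<close>

lemma thick_zero:
  assumes C: "thick n C" and Z: "zero_rep n Z"
  shows "Z \<in> C"
proof -
  obtain X where X: "X \<in> C" using C unfolding thick_def by blast
  note r = thick_rep[OF C X]
  have Zr: "is_rep n Z" and Z0: "\<And>i. i \<in> {1..n} \<Longrightarrow> space Z i = {0}" using Z by (auto simp: zero_rep_def)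
  have z: "is_mor n Z X (\<lambda>_ _. 0)" by (rule zero_mor[OF Zr r])
  have i: "is_mor n X X (\<lambda>_. id)" by (rule is_morI[OF r r]) auto
  have "is_mono n Z X (\<lambda>_ _. 0)" using z Z0 by (simp add: is_mono_def)
  moreover have "0 \<in> space X i" if "i \<in> {1..n}" for i
    using subspace_0[OF fin_dim_subspace[OF rep_fin_dim[OF r]], of i] that by simp
  then have "exact_at n Z (\<lambda>_ _. 0) X (\<lambda>_. id) X" using z i Z0 unfolding exact_at_def by auto
  ultimately show ?thesis by (rule thick_kernel[OF C X X])
qed

text \<open>
  A module isomorphic to \<open>X\<close> is a kernel of the zero endomorphism of \<open>X\<close>.
\<close>

lemma thick_iso:
  assumes C: "thick n C" and X: "X \<in> C" and iso: "iso n X Y"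
  shows "Y \<in> C"
proof -
  obtain k where k: "is_mor n Y X k" "\<And>i. 1 \<le> i \<Longrightarrow> i \<le> n \<Longrightarrow> bij_betw (k i) (space Y i) (space X i)"
    using isoE[OF iso_sym[OF iso]] by blast
  have "is_mono n Y X k" using k unfolding is_mono_def bij_betw_def by simp
  moreover have "exact_at n Y k X (\<lambda>_ _. 0) X"
    using k zero_mor[OF mor_rep(2)[OF k(1)] mor_rep(2)[OF k(1)]] unfolding exact_at_def bij_betw_def by simp
  ultimately show ?thesis by (rule thick_kernel[OF C X X])
qed

text \<open>
  A direct summand is the kernel of the projection to the complement, viewed as an endomorphism.
\<close>

lemma thick_summand:
  assumes C: "thick n C" and X: "X \<in> C" and ds: "direct_sum n X U W"
  shows "sub X U \<in> C" "sub X W \<in> C"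
proof -
  have *: "sub X W \<in> C" if ds: "direct_sum n X U W" for U W
  proof -
    obtain p where p: "short_exact n (sub X W) (\<lambda>_. id) X p (sub X U)" "is_mor n X X p"
      using direct_sum_short_exact[OF thick_rep[OF C X] ds] by blast
    have "is_mono n (sub X W) X (\<lambda>_. id)" using p(1) by (simp add: short_exact_def)
    moreover have "exact_at n (sub X W) (\<lambda>_. id) X p X"
      using p unfolding short_exact_def exact_at_def by blast
    ultimately show ?thesis by (rule thick_kernel[OF C X X])
  qed
  show "sub X W \<in> C" by (rule *[OF ds])
  show "sub X U \<in> C" by (rule *[OF direct_sum_sym[OF ds]])
qed

lemma thick_direct_sum:
  assumes C: "thick n C" and X: "is_rep n X" and ds: "direct_sum n X U W" and "sub X U \<in> C" "sub X W \<in> C"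
  shows "X \<in> C"
proof -
  obtain p where "short_exact n (sub X W) (\<lambda>_. id) X p (sub X U)"
    using direct_sum_short_exact[OF X ds] by blast
  then show ?thesis by (rule thick_extension[OF C assms(5,4)])
qed

lemma thick_induct [consumes 2, case_names zero interval direct_sum]:
  fixes X :: "'k::field rep"
  assumes C: "thick n C" and X: "X \<in> C"
    and zero: "\<And>X. zero_rep n X \<Longrightarrow> P X"
    and interval: "\<And>X a b. 1 \<le> a \<Longrightarrow> a < b \<Longrightarrow> b \<le> Suc n \<Longrightarrow> interval_mod a b \<in> C \<Longrightarrow> iso n X (interval_mod a b) \<Longrightarrow> P X"
    and sum: "\<And>X U W. is_rep n X \<Longrightarrow> direct_sum n X U W \<Longrightarrow> P (sub X U) \<Longrightarrow> P (sub X W) \<Longrightarrow> P X"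
  shows "P X"
proof -
  have "X \<in> C \<longrightarrow> P X"
    using thick_rep[OF C X]
  proof (induction rule: rep_induct)
    case (indecomposable X)
    then obtain a b where ab: "1 \<le> a" "a < b" "b \<le> Suc n" "iso n X (interval_mod a b)"
      by (rule indecomposable_interval)
    then show ?case using interval[OF ab(1-3) _ ab(4)] thick_iso[OF C _ ab(4)] by blast
  next
    case (direct_sum X U W)
    then show ?case using sum thick_summand[OF C] by blast
  qed (use zero in blast)
  then show ?thesis using X by blast
qed

lemma thick_subset:
  fixes C C' :: "'k::field rep set"
  assumes C: "thick n C" and C': "thick n C'"
    and "\<And>a b. 1 \<le> a \<Longrightarrow> a < b \<Longrightarrow> b \<le> Suc n \<Longrightarrow> interval_mod a b \<in> C \<Longrightarrow> interval_mod a b \<in> C'"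
  shows "C \<subseteq> C'"
proof
  fix X assume "X \<in> C"
  with C show "X \<in> C'"
  proof (induction rule: thick_induct)
    case (interval X a b)
    then show ?case using assms(3) thick_iso[OF C' _ iso_sym] by blast
  qed (use thick_zero[OF C'] thick_direct_sum[OF C'] in blast)+
qed

text \<open>
  For \<open>a \<le> c \<le> b \<le> d\<close> this is, with \<open>s = c\<close> and \<open>t = b\<close>, the canonical map
  \<open>[a, b] \<rightarrow> [c, d]\<close> with image \<open>[c, b]\<close>. Its kernel is \<open>[a, c]\<close> and its cokernel \<open>[b, d]\<close>.
\<close>

definition interval_map :: "nat \<Rightarrow> nat \<Rightarrow> nat \<Rightarrow> (nat \<Rightarrow> 'k::field) \<Rightarrow> nat \<Rightarrow> 'k" where
  "interval_map s t = (\<lambda>i. if s \<le> i \<and> i < t then id else (\<lambda>_. 0))"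

lemma interval_map_mor:
  assumes "a \<le> c" "c \<le> b" "b \<le> d"
  shows "is_mor n (interval_mod a b) (interval_mod c d) (interval_map c b)"
  using assms
  by (intro is_morI interval_rep) (auto simp: interval_map_def interval_space interval_arrow ambient.span_zero split: if_splits)

lemma interval_kernel:
  assumes "a \<le> c" "c \<le> b" "b \<le> d"
  shows "is_mono n (interval_mod a c) (interval_mod a b) (interval_map a c)"
    "exact_at n (interval_mod a c) (interval_map a c) (interval_mod a b) (interval_map c b) (interval_mod c d)"
  unfolding is_mono_def exact_at_def
  using interval_map_mor[of a a c b n] interval_map_mor[OF assms, of n] assms
  by (auto simp: interval_map_def interval_space ambient.span_zero inj_on_def split: if_splits)

lemma span_nonempty [simp]: "ambient.span S \<noteq> {}"
  using ambient.span_zero by blast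

lemma interval_cokernel:
  assumes "a \<le> c" "c \<le> b" "b \<le> d"
  shows "is_epi n (interval_mod c d) (interval_mod b d) (interval_map b d)"
    "exact_at n (interval_mod a b) (interval_map c b) (interval_mod c d) (interval_map b d) (interval_mod b d)"
  unfolding is_epi_def exact_at_def
  using interval_map_mor[of c b d d n] interval_map_mor[OF assms, of n] assms
  by (auto simp: interval_map_def interval_space ambient.span_zero image_constant_conv split: if_splits)

section \<open>Non-crossing partitions and thick subcategories\<close>

definition same_part :: "nat set set \<Rightarrow> nat \<Rightarrow> nat \<Rightarrow> bool" where
  "same_part P a b \<longleftrightarrow> (\<exists>B\<in>P. a \<in> B \<and> b \<in> B)"

lemma Nc_partition: "P \<in> Nc m \<Longrightarrow> partition_on {1..m} P"
  by (simp add: Nc_def)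

lemma part_unique: "partition_on A P \<Longrightarrow> B \<in> P \<Longrightarrow> B' \<in> P \<Longrightarrow> x \<in> B \<Longrightarrow> x \<in> B' \<Longrightarrow> B = B'"
  using partition_onD2[of A P] by (auto simp: disjoint_def)

lemma same_part_sym: "same_part P a b \<Longrightarrow> same_part P b a"
  by (auto simp: same_part_def)

lemma same_part_trans: "partition_on A P \<Longrightarrow> same_part P a b \<Longrightarrow> same_part P b c \<Longrightarrow> same_part P a c"
  unfolding same_part_def using part_unique[of A P] by blast

lemma same_part_refl: "partition_on A P \<Longrightarrow> a \<in> A \<Longrightarrow> same_part P a a"
  unfolding same_part_def using partition_onD1[of A P] by blast

lemma same_part_in: "partition_on A P \<Longrightarrow> same_part P a b \<Longrightarrow> a \<in> A \<and> b \<in> A"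
  unfolding same_part_def using partition_onD1[of A P] by blast

lemma part_eq_same_part: "partition_on A P \<Longrightarrow> B \<in> P \<Longrightarrow> x \<in> B \<Longrightarrow> y \<in> B \<longleftrightarrow> same_part P x y"
  unfolding same_part_def using part_unique[of A P] by blast

lemma Nc_crossing:
  assumes "P \<in> Nc m" "i < i'" "i' < j" "j < j'" "same_part P i j" "same_part P i' j'"
  shows "same_part P i i'"
proof -
  have "\<exists>B\<in>P. {i, i', j, j'} \<subseteq> B"
    using assms(1)[unfolded Nc_def noncrossing_def] assms(2-4) assms(5,6)[unfolded same_part_def] by simp
  then show ?thesis unfolding same_part_def by auto
qed

lemma refines_iff_same_part:
  assumes P: "partition_on A P" and P': "partition_on A P'"
  shows "refines A P P' \<longleftrightarrow> (\<forall>a b. same_part P a b \<longrightarrow> same_part P' a b)"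
proof
  assume "refines A P P'"
  then show "\<forall>a b. same_part P a b \<longrightarrow> same_part P' a b" unfolding refines_def same_part_def by (meson subsetD)
next
  assume h: "\<forall>a b. same_part P a b \<longrightarrow> same_part P' a b"
  have "\<exists>Y\<in>P'. X \<subseteq> Y" if X: "X \<in> P" for X
  proof -
    obtain x where x: "x \<in> X" using partition_onD3[OF P] X by fastforce
    then obtain Y where Y: "Y \<in> P'" "x \<in> Y" using same_part_refl[OF P'] partition_onD1[OF P] X unfolding same_part_def by blast
    have "y \<in> Y" if "y \<in> X" for y
      using that h x X part_eq_same_part[OF P' Y] unfolding same_part_def by blast
    then show ?thesis using Y(1) by blast
  qed
  then show "refines A P P'" using P P' by (simp add: refines_def)
qed

text \<open>
  Elements of one part lie on the same side of a chord that belongs to another part.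
\<close>

lemma Nc_side:
  assumes P: "P \<in> Nc m" and pq: "same_part P p q" and xy: "same_part P x y" and "\<not> same_part P p x"
  shows "x < p \<and> p < y \<longleftrightarrow> x < q \<and> q < y"
proof -
  have *: "x < q \<and> q < y" if h: "x < p" "p < y" and pq: "same_part P p q" and np: "\<not> same_part P p x" for p q
  proof (rule ccontr)
    note tr = same_part_trans[OF Nc_partition[OF P]]
    have nq: "\<not> same_part P q x" using np tr[OF pq] by blast
    have "q \<noteq> x" "q \<noteq> y" using pq xy np tr same_part_sym by metis+
    moreover assume "\<not> (x < q \<and> q < y)"
    ultimately have "q < x \<or> y < q" by auto
    then show False
    proof
      assume "q < x"
      from Nc_crossing[OF P this h same_part_sym[OF pq] xy] show False using nq by simp
    next
      assume "y < q"
      from Nc_crossing[OF P h this xy pq] show False using np same_part_sym by blast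
    qed
  qed
  have "\<not> same_part P q x" using assms(4) same_part_trans[OF Nc_partition[OF P] pq] by blast
  then show ?thesis using *[OF _ _ pq assms(4)] *[OF _ _ same_part_sym[OF pq]] by blast
qed

text \<open>
  The pairs of vertices that are on the same side of every chord of \<open>P\<close>, where the vertex \<open>i\<close> is
  thought of as a point between \<open>i\<close> and \<open>i + 1\<close> on a circle through \<open>1, \<dots>, n + 1\<close> (and \<open>0\<close>
  between \<open>n + 1\<close> and \<open>1\<close>). They are the pairs in a common part of the Kreweras complement of
  \<open>P\<close>.
\<close>

definition unseparated :: "nat \<Rightarrow> nat set set \<Rightarrow> (nat \<times> nat) set" where
  "unseparated n P = {(i, j). i < j \<and> j \<le> n \<and>
     (\<forall>x y. same_part P x y \<and> x < y \<longrightarrow> (x \<le> i \<and> i < y \<longleftrightarrow> x \<le> j \<and> j < y))}"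

text \<open>
  The Kreweras complement determines the partition. Let \<open>B\<close> be the part of \<open>c\<close>; then \<open>d\<close> lies on the
  circle strictly between two neighbours \<open>p\<close>, \<open>q\<close> in \<open>B\<close>. The vertices next to \<open>p\<close> and \<open>q\<close> in this
  gap are not separated by \<open>P\<close>, but the chord from \<open>c\<close> to \<open>d\<close> separates them. If \<open>d\<close> is larger
  than all elements of \<open>B\<close>, the second neighbour is \<open>Min B\<close>, on the other side of \<open>n + 1\<close>.
\<close>

lemma separating_pair:
  assumes P: "P \<in> Nc (Suc n)" and cd: "1 \<le> c" "c < d" "d \<le> Suc n" and ns: "\<not> same_part P c d"
  obtains i j where "(i, j) \<in> unseparated n P" "\<not> (c \<le> i \<and> i < d \<longleftrightarrow> c \<le> j \<and> j < d)"
proof -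
  note part = Nc_partition[OF P]
  have "same_part P c c" using same_part_refl[OF part] cd by auto
  then obtain B where B: "B \<in> P" "c \<in> B" unfolding same_part_def by blast
  have Bsub: "B \<subseteq> {1..Suc n}" using partition_onD1[OF part] B by blast
  then have fin: "finite B" by (rule finite_subset) simp
  have inB: "same_part P p q" if "p \<in> B" "q \<in> B" for p q using that B(1) unfolding same_part_def by blast
  have dB: "d \<notin> B" using ns inB[OF B(2)] by blast
  have notB: "\<not> same_part P p x" if "p \<in> B" "x \<notin> B" for p x
    using that part_eq_same_part[OF part B(1)] by blast
  have parts: "x \<in> B \<longleftrightarrow> y \<in> B" if "same_part P x y" for x y
    using that part_eq_same_part[OF part B(1)] same_part_sym by blast
  define p where "p = Max {z \<in> B. z < d}"
  have "p \<in> {z \<in> B. z < d}" unfolding p_def using fin B cd by (intro Max_in) auto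
  then have p: "p \<in> B" "p < d" by auto
  have pmax: "z \<le> p" if "z \<in> B" "z < d" for z unfolding p_def using that fin by (intro Max_ge) auto
  show thesis
  proof (cases "\<exists>z\<in>B. d < z")
    case True
    define q where "q = Min {z \<in> B. d < z}"
    have "q \<in> {z \<in> B. d < z}" unfolding q_def using fin True by (intro Min_in) auto
    then have q: "q \<in> B" "d < q" by auto
    have qmin: "q \<le> z" if "z \<in> B" "d < z" for z unfolding q_def using that fin by (intro Min_le) auto
    have gap: "z \<le> p \<or> q \<le> z" if "z \<in> B" for z
      using that pmax[of z] qmin[of z] dB by (cases "z < d") (auto simp: not_less le_less)
    have "x \<le> p \<and> p < y \<longleftrightarrow> x \<le> q - 1 \<and> q - 1 < y" if xy: "same_part P x y" "x < y" for x y
    proof (cases "x \<in> B")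
      case True
      then show ?thesis using gap[of x] gap[of y] parts[OF xy(1)] p q by auto
    next
      case False
      then have "x \<noteq> p" "y \<noteq> p" "x \<noteq> q" "y \<noteq> q" using parts[OF xy(1)] p q by auto
      then show ?thesis using Nc_side[OF P inB[OF p(1) q(1)] xy(1) notB[OF p(1) False]] q by auto
    qed
    then have "(p, q - 1) \<in> unseparated n P" unfolding unseparated_def using p q Bsub by auto
    moreover have "\<not> (c \<le> p \<and> p < d \<longleftrightarrow> c \<le> q - 1 \<and> q - 1 < d)" using pmax[OF B(2) cd(2)] p q by auto
    ultimately show thesis by (rule that)
  next
    case False
    have pB: "z \<le> p" if "z \<in> B" for z using that pmax[of z] False dB by (cases "z < d") (auto simp: not_less le_less)
    define l where "l = Min B"
    have "B \<noteq> {}" using B by blast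
    then have l: "l \<in> B" "\<And>z. z \<in> B \<Longrightarrow> l \<le> z" unfolding l_def using Min_in[OF fin] Min_le[OF fin] by blast+
    have l1: "1 \<le> l" using l Bsub by auto
    have "x \<le> l - 1 \<and> l - 1 < y \<longleftrightarrow> x \<le> p \<and> p < y" if xy: "same_part P x y" "x < y" for x y
    proof (cases "x \<in> B")
      case True
      then show ?thesis using l(2)[of x] pB[of y] parts[OF xy(1)] l1 by auto
    next
      case False
      then have "x \<noteq> p" "y \<noteq> p" "x \<noteq> l" "y \<noteq> l" using parts[OF xy(1)] p l by auto
      then show ?thesis using Nc_side[OF P inB[OF l(1) p(1)] xy(1) notB[OF l(1) False]] l1 by auto
    qed
    then have "(l - 1, p) \<in> unseparated n P"
      unfolding unseparated_def using p l(2)[OF p(1)] l1 cd by auto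
    moreover have "\<not> (c \<le> l - 1 \<and> l - 1 < d \<longleftrightarrow> c \<le> p \<and> p < d)" using pB[OF B(2)] l(2)[OF B(2)] p l1 by auto
    ultimately show thesis by (rule that)
  qed
qed

abbreviation nc_cat :: "nat \<Rightarrow> nat set set \<Rightarrow> 'k::field rep set" where
  "nc_cat n P \<equiv> bij_cat n (unseparated n P)"

lemma nc_cat_thick: "thick n (nc_cat n P)"
  by (rule bij_cat_thick) (auto simp: unseparated_def)

lemma interval_bij_down:
  assumes "1 \<le> c" "i \<le> j" "j \<le> n"
  shows "bij_down (interval_mod c d) i j \<longleftrightarrow> (c \<le> i \<and> i < d \<longleftrightarrow> c \<le> j \<and> j < d)"
  using interval_inj_down[OF assms] interval_surj_down[OF assms] by blast

lemma interval_in_nc_cat: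
  assumes P: "P \<in> Nc (Suc n)" and cd: "1 \<le> c" "c < d" "d \<le> Suc n"
  shows "interval_mod c d \<in> nc_cat n P \<longleftrightarrow> same_part P c d"
proof
  assume s: "same_part P c d"
  have "bij_down (interval_mod c d) i j" if ij: "(i, j) \<in> unseparated n P" for i j
    using ij s cd interval_bij_down[of c i j n d] unfolding unseparated_def by auto
  then show "interval_mod c d \<in> nc_cat n P" unfolding bij_cat_def using interval_rep by blast
next
  assume m: "interval_mod c d \<in> nc_cat n P"
  show "same_part P c d"
  proof (rule ccontr)
    assume "\<not> same_part P c d"
    from separating_pair[OF P cd this] obtain i j 
      where ij: "(i, j) \<in> unseparated n P" "\<not> (c \<le> i \<and> i < d \<longleftrightarrow> c \<le> j \<and> j < d)" by blast
    then have "i \<le> j" "j \<le> n" by (auto simp: unseparated_def)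
    then show False using m ij interval_bij_down[OF cd(1), of i j n d] unfolding bij_cat_def by blast
  qed
qed

lemma nc_thick_eq:
  assumes P: "P \<in> Nc (Suc n)"
  shows "nc_thick n P = (nc_cat n P :: 'k::field rep set)"
proof -
  note part = Nc_partition[OF P]
  let ?S = "{X :: 'k rep. \<exists>B\<in>P. \<exists>a\<in>B. \<exists>b\<in>B. a < b \<and> iso n X (interval_mod a b)}"
  have S: "?S = {X. \<exists>a b. same_part P a b \<and> a < b \<and> iso n X (interval_mod a b)}"
    unfolding same_part_def by blast
  have range: "1 \<le> a" "b \<le> Suc n" if "same_part P a b" for a b using same_part_in[OF part that] by auto
  have indec: "{X\<in>nc_cat n P. indecomposable n X} = ?S"
    unfolding S
  proof (intro equalityI subsetI)
    fix X :: "'k rep" assume X: "X \<in> {X\<in>nc_cat n P. indecomposable n X}"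
    then obtain a b where ab: "1 \<le> a" "a < b" "b \<le> Suc n" "iso n X (interval_mod a b)"
      using indecomposable_interval by blast
    then have "interval_mod a b \<in> (nc_cat n P :: 'k rep set)" using X thick_iso[OF nc_cat_thick] by blast
    then show "X \<in> {X. \<exists>a b. same_part P a b \<and> a < b \<and> iso n X (interval_mod a b)}"
      using interval_in_nc_cat[OF P ab(1-3)] ab by blast
  next
    fix X :: "'k rep" assume "X \<in> {X. \<exists>a b. same_part P a b \<and> a < b \<and> iso n X (interval_mod a b)}"
    then obtain a b where ab: "same_part P a b" "a < b" "iso n X (interval_mod a b)" by blast
    note r = range[OF ab(1)]
    have "interval_mod a b \<in> (nc_cat n P :: 'k rep set)" using interval_in_nc_cat[OF P r(1) ab(2) r(2)] ab(1) by blast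
    then show "X \<in> {X\<in>nc_cat n P. indecomposable n X}"
      using thick_iso[OF nc_cat_thick _ iso_sym[OF ab(3)]] interval_indecomposable[OF ab(3) r(1) ab(2) r(2)] by blast
  qed
  show ?thesis
    unfolding nc_thick_def
  proof (rule the_equality)
    show "thick n (nc_cat n P :: 'k rep set) \<and> {X\<in>nc_cat n P. indecomposable n X} = ?S"
      using nc_cat_thick indec by blast
    fix C :: "'k rep set" assume C: "thick n C \<and> {X\<in>C. indecomposable n X} = ?S"
    have "interval_mod a b \<in> C \<longleftrightarrow> interval_mod a b \<in> (nc_cat n P :: 'k rep set)" if ab: "1 \<le> a" "a < b" "b \<le> Suc n" for a b
      using C indec interval_indecomposable[OF iso_refl[OF interval_rep] ab, where ?'a = 'k] by blast
    then show "C = nc_cat n P"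
      using thick_subset[of n C "nc_cat n P"] thick_subset[of n "nc_cat n P" C] C nc_cat_thick by blast
  qed
qed

text \<open>
  The first three facts come from \<open>0 \<rightarrow> [a, b] \<rightarrow> [a, c] \<rightarrow> [b, c] \<rightarrow> 0\<close>, the fourth one from the kernel
  of \<open>[a, c] \<rightarrow> [b, d]\<close>.
\<close>

lemma thick_intervals:
  assumes C: "thick n C"
  shows "a \<le> b \<Longrightarrow> b \<le> c \<Longrightarrow> interval_mod a b \<in> C \<Longrightarrow> interval_mod b c \<in> C \<Longrightarrow> interval_mod a c \<in> C"
    and "a \<le> b \<Longrightarrow> b \<le> c \<Longrightarrow> interval_mod a b \<in> C \<Longrightarrow> interval_mod a c \<in> C \<Longrightarrow> interval_mod b c \<in> C"
    and "a \<le> b \<Longrightarrow> b \<le> c \<Longrightarrow> interval_mod a c \<in> C \<Longrightarrow> interval_mod b c \<in> C \<Longrightarrow> interval_mod a b \<in> C"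
    and "a < b \<Longrightarrow> b < c \<Longrightarrow> c < d \<Longrightarrow> interval_mod a c \<in> C \<Longrightarrow> interval_mod b d \<in> C \<Longrightarrow> interval_mod a b \<in> C"
proof -
  assume abc: "a \<le> b" "b \<le> c"
  note k = interval_kernel[OF abc order_refl, of n] and q = interval_cokernel[OF order_refl abc, of n]
  have "short_exact n (interval_mod a b) (interval_map a b) (interval_mod a c) (interval_map b c) (interval_mod b c)"
    unfolding short_exact_def using k q by blast
  then show "interval_mod a b \<in> C \<Longrightarrow> interval_mod b c \<in> C \<Longrightarrow> interval_mod a c \<in> C"
    by (rule thick_extension[OF C, rotated 2])
  show "interval_mod a b \<in> C \<Longrightarrow> interval_mod a c \<in> C \<Longrightarrow> interval_mod b c \<in> C"
    using q thick_cokernel[OF C] by blast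
  show "interval_mod a c \<in> C \<Longrightarrow> interval_mod b c \<in> C \<Longrightarrow> interval_mod a b \<in> C"
    using k thick_kernel[OF C] by blast
next
  assume "a < b" "b < c" "c < d"
  then have "a \<le> b" "b \<le> c" "c \<le> d" by auto
  from interval_kernel[OF this, of n] show "interval_mod a c \<in> C \<Longrightarrow> interval_mod b d \<in> C \<Longrightarrow> interval_mod a b \<in> C"
    using thick_kernel[OF C] by blast
qed

text \<open>
  Two out of three in a short exact sequence make \<open>[a, b] \<in> C\<close> an equivalence relation between \<open>a\<close> and
  \<open>b\<close>, and for \<open>i < i' < j < j'\<close> the kernel of \<open>[i, j] \<rightarrow> [i', j']\<close> makes it non-crossing.
\<close>

lemma thick_partition:
  fixes C :: "'k::field rep set"
  assumes C: "thick n C"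
  obtains P where "P \<in> Nc (Suc n)" 
    "\<And>c d. 1 \<le> c \<Longrightarrow> c < d \<Longrightarrow> d \<le> Suc n \<Longrightarrow> interval_mod c d \<in> C \<longleftrightarrow> same_part P c d"
proof -
  let ?A = "{1..Suc n}"
  define I where "I a b \<longleftrightarrow> interval_mod (min a b) (max a b) \<in> C" for a b
  have I_le: "I a b \<longleftrightarrow> interval_mod a b \<in> C" if "a \<le> b" for a b using that by (simp add: I_def min_def max_def)
  have I_sym: "I a b \<longleftrightarrow> I b a" for a b by (simp add: I_def min.commute max.commute)
  have I_refl: "I a a" for a
    unfolding I_le[OF order_refl]
    by (rule thick_zero[OF C]) (auto simp: zero_rep_def interval_rep interval_space)
  have I_trans: "I a c" if "I a b" "I b c" for a b c
  proof -
    \<comment> \<open>Transitivity, with the three points in any order, is the two-out-of-three property.\<close>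
    have ordered: "(I a b \<and> I b c \<longrightarrow> I a c) \<and> (I a b \<and> I a c \<longrightarrow> I b c) \<and> (I a c \<and> I b c \<longrightarrow> I a b)"
      if "a \<le> b" "b \<le> c" for a b c
      using thick_intervals(1-3)[OF C that] I_le that by (metis order_trans)
    consider "a \<le> b" "b \<le> c" | "a \<le> c" "c \<le> b" | "b \<le> a" "a \<le> c" | "b \<le> c" "c \<le> a" | "c \<le> a" "a \<le> b" | "c \<le> b" "b \<le> a"
      by linarith
    then show ?thesis using that ordered I_sym by cases metis+
  qed
  define r where "r = {(a, b). a \<in> ?A \<and> b \<in> ?A \<and> I a b}"
  have equiv: "equiv ?A r"
    by (rule equivI) (auto simp: r_def refl_on_def sym_def trans_def I_refl I_sym intro: I_trans)
  define P where "P = ?A // r"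
  have part: "partition_on ?A P" unfolding P_def by (rule partition_on_quotient[OF equiv])
  have sp: "same_part P a b \<longleftrightarrow> (a, b) \<in> r" for a b
  proof
    assume "same_part P a b"
    then obtain B where B: "B \<in> ?A // r" "a \<in> B" "b \<in> B" unfolding same_part_def P_def by blast
    then show "(a, b) \<in> r" using quotient_eq_iff[OF equiv B(1) B(1) B(2,3)] by simp
  next
    assume ab: "(a, b) \<in> r"
    then have "a \<in> ?A" by (auto simp: r_def)
    then have "r `` {a} \<in> P" "a \<in> r `` {a}" "b \<in> r `` {a}"
      using ab equiv_class_self[OF equiv] unfolding P_def by (auto intro: quotientI)
    then show "same_part P a b" unfolding same_part_def by blast
  qed
  have "noncrossing P"
    unfolding noncrossing_def same_part_def[symmetric]
  proof (intro allI impI, elim conjE)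
    fix i i' j j' assume lt: "i < i'" "i' < j" "j < j'" and s: "same_part P i j" "same_part P i' j'"
    have "I i i'" 
      using thick_intervals(4)[OF C lt] s lt unfolding sp r_def by (simp add: I_le)
    then have "same_part P i i'" using s unfolding sp r_def by auto
    then obtain B where B: "B \<in> P" "i \<in> B" "i' \<in> B" unfolding same_part_def by blast
    then have "j \<in> B" "j' \<in> B" using s part_eq_same_part[OF part B(1)] by blast+
    then show "\<exists>B\<in>P. {i, i', j, j'} \<subseteq> B" using B by blast
  qed
  then have "P \<in> Nc (Suc n)" using part by (simp add: Nc_def)
  moreover have "interval_mod c d \<in> C \<longleftrightarrow> same_part P c d" if "1 \<le> c" "c < d" "d \<le> Suc n" for c d
    unfolding sp r_def using that I_le[of c d] by auto
  ultimately show thesis by (rule that)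
qed

lemma thick_is_nc_cat:
  fixes C :: "'k::field rep set"
  assumes C: "thick n C"
  obtains P where "P \<in> Nc (Suc n)" "C = nc_cat n P"
proof -
  obtain P where P: "P \<in> Nc (Suc n)" 
    "\<And>c d. 1 \<le> c \<Longrightarrow> c < d \<Longrightarrow> d \<le> Suc n \<Longrightarrow> interval_mod c d \<in> C \<longleftrightarrow> same_part P c d"
    using thick_partition[OF C] by metis
  have "C = nc_cat n P"
    using thick_subset[OF C nc_cat_thick, of P] thick_subset[OF nc_cat_thick C, of P] P(2) interval_in_nc_cat[OF P(1)]
    by blast
  with P(1) show thesis by (rule that)
qed

lemma nc_cat_subset_iff:
  assumes P: "P \<in> Nc (Suc n)" and P': "P' \<in> Nc (Suc n)"
  shows "(nc_cat n P :: 'k::field rep set) \<subseteq> nc_cat n P' \<longleftrightarrow> refines {1..Suc n} P P'"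
proof -
  note part = Nc_partition[OF P] and part' = Nc_partition[OF P']
  show ?thesis
    unfolding refines_iff_same_part[OF part part']
  proof (intro iffI allI impI)
    fix a b assume sub: "(nc_cat n P :: 'k rep set) \<subseteq> nc_cat n P'" and ab: "same_part P a b"
    have lt: "same_part P' a b" if ab: "same_part P a b" "a < b" for a b
    proof -
      have r: "1 \<le> a" "b \<le> Suc n" using same_part_in[OF part ab(1)] by auto
      then show ?thesis
        using sub interval_in_nc_cat[OF P r(1) ab(2) r(2), where ?'a = 'k] interval_in_nc_cat[OF P' r(1) ab(2) r(2), where ?'a = 'k] ab(1) by blast
    qed
    show "same_part P' a b"
    proof (cases a b rule: linorder_cases)
      case equal
      then show ?thesis using same_part_refl[OF part'] same_part_in[OF part ab] by blast
    qed (use lt ab same_part_sym in blast)+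
  next
    assume "\<forall>a b. same_part P a b \<longrightarrow> same_part P' a b"
    then show "(nc_cat n P :: 'k rep set) \<subseteq> nc_cat n P'"
      by (intro thick_subset[OF nc_cat_thick nc_cat_thick]) (use interval_in_nc_cat[OF P] interval_in_nc_cat[OF P'] in blast)
  qed
qed

lemma nc_thick_bij: "bij_betw (nc_thick n) (Nc (Suc n)) {C :: 'k::field rep set. thick n C}"
proof (rule bij_betw_imageI)
  show "inj_on (nc_thick n :: _ \<Rightarrow> 'k rep set) (Nc (Suc n))"
  proof (rule inj_onI)
    fix P P' assume P: "P \<in> Nc (Suc n)" "P' \<in> Nc (Suc n)" and eq: "nc_thick n P = (nc_thick n P' :: 'k rep set)"
    then have "refines {1..Suc n} P P'" "refines {1..Suc n} P' P"
      using nc_cat_subset_iff[OF P(1,2), where ?'k = 'k] nc_cat_subset_iff[OF P(2,1), where ?'k = 'k]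
      unfolding nc_thick_eq[OF P(1)] nc_thick_eq[OF P(2)] by auto
    then show "P = P'" by (rule refines_asym)
  qed
  show "nc_thick n ` Nc (Suc n) = {C :: 'k rep set. thick n C}"
  proof (intro equalityI subsetI)
    fix C :: "'k rep set" assume "C \<in> nc_thick n ` Nc (Suc n)"
    then obtain P where "P \<in> Nc (Suc n)" "C = nc_thick n P" by blast
    then show "C \<in> {C. thick n C}" using nc_thick_eq[of P n, where ?'k = 'k] nc_cat_thick by simp
  next
    fix C :: "'k rep set" assume "C \<in> {C. thick n C}"
    then obtain P where "P \<in> Nc (Suc n)" "C = nc_cat n P" using thick_is_nc_cat by blast
    then show "C \<in> nc_thick n ` Nc (Suc n)" using nc_thick_eq by blast
  qed
qed

lemma nc_thick_less_iff:
  assumes P: "P \<in> Nc (Suc n)" "P' \<in> Nc (Suc n)"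
  shows "(nc_thick n P :: 'k::field rep set) \<subset> nc_thick n P' \<longleftrightarrow> nc_less (Suc n) P P'"
proof -
  have "(nc_thick n P :: 'k rep set) \<noteq> nc_thick n P' \<longleftrightarrow> P \<noteq> P'"
    using bij_betw_imp_inj_on[OF nc_thick_bij[of n, where ?'k = 'k]] P by (auto dest: inj_onD)
  then show ?thesis
    using nc_cat_subset_iff[OF P, where ?'k = 'k]
    unfolding nc_less_def nc_thick_eq[OF P(1)] nc_thick_eq[OF P(2)] by blast
qed

section \<open>Exceptional sequences of interval modules\<close>

text \<open>
  The indecomposable objects suffice for computing the perpendicular category.
\<close>

lemma perp_interval_iff:
  assumes C: "thick n C" and U: "is_rep n U"
  shows "U \<in> perp n C \<longleftrightarrow>
    (\<forall>a b. 1 \<le> a \<and> a < b \<and> b \<le> Suc n \<and> interval_mod a b \<in> C \<longrightarrow> bij_down U (a - 1) (b - 1))"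
proof
  assume "U \<in> perp n C"
  then show "\<forall>a b. 1 \<le> a \<and> a < b \<and> b \<le> Suc n \<and> interval_mod a b \<in> C \<longrightarrow> bij_down U (a - 1) (b - 1)"
    unfolding perp_def using hom_zero_interval[OF U] ext_zero_interval[OF U] by blast
next
  assume h: "\<forall>a b. 1 \<le> a \<and> a < b \<and> b \<le> Suc n \<and> interval_mod a b \<in> C \<longrightarrow> bij_down U (a - 1) (b - 1)"
  have "hom_zero n X U \<and> ext_zero n X U" if "X \<in> C" for X
    using C that
  proof (induction rule: thick_induct)
    case (zero X)
    then show ?case using hom_zero_zero ext_zero_zero by blast
  next
    case (interval X a b)
    then have "bij_down U (a - 1) (b - 1)" using h by blast
    then show ?case
      using interval hom_zero_interval[OF U] ext_zero_interval[OF U] hom_zero_iso ext_zero_iso by blast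
  next
    case (direct_sum X V W)
    then show ?case using hom_zero_direct_sum ext_zero_direct_sum by blast
  qed
  then show "U \<in> perp n C" unfolding perp_def using U by blast
qed

lemma interval_bij_down_compat:
  assumes "1 \<le> c" "1 \<le> a" "a < b" "b \<le> Suc n"
  shows "bij_down (interval_mod c d) (a - 1) (b - 1) \<longleftrightarrow> compat (c, d) (a, b)"
proof -
  have "c \<le> x - 1 \<and> x - 1 < d \<longleftrightarrow> c < x \<and> x \<le> d" if "1 \<le> x" for x using that by auto
  then have "compat (c, d) (a, b) \<longleftrightarrow> (c \<le> a - 1 \<and> a - 1 < d \<longleftrightarrow> c \<le> b - 1 \<and> b - 1 < d)"
    using assms unfolding compat_def by auto
  also have "\<dots> \<longleftrightarrow> bij_down (interval_mod c d) (a - 1) (b - 1)"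
    by (rule interval_bij_down[OF assms(1), symmetric, of _ _ n]) (use assms in auto)
  finally show ?thesis by (rule sym)
qed

abbreviation iso_interval :: "nat \<Rightarrow> 'k::field rep \<Rightarrow> nat \<times> nat \<Rightarrow> bool" where
  "iso_interval n X p \<equiv> iso n X (interval_mod (fst p) (snd p))"

lemma bij_down_iso_interval:
  assumes "iso_interval n X p" "1 \<le> fst p" "1 \<le> fst q" "fst q < snd q" "snd q \<le> Suc n"
  shows "bij_down X (fst q - 1) (snd q - 1) \<longleftrightarrow> compat p q"
  using iso_down[OF assms(1), of "fst q - 1" "snd q - 1"] interval_bij_down_compat[OF assms(2-5), of "snd p"] assms(3-5)
  by simp

lemma exceptional_pair_iff:
  assumes X: "iso_interval n X p" and Y: "iso_interval n Y q"
    and "1 \<le> fst p" "1 \<le> fst q" "fst q < snd q" "snd q \<le> Suc n"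
  shows "hom_zero n Y X \<and> ext_zero n Y X \<longleftrightarrow> compat p q"
  unfolding bij_down_iso_interval[OF X assms(3-6), symmetric]
  using hom_zero_iso[OF Y] ext_zero_iso[OF Y] hom_zero_interval[OF iso_rep(1)[OF X] assms(4-6)]
    ext_zero_interval[OF iso_rep(1)[OF X] assms(4-6)] by simp

text \<open>
  The vertex \<open>a - 1\<close> is outside the support of \<open>[a, b]\<close>, so there is nothing to be hit.
\<close>

lemma ext_zero_self:
  assumes "iso n X (interval_mod a b)" "1 \<le> a" "a < b" "b \<le> Suc n"
  shows "ext_zero n X X"
proof -
  have "surj_down (interval_mod a b :: 'a rep) (a - 1) (b - 1)"
    using assms interval_surj_down[of a "a - 1" "b - 1" n b, where ?'k = 'a] by auto
  then have "surj_down X (a - 1) (b - 1)" using iso_down(2)[OF assms(1), of "a - 1" "b - 1"] assms(2-4) by auto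
  then show ?thesis
    using ext_zero_iso[OF assms(1)] ext_zero_interval[OF iso_rep(1)[OF assms(1)] assms(2-4)] by blast
qed

lemma complete_exceptional_of_pairs:
  assumes ps: "ps \<in> exc_pairs n" and Xs: "list_all2 (iso_interval n) Xs ps"
  shows "complete_exceptional n Xs"
proof -
  have len: "length Xs = n" "length ps = n" using ps list_all2_lengthD[OF Xs] by (auto simp: exc_pairs_def)
  have iso: "iso_interval n (Xs ! i) (ps ! i)" if "i < n" for i using list_all2_nthD2[OF Xs] that len by simp
  have r: "1 \<le> fst (ps ! i)" "fst (ps ! i) < snd (ps ! i)" "snd (ps ! i) \<le> Suc n" if "i < n" for i
    using ps that nth_mem[of i ps] len unfolding exc_pairs_def compat_seq_def by blast+
  have c: "compat (ps ! j) (ps ! i)" if "j < i" "i < n" for i j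
    using ps that len unfolding exc_pairs_def compat_seq_def sorted_wrt_iff_nth_less by blast
  have pair: "hom_zero n (Xs ! i) (Xs ! j) \<and> ext_zero n (Xs ! i) (Xs ! j)" if "j < i" "i < n" for i j
  proof -
    have j: "j < n" using that by simp
    show ?thesis using exceptional_pair_iff[OF iso[OF j] iso[OF that(2)] r(1)[OF j] r[OF that(2)]] c[OF that] by blast
  qed
  show ?thesis
    unfolding complete_exceptional_def
  proof (intro conjI allI impI)
    fix i assume i: "i < n"
    show "indecomposable n (Xs ! i)" by (rule interval_indecomposable[OF iso[OF i] r[OF i]])
    fix j
    show "hom_zero n (Xs ! i) (Xs ! j)" if "j < i" using pair[OF that i] by blast
    show "ext_zero n (Xs ! i) (Xs ! j)" if "j \<le> i"
      using that pair[OF _ i] ext_zero_self[OF iso[OF i] r[OF i]] by (cases "j = i") auto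
  qed (use len in simp)
qed

lemma complete_exceptional_pairs:
  assumes Xs: "complete_exceptional n Xs"
  obtains ps where "ps \<in> exc_pairs n" "list_all2 (iso_interval n) Xs ps"
proof -
  have len: "length Xs = n" using Xs by (simp add: complete_exceptional_def)
  have "\<exists>p. 1 \<le> fst p \<and> fst p < snd p \<and> snd p \<le> Suc n \<and> iso_interval n (Xs ! i) p" if "i < n" for i
  proof -
    have "indecomposable n (Xs ! i)" using Xs that by (simp add: complete_exceptional_def)
    then obtain a b where "1 \<le> a" "a < b" "b \<le> Suc n" "iso n (Xs ! i) (interval_mod a b)" by (rule indecomposable_interval)
    then show ?thesis by (intro exI[of _ "(a, b)"]) simp
  qed
  then obtain f where f: "\<And>i. i < n \<Longrightarrow> 1 \<le> fst (f i) \<and> fst (f i) < snd (f i) \<and> snd (f i) \<le> Suc n \<and> iso_interval n (Xs ! i) (f i)"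
    by metis
  have "compat (f j) (f i)" if ji: "j < i" "i < n" for i j
  proof -
    have j: "j < n" using ji by simp
    have "hom_zero n (Xs ! i) (Xs ! j) \<and> ext_zero n (Xs ! i) (Xs ! j)"
      using Xs ji unfolding complete_exceptional_def by simp
    then show ?thesis using exceptional_pair_iff[of n "Xs ! j" "f j" "Xs ! i" "f i"] f[OF j] f[OF ji(2)] by blast
  qed
  then have "map f [0..<n] \<in> exc_pairs n"
    using f unfolding exc_pairs_def compat_seq_def sorted_wrt_iff_nth_less by auto
  moreover have "list_all2 (iso_interval n) Xs (map f [0..<n])"
    using f len by (simp add: list_all2_conv_all_nth)
  ultimately show thesis by (rule that)
qed

lemma soc_seq_pairs:
  assumes "ps \<in> exc_pairs n" "list_all2 (iso_interval n) Xs ps"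
  shows "soc_seq n Xs = map fst ps"
proof -
  have "length Xs = length ps" using assms(2) by (rule list_all2_lengthD)
  moreover have "soc_index n (Xs ! i) = fst (ps ! i)" if i: "i < length ps" for i
  proof (rule soc_index_interval)
    show "iso_interval n (Xs ! i) (ps ! i)" using list_all2_nthD2[OF assms(2) i] .
    show "1 \<le> fst (ps ! i)" "fst (ps ! i) < snd (ps ! i)" "snd (ps ! i) \<le> Suc n"
      using assms(1) nth_mem[OF i] unfolding exc_pairs_def compat_seq_def by blast+
  qed
  ultimately show ?thesis unfolding soc_seq_def by (intro nth_equalityI) auto
qed

section \<open>Maximal chains\<close>

lemma max_chains_subset: "cs \<in> max_chains Q lt \<Longrightarrow> set cs \<subseteq> Q"
  unfolding max_chains_def pred_on.maxchain_def pred_on.chain_def by blast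

text \<open>
  The form in which maximality is used: whatever is comparable with all members is itself a member.
\<close>

lemma max_chains_member:
  assumes cs: "cs \<in> max_chains Q lt" and x: "x \<in> Q" and comp: "\<And>y. y \<in> set cs \<Longrightarrow> x = y \<or> lt x y \<or> lt y x"
  shows "x \<in> set cs"
proof (rule ccontr)
  assume nx: "x \<notin> set cs"
  have max: "pred_on.maxchain Q lt (set cs)" using cs by (simp add: max_chains_def)
  then have "pred_on.chain Q lt (set cs)" by (simp add: pred_on.maxchain_def)
  then have "pred_on.chain Q lt (insert x (set cs))"
    using x comp unfolding pred_on.chain_def by auto
  moreover have "set cs \<subset> insert x (set cs)" using nx by blast
  ultimately show False using max unfolding pred_on.maxchain_def by blast
qed

lemma max_chains_map:
  assumes f: "bij_betw f Q Q'" and lt: "\<And>x y. x \<in> Q \<Longrightarrow> y \<in> Q \<Longrightarrow> lt' (f x) (f y) \<longleftrightarrow> lt x y"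
    and cs: "cs \<in> max_chains Q lt"
  shows "map f cs \<in> max_chains Q' lt'"
proof -
  have sorted: "sorted_wrt lt cs" and max: "pred_on.maxchain Q lt (set cs)" using cs by (auto simp: max_chains_def)
  have sub: "set cs \<subseteq> Q" by (rule max_chains_subset[OF cs])
  have inj: "inj_on f Q" and im: "f ` Q = Q'" using f by (auto simp: bij_betw_def)
  have comp: "(lt' (f x) (f y) \<or> f x = f y) \<longleftrightarrow> (lt x y \<or> x = y)" if "x \<in> Q" "y \<in> Q" for x y
    using lt[OF that] inj_on_eq_iff[OF inj that] by simp
  have "sorted_wrt lt' (map f cs)"
    unfolding sorted_wrt_map using sorted
    by (rule sorted_wrt_mono_rel[rotated]) (use lt sub in blast)
  moreover have "pred_on.maxchain Q' lt' (f ` set cs)"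
    unfolding pred_on.maxchain_def
  proof (intro conjI notI)
    show "pred_on.chain Q' lt' (f ` set cs)"
      unfolding pred_on.chain_def
    proof (intro conjI ballI)
      show "f ` set cs \<subseteq> Q'" using sub im by blast
      fix x y assume "x \<in> f ` set cs" "y \<in> f ` set cs"
      then obtain u v where uv: "u \<in> set cs" "x = f u" "v \<in> set cs" "y = f v" by blast
      have "(lt u v \<or> u = v) \<or> (lt v u \<or> v = u)"
        using max uv unfolding pred_on.maxchain_def pred_on.chain_def by auto
      then show "lt'\<^sup>=\<^sup>= x y \<or> lt'\<^sup>=\<^sup>= y x"
        using comp[of u v] comp[of v u] sub uv by auto
    qed
    assume "\<exists>S. pred_on.chain Q' lt' S \<and> f ` set cs \<subset> S"
    then obtain S where S: "pred_on.chain Q' lt' S" "f ` set cs \<subset> S" by blast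
    define T where "T = {x \<in> Q. f x \<in> S}"
    have SQ: "S \<subseteq> f ` Q" using S(1) im by (simp add: pred_on.chain_def)
    have "pred_on.chain Q lt T"
      unfolding pred_on.chain_def
    proof (intro conjI ballI)
      show "T \<subseteq> Q" unfolding T_def by blast
      fix x y assume "x \<in> T" "y \<in> T"
      then have xy: "x \<in> Q" "f x \<in> S" "y \<in> Q" "f y \<in> S" by (auto simp: T_def)
      have "(lt' (f x) (f y) \<or> f x = f y) \<or> (lt' (f y) (f x) \<or> f y = f x)"
        using S(1) xy unfolding pred_on.chain_def by auto
      then show "lt\<^sup>=\<^sup>= x y \<or> lt\<^sup>=\<^sup>= y x"
        unfolding comp[OF xy(1,3)] comp[OF xy(3,1)] by auto
    qed
    moreover have "set cs \<subseteq> T" using S(2) sub unfolding T_def by blast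
    moreover have "set cs \<noteq> T"
    proof
      assume eq: "set cs = T"
      have "S \<subseteq> f ` T" using SQ unfolding T_def by blast
      then show False using S(2) eq by blast
    qed
    ultimately show False using max unfolding pred_on.maxchain_def by blast
  qed
  ultimately show ?thesis by (simp add: max_chains_def)
qed

lemma max_chains_image:
  assumes f: "bij_betw f Q Q'" and lt: "\<And>x y. x \<in> Q \<Longrightarrow> y \<in> Q \<Longrightarrow> lt' (f x) (f y) \<longleftrightarrow> lt x y"
  shows "max_chains Q' lt' = map f ` max_chains Q lt"
proof (intro equalityI subsetI)
  fix cs assume cs: "cs \<in> max_chains Q' lt'"
  let ?g = "the_inv_into Q f"
  have g: "bij_betw ?g Q' Q" by (rule bij_betw_the_inv_into[OF f])
  have fg: "f (?g y) = y" if "y \<in> Q'" for y using f_the_inv_into_f_bij_betw[OF f] that by blast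
  have gQ: "?g y \<in> Q" if "y \<in> Q'" for y using bij_betwE[OF g] that by blast
  have "lt (?g x) (?g y) \<longleftrightarrow> lt' x y" if "x \<in> Q'" "y \<in> Q'" for x y
    using lt[OF gQ[OF that(1)] gQ[OF that(2)]] fg[OF that(1)] fg[OF that(2)] by simp
  then have "map ?g cs \<in> max_chains Q lt" by (rule max_chains_map[OF g _ cs])
  moreover have "cs = map f (map ?g cs)" using max_chains_subset[OF cs] fg by (auto intro!: map_idI[symmetric])
  ultimately show "cs \<in> map f ` max_chains Q lt" by (rule image_eqI[rotated])
next
  fix cs assume "cs \<in> map f ` max_chains Q lt"
  then obtain cs' where "cs' \<in> max_chains Q lt" "cs = map f cs'" by blast
  then show "cs \<in> max_chains Q' lt'" using max_chains_map[of f Q Q' lt' lt cs'] f lt by blast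
qed

section \<open>Neighbours in the lattice of non-crossing partitions\<close>

definition merge :: "nat set \<Rightarrow> nat set \<Rightarrow> nat set set \<Rightarrow> nat set set" where
  "merge A B P = P - {A, B} \<union> {A \<union> B}"

definition covers :: "nat set set \<Rightarrow> nat set set \<Rightarrow> bool" where
  "covers P P' \<longleftrightarrow> (\<exists>A\<in>P. \<exists>B\<in>P. Min A < Min B \<and> P' = merge A B P)"

lemma same_part_merge:
  assumes P: "partition_on S P" and A: "A \<in> P" and B: "B \<in> P"
  shows "same_part (merge A B P) a b \<longleftrightarrow> same_part P a b \<or> (a \<in> A \<union> B \<and> b \<in> A \<union> B)"
proof
  assume "same_part (merge A B P) a b"
  then obtain D where "D \<in> merge A B P" "a \<in> D" "b \<in> D" unfolding same_part_def by blast
  then show "same_part P a b \<or> (a \<in> A \<union> B \<and> b \<in> A \<union> B)" unfolding same_part_def merge_def by auto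
next
  have M: "same_part (merge A B P) a b" if "a \<in> A \<union> B" "b \<in> A \<union> B"
    unfolding same_part_def by (rule bexI[of _ "A \<union> B"]) (use that in \<open>auto simp: merge_def\<close>)
  assume "same_part P a b \<or> (a \<in> A \<union> B \<and> b \<in> A \<union> B)"
  then show "same_part (merge A B P) a b"
  proof
    assume "same_part P a b"
    then obtain D where D: "D \<in> P" "a \<in> D" "b \<in> D" unfolding same_part_def by blast
    show ?thesis
    proof (cases "D = A \<or> D = B")
      case False
      then have "D \<in> merge A B P" using D(1) by (simp add: merge_def)
      then show ?thesis using D unfolding same_part_def by blast
    qed (use D M in blast)
  qed (use M in blast)
qed

lemma partition_merge:
  assumes P: "partition_on S P" and A: "A \<in> P" and B: "B \<in> P"
  shows "partition_on S (merge A B P)"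
proof (rule partition_onI)
  show "\<Union> (merge A B P) = S" using partition_onD1[OF P] A B unfolding merge_def by blast
  show "{} \<notin> merge A B P" using partition_onD3[OF P] A unfolding merge_def by auto
  fix p q assume pq: "p \<in> merge A B P" "q \<in> merge A B P" "p \<noteq> q"
  have d: "X \<inter> Y = {}" if "X \<in> P" "Y \<in> P" "X \<noteq> Y" for X Y using partition_onD2[OF P] that by (auto simp: disjoint_def)
  show "disjnt p q" using pq d A B unfolding merge_def disjnt_def by blast
qed

lemma partition_finite: "partition_on {1..m::nat} P \<Longrightarrow> finite P \<and> (\<forall>B\<in>P. finite B \<and> B \<noteq> {} \<and> B \<subseteq> {1..m})"
proof -
  assume P: "partition_on {1..m} P"
  have sub: "B \<subseteq> {1..m}" if "B \<in> P" for B using partition_onD1[OF P] that by blast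
  then have "P \<subseteq> Pow {1..m}" by blast
  then have "finite P" by (rule finite_subset) simp
  then show ?thesis using sub partition_onD3[OF P] finite_subset[OF sub] by blast
qed

lemma card_merge:
  assumes P: "partition_on {1..m} P" and A: "A \<in> P" and B: "B \<in> P" and "A \<noteq> B"
  shows "Suc (card (merge A B P)) = card P"
proof -
  note fin = partition_finite[OF P]
  have "A \<inter> B = {}" using partition_onD2[OF P] A B assms(4) by (auto simp: disjoint_def)
  then have "A \<union> B \<noteq> A" "A \<union> B \<noteq> B" using fin A B by blast+
  moreover have "A \<union> B \<in> P \<Longrightarrow> A \<union> B = A" using part_unique[OF P _ A] fin A by blast
  ultimately have "A \<union> B \<notin> P" by blast
  then have "card (merge A B P) = Suc (card (P - {A, B}))" unfolding merge_def using fin by simp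
  moreover have "card (P - {A, B}) = card P - 2" using A B assms(4) fin by (simp add: card_Diff_subset)
  moreover have "card {A, B} \<le> card P" using A B fin by (intro card_mono) auto
  ultimately show ?thesis using assms(4) by simp
qed

text \<open>
  Let \<open>C\<close> be a part of \<open>P'\<close> that is not a part of \<open>P\<close>, let \<open>A\<close> be the part of \<open>P\<close> that contains
  \<open>x = Min C\<close>, and \<open>B\<close> the part that contains the smallest element \<open>y\<close> of \<open>C - A\<close>. All other elements
  of \<open>C\<close> outside \<open>A\<close> and \<open>B\<close> are larger than \<open>x\<close> and \<open>y\<close>. Hence a part that crosses the union of \<open>A\<close> and
  \<open>B\<close> already crosses \<open>A\<close> or \<open>B\<close>: one of the points of the crossing may be replaced by \<open>x\<close> or \<open>y\<close>.
\<close>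

lemma covering_exists:
  assumes P: "P \<in> Nc m" and P': "P' \<in> Nc m" and less: "nc_less m P P'"
  obtains Q where "Q \<in> Nc m" "covers P Q" "refines {1..m} Q P'"
proof -
  note part = Nc_partition[OF P] and part' = Nc_partition[OF P']
  have ref: "\<And>a b. same_part P a b \<Longrightarrow> same_part P' a b"
    using less refines_iff_same_part[OF part part'] by (simp add: nc_less_def)
  have "\<not> refines {1..m} P' P" using less refines_asym unfolding nc_less_def by blast
  then obtain a b where ab: "same_part P' a b" "\<not> same_part P a b"
    using refines_iff_same_part[OF part' part] by blast
  obtain C where C: "C \<in> P'" "a \<in> C" "b \<in> C" using ab(1) unfolding same_part_def by blast
  have finC: "finite C" "C \<subseteq> {1..m}" using partition_finite[OF part'] C(1) by blast+
  define x where "x = Min C"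
  have x: "x \<in> C" "\<And>z. z \<in> C \<Longrightarrow> x \<le> z" unfolding x_def using Min_in[OF finC(1)] Min_le[OF finC(1)] C(2) by blast+
  obtain A where A: "A \<in> P" "x \<in> A" using same_part_refl[OF part] x(1) finC(2) unfolding same_part_def by blast
  have sub: "Y \<subseteq> C" if "Y \<in> P" "z \<in> Y" "z \<in> C" for Y z
    using ref part_eq_same_part[OF part' C(1) that(3)] part_eq_same_part[OF part that(1,2)] by blast
  have AC: "A \<subseteq> C" by (rule sub[OF A x(1)])
  have "\<not> C \<subseteq> A" using ab(2) C A(1) unfolding same_part_def by blast
  define y where "y = Min (C - A)"
  have "y \<in> C - A" unfolding y_def using finC \<open>\<not> C \<subseteq> A\<close> by (intro Min_in) auto
  then have y: "y \<in> C" "y \<notin> A" by auto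
  have ymin: "y \<le> z" if "z \<in> C" "z \<notin> A" for z unfolding y_def using that finC by (intro Min_le) auto
  obtain B where B: "B \<in> P" "y \<in> B" using same_part_refl[OF part] y(1) finC(2) unfolding same_part_def by blast
  have BC: "B \<subseteq> C" by (rule sub[OF B y(1)])
  have xy: "x < y" using x(2)[OF y(1)] A(2) y(2) by (cases "x = y") auto
  have AB: "z \<notin> A" if "z \<in> B" for z using part_unique[OF part A(1) B(1) _ that] y(2) B(2) by blast
  have finA: "finite A" "finite B" using partition_finite[OF part] A B by blast+
  have "Min A = x" using A finA AC x(2) by (intro Min_eqI) auto
  moreover have "Min B = y" using B finA BC ymin AB by (intro Min_eqI) auto
  ultimately have min: "Min A < Min B" using xy by simp
  let ?Q = "merge A B P"
  let ?M = "A \<union> B"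
  note Q = partition_merge[OF part A(1) B(1)]
  note spQ = same_part_merge[OF part A(1) B(1)]
  have M: "\<exists>e. e \<in> {x, y} \<and> same_part P e z" if "z \<in> ?M" for z
    using that A B unfolding same_part_def by blast
  have M': "z \<in> ?M" if "same_part P e z" "e \<in> {x, y}" for e z
    using that part_eq_same_part[OF part A] part_eq_same_part[OF part B] by blast
  have MC: "same_part P' u v" if "u \<in> ?M" "v \<in> ?M" for u v
    using that AC BC C(1) unfolding same_part_def by blast
  have CP: "z \<in> C" if "same_part P' u z" "u \<in> ?M" for u z
    using that AC BC part_eq_same_part[OF part' C(1), of u z] by blast
  have beyond: "e < z" if "z \<in> C" "z \<notin> ?M" "e \<in> {x, y}" for e z
    using ymin[of z] that B(2) xy by (cases "y = z") auto
  have "noncrossing ?Q"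
    unfolding noncrossing_def same_part_def[symmetric]
  proof (intro allI impI, elim conjE)
    fix i i' j j' assume lt: "i < i'" "i' < j" "j < j'" and s: "same_part ?Q i j" "same_part ?Q i' j'"
    have "same_part ?Q i i'"
    proof (cases "same_part P i j")
      case ij: True
      show ?thesis
      proof (cases "same_part P i' j'")
        case True
        then show ?thesis using Nc_crossing[OF P lt ij] spQ by blast
      next
        case False
        then have m: "i' \<in> ?M" "j' \<in> ?M" using s(2) spQ by auto
        have "i \<in> ?M"
        proof (rule ccontr)
          assume ni: "i \<notin> ?M"
          have "same_part P' i' i"
            using Nc_crossing[OF P' lt ref[OF ij] MC[OF m]] by (rule same_part_sym)
          then have "i \<in> C" using m(1) by (rule CP)
          obtain e where e: "e \<in> {x, y}" "same_part P e i'" using M[OF m(1)] by blast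
          have "same_part P e i" using Nc_crossing[OF P beyond[OF \<open>i \<in> C\<close> ni e(1)] lt(1,2) e(2) ij] .
          then show False using M' e(1) ni by blast
        qed
        then show ?thesis using m spQ by blast
      qed
    next
      case False
      then have m: "i \<in> ?M" "j \<in> ?M" using s(1) spQ by auto
      have "i' \<in> ?M"
      proof (rule ccontr)
        assume ni: "i' \<notin> ?M"
        then have ij': "same_part P i' j'" using s(2) spQ by blast
        have "same_part P' i i'" using Nc_crossing[OF P' lt MC[OF m] ref[OF ij']] .
        then have "i' \<in> C" using m(1) by (rule CP)
        obtain e where e: "e \<in> {x, y}" "same_part P e j" using M[OF m(2)] by blast
        have "same_part P e i'" using Nc_crossing[OF P beyond[OF \<open>i' \<in> C\<close> ni e(1)] lt(2,3) e(2) ij'] .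
        then show False using M' e(1) ni by blast
      qed
      then show ?thesis using m spQ by blast
    qed
    then obtain D where D: "D \<in> ?Q" "i \<in> D" "i' \<in> D" unfolding same_part_def by blast
    then have "j \<in> D" "j' \<in> D" using s part_eq_same_part[OF Q D(1)] by blast+
    then show "\<exists>B\<in>?Q. {i, i', j, j'} \<subseteq> B" using D by blast
  qed
  then have "?Q \<in> Nc m" using Q by (simp add: Nc_def)
  moreover have "covers P ?Q" unfolding covers_def using A B min by blast
  moreover have "refines {1..m} ?Q P'"
    unfolding refines_iff_same_part[OF Q part'] spQ using ref MC by blast
  ultimately show thesis by (rule that)
qed

lemma nc_less_trans: "nc_less m P Q \<Longrightarrow> nc_less m Q R \<Longrightarrow> nc_less m P R"
  unfolding nc_less_def using refines_trans refines_asym by metis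

lemma covers_less:
  assumes P: "P \<in> Nc m" and cov: "covers P Q"
  shows "nc_less m P Q" "Suc (card Q) = card P"
proof -
  note part = Nc_partition[OF P]
  obtain A B where AB: "A \<in> P" "B \<in> P" "Min A < Min B" "Q = merge A B P" using cov unfolding covers_def by blast
  then show c: "Suc (card Q) = card P" using card_merge[OF part] by auto
  have "refines {1..m} P Q"
    unfolding AB(4) refines_iff_same_part[OF part partition_merge[OF part AB(1,2)]] same_part_merge[OF part AB(1,2)] by blast
  then show "nc_less m P Q" using c unfolding nc_less_def by auto
qed

lemma nc_chain_nth:
  assumes Ps: "Ps \<in> nc_chains m"
  shows "i < length Ps \<Longrightarrow> Ps ! i \<in> Nc m" "i < j \<Longrightarrow> j < length Ps \<Longrightarrow> nc_less m (Ps ! i) (Ps ! j)"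
    "i \<le> j \<Longrightarrow> j < length Ps \<Longrightarrow> refines {1..m} (Ps ! i) (Ps ! j)"
proof -
  show N: "i < length Ps \<Longrightarrow> Ps ! i \<in> Nc m" for i using max_chains_subset[OF Ps] by auto
  have "sorted_wrt (nc_less m) Ps" using Ps by (simp add: max_chains_def)
  then show L: "i < j \<Longrightarrow> j < length Ps \<Longrightarrow> nc_less m (Ps ! i) (Ps ! j)" for i j
    by (simp add: sorted_wrt_iff_nth_less)
  show "i \<le> j \<Longrightarrow> j < length Ps \<Longrightarrow> refines {1..m} (Ps ! i) (Ps ! j)"
    using L[of i j] refines_refl[OF Nc_partition[OF N[of j]]] by (cases "i = j") (auto simp: nc_less_def)
qed

text \<open>
  A step that is not a cover would leave room for a further element of the chain.
\<close>

lemma nc_chain_covers: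
  assumes Ps: "Ps \<in> nc_chains m" and i: "Suc i < length Ps"
  shows "covers (Ps ! i) (Ps ! Suc i)"
proof -
  note N = nc_chain_nth(1)[OF Ps] and L = nc_chain_nth(2)[OF Ps]
  have "nc_less m (Ps ! i) (Ps ! Suc i)" using L[of i "Suc i"] i by simp
  then obtain Q where Q: "Q \<in> Nc m" "covers (Ps ! i) Q" "refines {1..m} Q (Ps ! Suc i)"
    using covering_exists[OF N[of i] N[of "Suc i"]] i by auto
  have iQ: "nc_less m (Ps ! i) Q" by (rule covers_less[OF N Q(2)]) (use i in simp)
  have QS: "Q = Ps ! Suc i \<or> nc_less m Q (Ps ! Suc i)" using Q(3) by (auto simp: nc_less_def)
  have below: "nc_less m (Ps ! k) Q" if "k \<le> i" for k
    using that iQ L[of k i] i nc_less_trans by (cases "k = i") auto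
  have above: "Q = Ps ! k \<or> nc_less m Q (Ps ! k)" if "Suc i \<le> k" "k < length Ps" for k
    using that QS L[of "Suc i" k] nc_less_trans by (cases "k = Suc i") auto
  have "Q \<in> set Ps"
  proof (rule max_chains_member[OF Ps Q(1)])
    fix y assume "y \<in> set Ps"
    then obtain k where "k < length Ps" "y = Ps ! k" by (auto simp: in_set_conv_nth)
    then show "Q = y \<or> nc_less m Q y \<or> nc_less m y Q" using below[of k] above[of k] by (cases "k \<le> i") auto
  qed
  then obtain k where k: "k < length Ps" "Q = Ps ! k" by (auto simp: in_set_conv_nth)
  have "\<not> k \<le> i" using below[of k] k(2) by (auto simp: nc_less_def)
  moreover have "\<not> Suc i < k"
  proof
    assume "Suc i < k"
    then have "nc_less m (Ps ! Suc i) Q" using L k by blast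
    then show False using Q(3) refines_asym unfolding nc_less_def by blast
  qed
  ultimately have "k = Suc i" by simp
  then show ?thesis using Q(2) k(2) by simp
qed

text \<open>
  The chain starts with the partition into singletons and ends with the one-part partition, and every step
  lowers the number of parts by one.
\<close>

lemma nc_chain_length:
  assumes Ps: "Ps \<in> nc_chains m" and m: "1 \<le> m"
  shows "length Ps = m"
proof -
  note N = nc_chain_nth(1)[OF Ps] and L = nc_chain_nth(2)[OF Ps]
  let ?D = "(\<lambda>x. {x}) ` {1..m}" and ?T = "{{1..m}}"
  have D: "partition_on {1..m} ?D" by (rule partition_on_singletons)
  have T: "partition_on {1..m} ?T" by (rule partition_on_space) (use m in auto)
  have spD: "same_part ?D a b \<longleftrightarrow> a \<in> {1..m} \<and> a = b" for a b unfolding same_part_def by auto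
  have spT: "same_part ?T a b \<longleftrightarrow> a \<in> {1..m} \<and> b \<in> {1..m}" for a b unfolding same_part_def by auto
  have DN: "?D \<in> Nc m" unfolding Nc_def noncrossing_def same_part_def[symmetric] using D by (simp add: spD)
  have TN: "?T \<in> Nc m" unfolding Nc_def noncrossing_def using T by auto
  have Dle: "refines {1..m} ?D P" if "P \<in> Nc m" for P
    unfolding refines_iff_same_part[OF D Nc_partition[OF that]] spD using same_part_refl[OF Nc_partition[OF that]] by blast
  have Tge: "refines {1..m} P ?T" if "P \<in> Nc m" for P
    unfolding refines_iff_same_part[OF Nc_partition[OF that] T] spT using same_part_in[OF Nc_partition[OF that]] by blast
  have "?D \<in> set Ps" using max_chains_member[OF Ps DN] Dle max_chains_subset[OF Ps] unfolding nc_less_def by blast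
  then obtain d where d: "d < length Ps" "Ps ! d = ?D" by (auto simp: in_set_conv_nth)
  have "d = 0"
  proof (rule ccontr)
    assume "d \<noteq> 0"
    then have "nc_less m (Ps ! 0) ?D" using L[of 0 d] d by simp
    moreover have "refines {1..m} ?D (Ps ! 0)" by (rule Dle[OF N]) (use d in auto)
    ultimately show False using refines_asym unfolding nc_less_def by blast
  qed
  have "?T \<in> set Ps" using max_chains_member[OF Ps TN] Tge max_chains_subset[OF Ps] unfolding nc_less_def by blast
  then obtain t where t: "t < length Ps" "Ps ! t = ?T" by (auto simp: in_set_conv_nth)
  have "Suc t = length Ps"
  proof (rule ccontr)
    assume "Suc t \<noteq> length Ps"
    then have "Suc t < length Ps" using t by simp
    then have "nc_less m ?T (Ps ! Suc t)" "Ps ! Suc t \<in> Nc m" using L[of t "Suc t"] t N by simp_all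
    then show False using Tge refines_asym unfolding nc_less_def by blast
  qed
  have card: "i < length Ps \<Longrightarrow> card (Ps ! i) + i = m" for i
  proof (induction i)
    case 0
    have "inj_on (\<lambda>x. {x}) {1..m}" by (auto intro: inj_onI)
    then show ?case using d \<open>d = 0\<close> by (simp add: card_image)
  next
    case (Suc i)
    have "Suc (card (Ps ! Suc i)) = card (Ps ! i)"
      by (rule covers_less(2)[OF N nc_chain_covers[OF Ps Suc.prems]]) (use Suc.prems in simp)
    then show ?case using Suc by simp
  qed
  show ?thesis using card[OF t(1)] t(2) \<open>Suc t = length Ps\<close> by simp
qed

text \<open>
  The two merged parts can be recovered as the parts of \<open>P\<close> that disappear.
\<close>

lemma stanley_label_merge:
  assumes P: "partition_on S P" and AB: "A \<in> P" "B \<in> P" "Min A < Min B"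
  shows "stanley_label P (merge A B P) = Max {x\<in>A. \<forall>y\<in>B. x < y}"
  unfolding stanley_label_def
proof (rule the_equality)
  show "\<exists>Pi\<in>P. \<exists>Pj\<in>P. Min Pi < Min Pj \<and> merge A B P = P - {Pi, Pj} \<union> {Pi \<union> Pj} \<and>
      Max {x\<in>A. \<forall>y\<in>B. x < y} = Max {x\<in>Pi. \<forall>y\<in>Pj. x < y}"
    using AB unfolding merge_def by blast
  have removed: "P - merge X Y P = {X, Y}" if "X \<in> P" "Y \<in> P" "X \<noteq> Y" for X Y
  proof -
    have "X \<inter> Y = {}" using partition_onD2[OF P] that by (auto simp: disjoint_def)
    moreover have "X \<noteq> {}" "Y \<noteq> {}" using partition_onD3[OF P] that by auto
    ultimately have "X \<union> Y \<noteq> X" "X \<union> Y \<noteq> Y" by blast+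
    moreover have "X \<union> Y \<notin> P - {X, Y}"
      using part_unique[OF P _ that(1)] \<open>X \<noteq> {}\<close> by blast
    ultimately show ?thesis using that unfolding merge_def by blast
  qed
  fix k assume "\<exists>Pi\<in>P. \<exists>Pj\<in>P. Min Pi < Min Pj \<and> merge A B P = P - {Pi, Pj} \<union> {Pi \<union> Pj} \<and>
      k = Max {x\<in>Pi. \<forall>y\<in>Pj. x < y}"
  then obtain Pi Pj where p: "Pi \<in> P" "Pj \<in> P" "Min Pi < Min Pj" "merge A B P = merge Pi Pj P"
      "k = Max {x\<in>Pi. \<forall>y\<in>Pj. x < y}" unfolding merge_def by blast
  have "{A, B} = {Pi, Pj}"
    using removed[OF p(1,2)] removed[OF AB(1,2)] p(3,4) AB(3) by auto
  then have "Pi = A \<and> Pj = B" using p(3) AB(3) by (auto simp: doubleton_eq_iff)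
  then show "k = Max {x\<in>A. \<forall>y\<in>B. x < y}" using p(5) by simp
qed

text \<open>
  Compatibility with the chords of \<open>P\<close> means that every part of \<open>P\<close> is contained in \<open>{c + 1..d}\<close> or
  disjoint from it. As \<open>c\<close> is outside and \<open>d\<close> inside, they lie in different ones of the merged parts
  \<open>A\<close>, \<open>B\<close>. It is \<open>B\<close> that is inside, since \<open>A\<close> has the smaller minimum; so \<open>d = Max B\<close>, and
  \<open>c\<close> is the last element of \<open>A\<close> before \<open>B\<close>.
\<close>

lemma covers_interval:
  assumes P: "P \<in> Nc m" and P': "P' \<in> Nc m" and cov: "covers P P'"
  defines "k \<equiv> stanley_label P P'"
  obtains d where "k < d" "same_part P' k d" "\<And>a b. same_part P a b \<Longrightarrow> a < b \<Longrightarrow> compat (k, d) (a, b)"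
    "\<And>c d'. c < d' \<Longrightarrow> same_part P' c d' \<Longrightarrow> (\<And>a b. same_part P a b \<Longrightarrow> a < b \<Longrightarrow> compat (c, d') (a, b)) \<Longrightarrow> c = k \<and> d' = d"
proof -
  note part = Nc_partition[OF P] and part' = Nc_partition[OF P']
  obtain A B where A: "A \<in> P" and B: "B \<in> P" and min: "Min A < Min B" and P'eq: "P' = merge A B P"
    using cov unfolding covers_def by blast
  note sp' = same_part_merge[OF part A B, folded P'eq]
  have fin: "finite A" "finite B" "A \<noteq> {}" "B \<noteq> {}" using partition_finite[OF part] A B by auto
  have disj: "z \<notin> B" if "z \<in> A" for z using part_unique[OF part A B that] min by auto
  have spA: "same_part P p q" if "p \<in> A" "q \<in> A" for p q using that A unfolding same_part_def by blast
  have spB: "same_part P p q" if "p \<in> B" "q \<in> B" for p q using that B unfolding same_part_def by blast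
  have inA: "q \<in> A" if "same_part P p q" "p \<in> A" for p q using that part_eq_same_part[OF part A] by blast
  have inB: "q \<in> B" if "same_part P p q" "p \<in> B" for p q using that part_eq_same_part[OF part B] by blast
  let ?K = "{x\<in>A. \<forall>y\<in>B. x < y}"
  have k_def': "k = Max ?K" unfolding k_def P'eq by (rule stanley_label_merge[OF part A B min])
  have "Min A \<in> ?K" using Min_in[OF fin(1,3)] min Min_le[OF fin(2)] by (auto intro: less_le_trans)
  then have "k \<in> ?K" unfolding k_def' using fin(1) by (intro Max_in) auto
  then have k: "k \<in> A" "\<And>y. y \<in> B \<Longrightarrow> k < y" by auto
  have kmax: "z \<le> k" if "z \<in> A" "\<And>y. y \<in> B \<Longrightarrow> z < y" for z
    unfolding k_def' using that fin(1) by (intro Max_ge) auto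
  define d where "d = Max B"
  have d: "d \<in> B" "\<And>y. y \<in> B \<Longrightarrow> y \<le> d" unfolding d_def using fin by auto
  have kd: "k < d" by (rule k(2)[OF d(1)])
  have s': "same_part P' k d" using sp' k(1) d(1) by blast
  have outA: "\<not> (k < z \<and> z \<le> d)" if z: "z \<in> A" for z
  proof
    assume kz: "k < z \<and> z \<le> d"
    then obtain y where y: "y \<in> B" "y \<le> z" using kmax[OF z] by fastforce
    have "y < z" using y disj[OF z] by (cases "y = z") auto
    moreover have "z < d" using kz d(1) disj[OF z] by (cases "z = d") auto
    ultimately have "same_part P k y" using Nc_crossing[OF P k(2)[OF y(1)] _ _ spA[OF k(1) z] spB[OF y(1) d(1)]] by blast
    then show False using inA k(1) disj y(1) by blast
  qed
  have inside: "k < a \<and> a \<le> d \<longleftrightarrow> k < b \<and> b \<le> d" if ab: "same_part P a b" for a b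
  proof -
    consider "a \<in> A" | "a \<in> B" | "a \<notin> A \<union> B" by blast
    then show ?thesis
    proof cases
      case 1
      then show ?thesis using outA[OF 1] outA[OF inA[OF ab 1]] by blast
    next
      case 2
      then show ?thesis using k(2) d(2) inB[OF ab 2] by blast
    next
      case 3
      have b: "b \<notin> A \<union> B" using 3 inA[OF same_part_sym[OF ab]] inB[OF same_part_sym[OF ab]] by blast
      have "same_part P' a b" "\<not> same_part P' a k" using sp' ab 3 inA[OF same_part_sym] k(1) by blast+
      then have "k < a \<and> a < d \<longleftrightarrow> k < b \<and> b < d" using Nc_side[OF P' _ s'] by blast
      then show ?thesis using 3 b d(1) by (auto simp: le_less)
    qed
  qed
  show thesis
  proof (rule that[OF kd s'])
    fix a b assume "same_part P a b"
    from inside[OF this] show "compat (k, d) (a, b)" unfolding compat_def by auto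
  next
    fix c d' assume cd: "c < d'" "same_part P' c d'"
      and compat: "\<And>a b. same_part P a b \<Longrightarrow> a < b \<Longrightarrow> compat (c, d') (a, b)"
    have closed: "c < a \<and> a \<le> d' \<longleftrightarrow> c < b \<and> b \<le> d'" if "same_part P a b" for a b
      using compat[OF that] compat[OF same_part_sym[OF that]] unfolding compat_def
      by (cases a b rule: linorder_cases) auto
    have "\<not> same_part P c d'" using closed[of c d'] cd(1) by auto
    then have cases: "c \<in> A \<and> d' \<in> B \<or> c \<in> B \<and> d' \<in> A" using cd(2) sp' spA spB by blast
    have "\<not> (c \<in> B \<and> d' \<in> A)"
    proof
      assume h: "c \<in> B \<and> d' \<in> A"
      have "c < Min A" using closed[OF spA[of d' "Min A"]] h cd(1) Min_in[OF fin(1,3)] by blast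
      then show False using min Min_le[OF fin(2), of c] h by simp
    qed
    with cases have cA: "c \<in> A" and dB: "d' \<in> B" by auto
    have all: "c < y \<and> y \<le> d'" if "y \<in> B" for y using closed[OF spB[OF dB that]] cd(1) by blast
    have "d' = d" using all[OF d(1)] d(2)[OF dB] by simp
    moreover have "c = k"
    proof (rule ccontr)
      assume "c \<noteq> k"
      then have "c < k" using kmax[OF cA] all by fastforce
      then show False using closed[OF spA[OF cA k(1)]] k(2)[OF dB] by simp
    qed
    ultimately show "c = k \<and> d' = d" by simp
  qed
qed

text \<open>
  The modules in \<open>step_class\<close> are the \<open>[c, d]\<close> with \<open>c\<close>, \<open>d\<close> in a common part of \<open>P'\<close> that are
  compatible with all chords of \<open>P\<close>.
\<close>

lemma step_class_covers:
  assumes P: "P \<in> Nc (Suc n)" and P': "P' \<in> Nc (Suc n)" and cov: "covers P P'"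
  obtains t where "fst t = stanley_label P P'" "1 \<le> fst t" "fst t < snd t" "snd t \<le> Suc n" "same_part P' (fst t) (snd t)"
    "\<And>a b. same_part P a b \<Longrightarrow> a < b \<Longrightarrow> compat t (a, b)"
    "step_class n (nc_thick n P) (nc_thick n P') = {X :: 'k::field rep. iso_interval n X t}"
proof -
  define k where "k = stanley_label P P'"
  obtain d where d: "k < d" "same_part P' k d" "\<And>a b. same_part P a b \<Longrightarrow> a < b \<Longrightarrow> compat (k, d) (a, b)"
    "\<And>c d'. c < d' \<Longrightarrow> same_part P' c d' \<Longrightarrow> (\<And>a b. same_part P a b \<Longrightarrow> a < b \<Longrightarrow> compat (c, d') (a, b)) \<Longrightarrow> c = k \<and> d' = d"
    using covers_interval[OF P P' cov, folded k_def] by metis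
  note part = Nc_partition[OF P] and part' = Nc_partition[OF P']
  have kd: "1 \<le> k" "d \<le> Suc n" using same_part_in[OF part' d(2)] by auto
  have perp: "X \<in> perp n (nc_cat n P) \<longleftrightarrow> (\<forall>a b. same_part P a b \<and> a < b \<longrightarrow> compat (c, e) (a, b))"
    if X: "iso n X (interval_mod c e)" and c: "1 \<le> c" for X :: "'k rep" and c e
  proof -
    have iff: "bij_down X (a - 1) (b - 1) \<longleftrightarrow> compat (c, e) (a, b)" if "1 \<le> a" "a < b" "b \<le> Suc n" for a b
      using bij_down_iso_interval[of n X "(c, e)" "(a, b)"] X c that by simp
    have "X \<in> perp n (nc_cat n P) \<longleftrightarrow>
        (\<forall>a b. 1 \<le> a \<and> a < b \<and> b \<le> Suc n \<and> same_part P a b \<longrightarrow> compat (c, e) (a, b))"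
      unfolding perp_interval_iff[OF nc_cat_thick iso_rep(1)[OF X]]
      using iff interval_in_nc_cat[OF P, where ?'a = 'k] by blast
    also have "\<dots> \<longleftrightarrow> (\<forall>a b. same_part P a b \<and> a < b \<longrightarrow> compat (c, e) (a, b))"
      using same_part_in[OF part] by fastforce
    finally show ?thesis .
  qed
  have "step_class n (nc_cat n P) (nc_cat n P') = {X :: 'k rep. iso n X (interval_mod k d)}"
    unfolding step_class_def
  proof (intro equalityI subsetI; unfold mem_Collect_eq Int_iff; (elim conjE)?)
    fix X :: "'k rep" assume X: "indecomposable n X" "X \<in> nc_cat n P'" "X \<in> perp n (nc_cat n P)"
    obtain c e where ce: "1 \<le> c" "c < e" "e \<le> Suc n" "iso n X (interval_mod c e)"
      using indecomposable_interval[OF X(1)] by metis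
    have "interval_mod c e \<in> (nc_cat n P' :: 'k rep set)" by (rule thick_iso[OF nc_cat_thick X(2) ce(4)])
    then have "same_part P' c e" using interval_in_nc_cat[OF P' ce(1-3)] by blast
    moreover have "compat (c, e) (a, b)" if "same_part P a b" "a < b" for a b
      using X(3) perp[OF ce(4,1)] that by blast
    ultimately have "c = k \<and> e = d" using d(4)[OF ce(2)] by blast
    then show "iso n X (interval_mod k d)" using ce(4) by simp
  next
    fix X :: "'k rep" assume X: "iso n X (interval_mod k d)"
    have "interval_mod k d \<in> (nc_cat n P' :: 'k rep set)" using interval_in_nc_cat[OF P' kd(1) d(1) kd(2)] d(2) by blast
    then have "X \<in> nc_cat n P'" using thick_iso[OF nc_cat_thick _ iso_sym[OF X]] by blast
    moreover have "X \<in> perp n (nc_cat n P)" using perp[OF X kd(1)] d(3) by blast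
    moreover have "indecomposable n X" by (rule interval_indecomposable[OF X kd(1) d(1) kd(2)])
    ultimately show "indecomposable n X \<and> X \<in> nc_cat n P' \<and> X \<in> perp n (nc_cat n P)" by blast
  qed
  then have "step_class n (nc_thick n P) (nc_thick n P') = {X :: 'k rep. iso_interval n X (k, d)}"
    unfolding nc_thick_eq[OF P] nc_thick_eq[OF P'] by simp
  moreover have "fst (k, d) = stanley_label P P'" by (simp add: k_def)
  ultimately show thesis using kd d(1,2,3) by (intro that[of "(k, d)"]) (simp_all only: fst_conv snd_conv)
qed

section \<open>Socles of exceptional sequences and Stanley's labels\<close>

lemma consecutive_nth:
  "length (consecutive h cs) = length cs - 1"
  "Suc i < length cs \<Longrightarrow> consecutive h cs ! i = h (cs ! i) (cs ! Suc i)"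
  unfolding consecutive_def by (auto simp: nth_butlast nth_tl)

lemma listset_map: "listset (map S ps) = {xs. list_all2 (\<lambda>x p. x \<in> S p) xs ps}"
proof (induction ps)
  case (Cons p ps)
  then show ?case by (auto simp: set_Cons_def list_all2_Cons2)
qed simp

definition iso_class :: "nat \<Rightarrow> (nat \<times> nat) list \<Rightarrow> 'k::field rep list set" where
  "iso_class n ps = {Xs. list_all2 (iso_interval n) Xs ps}"

lemma iso_class_nonempty: "map (\<lambda>p. interval_mod (fst p) (snd p)) ps \<in> iso_class n ps"
  unfolding iso_class_def by (simp add: list_all2_conv_all_nth iso_refl[OF interval_rep])

lemma exc_classes_eq: "exc_classes n = (iso_class n :: _ \<Rightarrow> 'k::field rep list set) ` exc_pairs n"
proof -
  let ?CE = "{Xs :: 'k rep list. complete_exceptional n Xs}"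
  let ?r = "{(Xs, Ys :: 'k rep list). complete_exceptional n Xs \<and> complete_exceptional n Ys \<and> list_all2 (iso n) Xs Ys}"
  have cls: "?r `` {Xs} = iso_class n ps" if ps: "ps \<in> exc_pairs n" and Xs: "Xs \<in> iso_class n ps" for ps and Xs :: "'k rep list"
  proof (intro equalityI subsetI)
    fix Ys assume "Ys \<in> ?r `` {Xs}"
    then have "list_all2 (iso n) Xs Ys" by simp
    moreover have "list_all2 (iso_interval n) Xs ps" using Xs by (simp add: iso_class_def)
    ultimately show "Ys \<in> iso_class n ps"
      unfolding iso_class_def mem_Collect_eq list_all2_conv_all_nth using iso_trans[OF iso_sym] by metis
  next
    fix Ys :: "'k rep list" assume Ys: "Ys \<in> iso_class n ps"
    have X: "list_all2 (iso_interval n) Xs ps" and Y: "list_all2 (iso_interval n) Ys ps"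
      using Xs Ys by (auto simp: iso_class_def)
    have "list_all2 (iso n) Xs Ys"
      using X Y unfolding list_all2_conv_all_nth using iso_trans[OF _ iso_sym] by metis
    then show "Ys \<in> ?r `` {Xs}" using complete_exceptional_of_pairs[OF ps X] complete_exceptional_of_pairs[OF ps Y] by simp
  qed
  show ?thesis
    unfolding exc_classes_def
  proof (intro equalityI subsetI)
    fix E assume "E \<in> ?CE // ?r"
    then obtain Xs where Xs: "complete_exceptional n Xs" "E = ?r `` {Xs}" by (auto elim: quotientE)
    obtain ps where "ps \<in> exc_pairs n" "list_all2 (iso_interval n) Xs ps" by (rule complete_exceptional_pairs[OF Xs(1)])
    then show "E \<in> iso_class n ` exc_pairs n" using cls[of ps Xs] Xs(2) by (auto simp: iso_class_def)
  next
    fix E :: "'k rep list set" assume "E \<in> iso_class n ` exc_pairs n"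
    then obtain ps where ps: "ps \<in> exc_pairs n" "E = iso_class n ps" by blast
    let ?Xs = "map (\<lambda>p. interval_mod (fst p) (snd p)) ps :: 'k rep list"
    have ne: "?Xs \<in> iso_class n ps" by (rule iso_class_nonempty)
    have "complete_exceptional n ?Xs" using ne complete_exceptional_of_pairs[OF ps(1)] by (simp add: iso_class_def)
    then have "?r `` {?Xs} \<in> ?CE // ?r" by (intro quotientI) simp
    then show "E \<in> ?CE // ?r" unfolding cls[OF ps(1) ne] ps(2) .
  qed
qed

lemma soc_class_iso_class:
  assumes ps: "ps \<in> exc_pairs n"
  shows "soc_class n (iso_class n ps :: 'k::field rep list set) = map fst ps"
proof -
  have "soc_seq n Xs = map fst ps" if "Xs \<in> iso_class n ps" for Xs :: "'k rep list"
    using soc_seq_pairs[OF ps] that by (simp add: iso_class_def)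
  then have "soc_seq n ` (iso_class n ps :: 'k rep list set) = {map fst ps}"
    using iso_class_nonempty[of ps n, where ?'a = 'k] by (auto simp: image_iff)
  then show ?thesis by (simp add: soc_class_def)
qed

lemma soc_class_bij: "bij_betw (soc_class n) (exc_classes n :: 'k::field rep list set set) (parking n)"
proof (rule bij_betw_imageI)
  have b: "bij_betw (map fst) (exc_pairs n) (parking n)" by (rule exc_pairs_parking)
  show "inj_on (soc_class n) (exc_classes n :: 'k rep list set set)"
    unfolding exc_classes_eq
  proof (rule inj_onI)
    fix E F :: "'k rep list set"
    assume "E \<in> iso_class n ` exc_pairs n" "F \<in> iso_class n ` exc_pairs n" and eq: "soc_class n E = soc_class n F"
    then obtain ps qs where "ps \<in> exc_pairs n" "E = iso_class n ps" "qs \<in> exc_pairs n" "F = iso_class n qs" by blast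
    then show "E = F"
      using eq bij_betw_imp_inj_on[OF b] by (simp add: soc_class_iso_class inj_on_eq_iff)
  qed
  show "soc_class n ` (exc_classes n :: 'k rep list set set) = parking n"
    unfolding exc_classes_eq image_image
    using soc_class_iso_class[of _ n, where ?'k = 'k] bij_betw_imp_surj_on[OF b] by (simp cong: image_cong)
qed

text \<open>
  The module of a step lies in all later members of the chain of thick subcategories, and the module of a
  later step is perpendicular to the member that this step starts from. Reading the steps from top to bottom therefore gives an
  exceptional sequence.
\<close>

lemma nc_chain_exceptional:
  assumes Ps: "Ps \<in> nc_chains (Suc n)"
  obtains ps where "ps \<in> exc_pairs n" "rev (stanley Ps) = map fst ps"
    "chain_exc n (map (nc_thick n) Ps) = (iso_class n ps :: 'k::field rep list set)"
proof -
  note N = nc_chain_nth(1)[OF Ps] and R = nc_chain_nth(3)[OF Ps] and cov = nc_chain_covers[OF Ps]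
  have len: "length Ps = Suc n" by (rule nc_chain_length[OF Ps]) simp
  let ?Good = "\<lambda>i t. fst t = stanley_label (Ps ! i) (Ps ! Suc i) \<and> 1 \<le> fst t \<and> fst t < snd t \<and> snd t \<le> Suc n
      \<and> same_part (Ps ! Suc i) (fst t) (snd t) \<and> (\<forall>a b. same_part (Ps ! i) a b \<and> a < b \<longrightarrow> compat t (a, b))
      \<and> step_class n (nc_thick n (Ps ! i)) (nc_thick n (Ps ! Suc i)) = {X :: 'k rep. iso_interval n X t}"
  have "\<exists>t. ?Good i t" if i: "i < n" for i
  proof -
    have "Suc i < length Ps" using i len by simp
    from step_class_covers[OF N N cov[OF this], where ?'k = 'k] show ?thesis
      using \<open>Suc i < length Ps\<close> by (metis Suc_lessD)
  qed
  then obtain t where t: "\<And>i. i < n \<Longrightarrow> ?Good i (t i)" by metis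
  let ?ts = "map t [0..<n]"
  have "compat (t j) (t i)" if ij: "i < j" "j < n" for i j
  proof -
    have i: "i < n" using ij by simp
    have "refines {1..Suc n} (Ps ! Suc i) (Ps ! j)" using R[of "Suc i" j] ij len by simp
    moreover have "partition_on {1..Suc n} (Ps ! Suc i)" "partition_on {1..Suc n} (Ps ! j)"
      using Nc_partition[OF N] ij len by simp_all
    moreover have "same_part (Ps ! Suc i) (fst (t i)) (snd (t i))" using t[OF i] by blast
    ultimately have "same_part (Ps ! j) (fst (t i)) (snd (t i))"
      using refines_iff_same_part by blast
    then have "compat (t j) (fst (t i), snd (t i))" using t[OF ij(2)] t[OF i] by blast
    then show ?thesis by simp
  qed
  then have "sorted_wrt compat (rev ?ts)" unfolding sorted_wrt_rev by (simp add: sorted_wrt_iff_nth_less)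
  moreover have "1 \<le> fst (t i) \<and> fst (t i) < snd (t i) \<and> snd (t i) \<le> Suc n" if "i < n" for i
    using t[OF that] by blast
  then have "\<forall>p\<in>set (rev ?ts). 1 \<le> fst p \<and> fst p < snd p \<and> snd p \<le> Suc n" by auto
  ultimately have exc: "rev ?ts \<in> exc_pairs n" unfolding exc_pairs_def compat_seq_def by simp
  have "stanley Ps = map fst ?ts"
    unfolding stanley_def using t len by (intro nth_equalityI) (simp_all add: consecutive_nth)
  then have lab: "rev (stanley Ps) = map fst (rev ?ts)" by (simp add: rev_map)
  have "consecutive (step_class n) (map (nc_thick n) Ps) = map (\<lambda>p. {X :: 'k rep. iso_interval n X p}) ?ts"
    using t len by (intro nth_equalityI) (simp_all add: consecutive_nth)
  then have "chain_exc n (map (nc_thick n) Ps) = (iso_class n (rev ?ts) :: 'k rep list set)"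
    unfolding chain_exc_def iso_class_def rev_map[symmetric] by (simp only: rev_map listset_map mem_Collect_eq)
  with exc lab show thesis by (rule that)
qed

theorem theorem4p5p3p1:
  fixes n :: nat
  assumes "n \<ge> 1"
  shows "(\<forall>Xs :: 'k::field rep list. complete_exceptional n Xs \<longrightarrow> soc_seq n Xs \<in> parking n) \<and>
    bij_betw (soc_class n) (exc_classes n :: 'k rep list set set) (parking n) \<and>
    map (nc_thick n) \<in> nc_chains (n + 1) \<rightarrow> (thick_chains n :: 'k rep set list set) \<and>
    chain_exc n \<in> (thick_chains n :: 'k rep set list set) \<rightarrow> exc_classes n \<and>
    stanley \<in> nc_chains (n + 1) \<rightarrow> parking n \<and>
    (\<forall>Ps \<in> nc_chains (n + 1).
       rev (stanley Ps) = soc_class n (chain_exc n (map (nc_thick n) Ps :: 'k rep set list)))"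
proof -
  have pf: "map fst ps \<in> parking n" if "ps \<in> exc_pairs n" for ps
    using bij_betwE[OF exc_pairs_parking] that by blast
  have chains: "thick_chains n = map (nc_thick n :: _ \<Rightarrow> 'k rep set) ` nc_chains (Suc n)"
    using nc_thick_less_iff by (intro max_chains_image[OF nc_thick_bij])
  show ?thesis
    unfolding Suc_eq_plus1[symmetric]
  proof (intro conjI allI impI ballI Pi_I)
    fix Xs :: "'k rep list" assume "complete_exceptional n Xs"
    then obtain ps where "ps \<in> exc_pairs n" "list_all2 (iso_interval n) Xs ps" by (rule complete_exceptional_pairs)
    then show "soc_seq n Xs \<in> parking n" using soc_seq_pairs[of ps n Xs] pf by simp
  next
    show "bij_betw (soc_class n) (exc_classes n :: 'k rep list set set) (parking n)" by (rule soc_class_bij)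
  next
    fix Ps assume "Ps \<in> nc_chains (Suc n)"
    then show "map (nc_thick n) Ps \<in> (thick_chains n :: 'k rep set list set)" unfolding chains by blast
  next
    fix Cs :: "'k rep set list" assume "Cs \<in> thick_chains n"
    then obtain Ps where Ps: "Ps \<in> nc_chains (Suc n)" "Cs = map (nc_thick n) Ps" unfolding chains by blast
    obtain ps where "ps \<in> exc_pairs n" "chain_exc n Cs = iso_class n ps"
      using nc_chain_exceptional[OF Ps(1), where ?'k = 'k] Ps(2) by metis
    then show "chain_exc n Cs \<in> exc_classes n" unfolding exc_classes_eq by blast
  next
    fix Ps assume Ps: "Ps \<in> nc_chains (Suc n)"
    obtain ps where ps: "ps \<in> exc_pairs n" "rev (stanley Ps) = map fst ps"
      "chain_exc n (map (nc_thick n) Ps) = (iso_class n ps :: 'k rep list set)"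
      by (rule nc_chain_exceptional[OF Ps])
    show "stanley Ps \<in> parking n" using pf[OF ps(1)] parking_rev[of "stanley Ps"] ps(2) by simp
    show "rev (stanley Ps) = soc_class n (chain_exc n (map (nc_thick n) Ps :: 'k rep set list))"
      unfolding ps(2,3) soc_class_iso_class[OF ps(1)] ..
  qed
qed

end
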